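(* Let $N\ge1$ be an integer, $\alpha>0$, and let $H$ be the self-adjoint operator $-\frac{d^2}{dx^2}$ on the infinite star graph with the Exner--Šeba vertex condition, and let $T_{00}(x)$ be its vacuum energy density, both as defined in the context. Then, on each edge $j\in\{1,\dots,N\}$ and for every $x>0$, $$T_{00}(x)=\left(1-\frac2N\right)\frac1{8\pi x^2}+\frac{\alpha}{2\pi N^2x}+\frac{\alpha^2}{\pi N^3}\,e^{2\alpha x/N}\operatorname{Ei}\left(-\frac{2\alpha x}{N}\right).$$
   Context: Operator $H$: on $L^2(0,\infty)^N$, $(Hu)_j=-u_j''$ with domain consisting of all $u=(u_1,\dots,u_N)$ with $u_j\in H^2(0,\infty)$ (Sobolev space) satisfying $u_1(0)=\dots=u_N(0)=:u(0)$ and $\sum_{j=1}^N u_j'(0)=\alpha u(0)$. For $\alpha>0$, $H$ is self-adjoint and nonnegative. The cylinder kernel $G_{Sj}{}^{l}(t,x,y)$, $t>0$, $x,y>0$, is the integral kernel of $e^{-t\sqrt H}$: $(e^{-t\sqrt H}f)_j(x)=\sum_{l=1}^N\int_0^\infty G_{Sj}{}^{l}(t,x,y)f_l(y)\,dy$. Vacuum energy density: for fixed $x>0$ and edge $j$, $T_{00}(x)$ is defined as $-\frac12$ times the coefficient of the term proportional to $t$ in the asymptotic expansion of the diagonal value $G_{Sj}{}^{j}(t,x,x)$ (no summation over $j$) as $t\to0^+$. $\operatorname{Ei}$ is the exponential integral, $\operatorname{Ei}(-z)=-\int_z^\infty\frac{e^{-w}}{w}\,dw$ for $z>0$. *)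

theory Defs
  imports "HOL-Analysis.Analysis" "HOL-Library.Landau_Symbols"
begin

text \<open>
  The edges of the star graph are the elements of a finite type \<open>'n\<close>, so \<open>N = CARD('n)\<close>.
  A wave function is a family of representatives \<open>f j :: real \<Rightarrow> complex\<close>; only the
  values on \<open>{0<..}\<close> matter, and elements of the Hilbert space are such families up to
  equality almost everywhere (\<open>l2_eq\<close>).
\<close>

type_synonym 'n wave = "'n \<Rightarrow> real \<Rightarrow> complex"

abbreviation half_line :: "real measure" where
  "half_line \<equiv> restrict_space lborel {0<..}"

definition L2_half_line :: "(real \<Rightarrow> complex) set" where
  "L2_half_line = {u. u \<in> borel_measurable half_line \<and> integrable half_line (\<lambda>x. (cmod (u x))\<^sup>2)}"

definition L2 :: "'n::finite wave set" where
  "L2 = {f. \<forall>j. f j \<in> L2_half_line}"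

definition l2_inner :: "'n::finite wave \<Rightarrow> 'n wave \<Rightarrow> complex" where
  "l2_inner f g = (\<Sum>j\<in>UNIV. integral\<^sup>L half_line (\<lambda>x. cnj (f j x) * g j x))"

definition l2_norm :: "'n::finite wave \<Rightarrow> real" where
  "l2_norm f = sqrt (\<Sum>j\<in>UNIV. integral\<^sup>L half_line (\<lambda>x. (cmod (f j x))\<^sup>2))"

definition l2_eq :: "'n::finite wave \<Rightarrow> 'n wave \<Rightarrow> bool" where
  "l2_eq f g \<longleftrightarrow> (\<forall>j. AE x in half_line. f j x = g j x)"


section \<open>Sobolev spaces on the half-line\<close>

text \<open>
  Weak derivatives are tested against \<open>C\<^sup>1\<close> functions \<open>p\<close> (with derivative \<open>p'\<close>) whose support is
  a compact subset of \<open>{0<..}\<close>.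
\<close>

definition test_function :: "(real \<Rightarrow> real) \<Rightarrow> (real \<Rightarrow> real) \<Rightarrow> bool" where
  "test_function p p' \<longleftrightarrow>
     (\<forall>x. (p has_real_derivative p' x) (at x)) \<and> continuous_on UNIV p' \<and>
     (\<exists>a b. 0 < a \<and> (\<forall>x. x \<notin> {a..b} \<longrightarrow> p x = 0))"

definition locally_integrable :: "(real \<Rightarrow> complex) \<Rightarrow> bool" where
  "locally_integrable u \<longleftrightarrow> (\<forall>a b. 0 < a \<longrightarrow> set_integrable lborel {a..b} u)"

definition weak_derivative :: "(real \<Rightarrow> complex) \<Rightarrow> (real \<Rightarrow> complex) \<Rightarrow> bool" where
  "weak_derivative u v \<longleftrightarrow> locally_integrable u \<and> locally_integrable v \<and>
     (\<forall>p p'. test_function p p' \<longrightarrow>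
        integral\<^sup>L half_line (\<lambda>x. u x * of_real (p' x)) =
        - integral\<^sup>L half_line (\<lambda>x. v x * of_real (p x)))"

fun sobolev_H :: "nat \<Rightarrow> (real \<Rightarrow> complex) set" where
  "sobolev_H 0 = L2_half_line"
| "sobolev_H (Suc m) = {u \<in> L2_half_line. \<exists>v \<in> sobolev_H m. weak_derivative u v}"

text \<open>The value at \<open>0\<close> of the continuous representative on \<open>{0..}\<close>.\<close>

definition boundary_value :: "(real \<Rightarrow> complex) \<Rightarrow> complex \<Rightarrow> bool" where
  "boundary_value u c \<longleftrightarrow>
     (\<exists>w. continuous_on {0..} w \<and> (AE x in half_line. u x = w x) \<and> w 0 = c)"


section \<open>The Hamiltonian\<close>

text \<open>
  Unbounded operators are represented by their graphs, closed under equality almost everywhere.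
  Below, \<open>u'\<close> is the derivative of \<open>u\<close> and \<open>- g\<close> its second derivative.
\<close>

definition star_hamiltonian :: "real \<Rightarrow> ('n::finite wave \<times> 'n wave) set" where
  "star_hamiltonian \<alpha> = {(u, g). (\<forall>j. u j \<in> sobolev_H 2) \<and> g \<in> L2 \<and>
     (\<exists>u' c d.
        (\<forall>j. weak_derivative (u j) (u' j) \<and> weak_derivative (u' j) (\<lambda>x. - g j x)) \<and>
        (\<forall>j. boundary_value (u j) c \<and> boundary_value (u' j) (d j)) \<and>
        (\<Sum>j\<in>UNIV. d j) = of_real \<alpha> * c)}"


section \<open>Spectral measures and functional calculus\<close>

text \<open>
  A projection-valued measure on the Borel sets of the reals. An everywhere defined symmetric map
  on the Hilbert space is automatically linear and compatible with equality almost everywhere.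
\<close>

definition orthogonal_projection :: "('n::finite wave \<Rightarrow> 'n wave) \<Rightarrow> bool" where
  "orthogonal_projection P \<longleftrightarrow>
     (\<forall>f\<in>L2. P f \<in> L2 \<and> l2_eq (P (P f)) (P f)) \<and>
     (\<forall>f\<in>L2. \<forall>g\<in>L2. l2_inner f (P g) = l2_inner (P f) g)"

definition projection_valued_measure :: "(real set \<Rightarrow> 'n::finite wave \<Rightarrow> 'n wave) \<Rightarrow> bool" where
  "projection_valued_measure E \<longleftrightarrow>
     (\<forall>A\<in>sets borel. orthogonal_projection (E A)) \<and>
     (\<forall>f\<in>L2. l2_eq (E {} f) (\<lambda>j x. 0) \<and> l2_eq (E UNIV f) f) \<and>
     (\<forall>A\<in>sets borel. \<forall>B\<in>sets borel. \<forall>f\<in>L2. l2_eq (E (A \<inter> B) f) (E A (E B f))) \<and>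
     (\<forall>A :: nat \<Rightarrow> real set. range A \<subseteq> sets borel \<longrightarrow> disjoint_family A \<longrightarrow>
        (\<forall>f\<in>L2. (\<lambda>n. l2_norm (\<lambda>j x. E (\<Union>i. A i) f j x - (\<Sum>i<n. E (A i) f j x)))
                   \<longlonglongrightarrow> 0))"

definition scalar_measure ::
    "(real set \<Rightarrow> 'n::finite wave \<Rightarrow> 'n wave) \<Rightarrow> 'n wave \<Rightarrow> real measure" where
  "scalar_measure E f = measure_of UNIV (sets borel) (\<lambda>A. ennreal (Re (l2_inner f (E A f))))"

definition spectral_domain ::
    "(real set \<Rightarrow> 'n::finite wave \<Rightarrow> 'n wave) \<Rightarrow> (real \<Rightarrow> real) \<Rightarrow> 'n wave set" where
  "spectral_domain E \<phi> = {f \<in> L2. integrable (scalar_measure E f) (\<lambda>s. (\<phi> s)\<^sup>2)}"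

text \<open>
  The integral of \<open>\<phi>\<close> against the complex measure \<open>A \<mapsto> l2_inner h (E A f)\<close>, which is expressed by
  polarization through the scalar measures (\<open>l2_inner\<close> is conjugate-linear in the first argument).
\<close>

definition spectral_form ::
    "(real set \<Rightarrow> 'n::finite wave \<Rightarrow> 'n wave) \<Rightarrow> (real \<Rightarrow> real) \<Rightarrow> 'n wave \<Rightarrow> 'n wave \<Rightarrow> complex"
  where
  "spectral_form E \<phi> h f =
     (1 / 4) * (\<Sum>k<4. (- \<i>) ^ k *
        of_real (integral\<^sup>L (scalar_measure E (\<lambda>j x. h j x + \<i> ^ k * f j x)) \<phi>))"

text \<open>
  The graph of the operator \<open>\<integral> \<phi> dE\<close>, for a real Borel function \<open>\<phi>\<close>. Its domain is dense, so
  that testing against the domain determines the image.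
\<close>

definition spectral_integral ::
    "(real set \<Rightarrow> 'n::finite wave \<Rightarrow> 'n wave) \<Rightarrow> (real \<Rightarrow> real) \<Rightarrow> ('n wave \<times> 'n wave) set" where
  "spectral_integral E \<phi> = {(f, g). f \<in> spectral_domain E \<phi> \<and> g \<in> L2 \<and>
     (\<forall>h\<in>spectral_domain E \<phi>. l2_inner h g = spectral_form E \<phi> h f)}"

definition is_spectral_measure_of ::
    "(real set \<Rightarrow> 'n::finite wave \<Rightarrow> 'n wave) \<Rightarrow> ('n wave \<times> 'n wave) set \<Rightarrow> bool" where
  "is_spectral_measure_of E H \<longleftrightarrow>
     projection_valued_measure E \<and> H = spectral_integral E (\<lambda>s. s)"


section \<open>Cylinder kernel and vacuum energy density\<close>

text \<open>
  If \<open>E\<close> is the spectral measure of \<open>H \<ge> 0\<close>, this is the operator \<open>exp (- t \<surd>H)\<close>; the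
  negative half-axis is then a null set for \<open>E\<close>, so the values of \<open>sqrt\<close> there are irrelevant.
\<close>

definition cylinder_operator ::
    "(real set \<Rightarrow> 'n::finite wave \<Rightarrow> 'n wave) \<Rightarrow> real \<Rightarrow> ('n wave \<times> 'n wave) set" where
  "cylinder_operator E t = spectral_integral E (\<lambda>s. exp (- t * sqrt s))"

text \<open>
  An integral kernel is only determined up to null sets; diagonal values refer to the continuous
  version, which is unique for \<open>t, x, y > 0\<close>. The edge \<open>j\<close> belongs to \<open>x\<close> and \<open>l\<close> to \<open>y\<close>.
\<close>

definition is_cylinder_kernel ::
    "(real set \<Rightarrow> 'n::finite wave \<Rightarrow> 'n wave) \<Rightarrow> (real \<Rightarrow> 'n \<Rightarrow> 'n \<Rightarrow> real \<Rightarrow> real \<Rightarrow> complex) \<Rightarrow> bool"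
  where
  "is_cylinder_kernel E G \<longleftrightarrow> (\<forall>t>0.
     (\<forall>j l. continuous_on ({0<..} \<times> {0<..}) (\<lambda>(x, y). G t j l x y)) \<and>
     (\<forall>(f, g)\<in>cylinder_operator E t. \<forall>j. AE x in half_line.
        (\<forall>l. integrable half_line (\<lambda>y. G t j l x y * f l y)) \<and>
        g j x = (\<Sum>l\<in>UNIV. integral\<^sup>L half_line (\<lambda>y. G t j l x y * f l y))))"

definition cylinder_kernel ::
    "(real set \<Rightarrow> 'n::finite wave \<Rightarrow> 'n wave) \<Rightarrow> real \<Rightarrow> 'n \<Rightarrow> 'n \<Rightarrow> real \<Rightarrow> real \<Rightarrow> complex" where
  "cylinder_kernel E = (SOME G. is_cylinder_kernel E G)"

text \<open>
  Asymptotic expansion as \<open>t \<rightarrow> 0+\<close> in integer powers of \<open>t\<close>, starting with \<open>t powi m\<close>;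
  such a coefficient family is unique if it exists.
\<close>

definition has_asymptotic_expansion :: "(real \<Rightarrow> complex) \<Rightarrow> (int \<Rightarrow> complex) \<Rightarrow> bool" where
  "has_asymptotic_expansion F a \<longleftrightarrow> (\<exists>m. (\<forall>k<m. a k = 0) \<and>
     (\<forall>M. (\<lambda>t. F t - (\<Sum>k=m..M. a k * of_real (t powi k)))
             \<in> o[at_right 0](\<lambda>t. of_real (t powi M))))"

definition asymptotic_coeff :: "(real \<Rightarrow> complex) \<Rightarrow> int \<Rightarrow> complex" where
  "asymptotic_coeff F k = (THE c. \<exists>a. has_asymptotic_expansion F a \<and> a k = c)"

definition vacuum_energy_density ::
    "(real set \<Rightarrow> 'n::finite wave \<Rightarrow> 'n wave) \<Rightarrow> 'n \<Rightarrow> real \<Rightarrow> complex" where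
  "vacuum_energy_density E j x =
     - (1 / 2) * asymptotic_coeff (\<lambda>t. cylinder_kernel E t j j x x) 1"

text \<open>The exponential integral on the negative half-axis; only used for negative arguments.\<close>

definition Ei :: "real \<Rightarrow> real" where
  "Ei z = - set_lebesgue_integral lborel {- z..} (\<lambda>w. exp (- w) / w)"

end

(*
  Both sides of the claim are compared through resolvents at negative energies. For kappa > 0 the
  resolvent (H + kappa^2)^-1 has an elementary kernel (a Dirichlet part on each edge plus a multiple of
  exp (- kappa (x + y)), the same for all pairs of edges), and localizing H = \<integral> s dE on bounded Borel sets
  shows <f, (H + kappa^2)^-1 f> = \<integral> 1 / (s + kappa^2) d<f, E f>; boundedness of the resolvents also excludes
  negative spectrum. Since exp (- t sqrt s) = 2 / pi * \<integral> kappa sin (t kappa) / (s + kappa^2) d kappa (Abel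
  summed by a factor exp (- epsilon kappa)), integrating the resolvent kernels over kappa turns every
  exp (- kappa r) into the Poisson kernel t / (t^2 + r^2). Hence the cylinder kernel is a superposition of
  Poisson kernels, and its diagonal is expanded in odd powers of t by the geometric series.
*)

theory Submission
  imports Defs "HOL-Real_Asymp.Real_Asymp"
begin

text \<open>\<open>spectral_integral\<close> gives only a weak identity, polarized into scalar
  measures, so operator identities are read off from these positive measures. Testing (H + c) u = f
  against \<open>E A v\<close> with \<open>A\<close> bounded expresses Re <v, E A f> through the
  integrals over \<open>A\<close> of s + c against the measures of v + u and v - u. Taking v = u and
  then v = f yields d \<mu> f = (s + c)^2 d \<mu> u on \<open>A\<close>. The resolvent enters as a
  bounded right inverse of H + c. The vertex condition fixes the remaining constant of its kernel:
  edge values B and outgoing derivatives \<open>I j\<close> - \<kappa> B give B = (sum of all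
  \<open>I j\<close>) / (N \<kappa> + \<alpha>). Together with the factor \<kappa> of the weight
  this becomes (1 - \<alpha> / (N \<kappa> + \<alpha>)) / N, and writing 1 / (N \<kappa> + \<alpha>)
  as a Laplace integral over q moves r to r + N q. At order t this leaves the integral of exp (-
  \<alpha> q) / (r + N q)^2, which one integration by parts reduces to Ei. The cylinder kernel is
  picked by \<open>SOME\<close>, so both existence and uniqueness of a continuous kernel have to be
  shown.\<close>

section \<open>Measurability and square integrability on the half-line\<close>

lemma sigma_finite_half_line: "sigma_finite_measure half_line"
  by (rule sigma_finite_measure_restrict_space) (auto intro: lborel.sigma_finite_measure_axioms)

interpretation half_line: sigma_finite_measure half_line
  by (rule sigma_finite_half_line)

interpretation half_line2: pair_sigma_finite half_line half_line ..

lemma measurable_ident_half_line: "(\<lambda>x. x) \<in> borel_measurable half_line"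
  by (simp add: measurable_restrict_space1)

lemma borel_measurable_cnj [measurable (raw)]:
  "f \<in> borel_measurable M \<Longrightarrow> (\<lambda>x. cnj (f x)) \<in> borel_measurable M"
  by (rule borel_measurable_continuous_on) (auto intro: continuous_intros)

lemma L2_half_line_measurable [measurable_dest]: "u \<in> L2_half_line \<Longrightarrow> u \<in> borel_measurable half_line"
  by (simp add: L2_half_line_def)

lemma L2_half_line_square: "u \<in> L2_half_line \<Longrightarrow> integrable half_line (\<lambda>x. (cmod (u x))\<^sup>2)"
  by (simp add: L2_half_line_def)

lemma L2_half_lineI:
  "u \<in> borel_measurable half_line \<Longrightarrow> integrable half_line (\<lambda>x. (cmod (u x))\<^sup>2) \<Longrightarrow> u \<in> L2_half_line"
  by (simp add: L2_half_line_def)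

lemma two_mult_le_squares: "2 * (a * b) \<le> a\<^sup>2 + (b::real)\<^sup>2"
  using sum_squares_bound[of a b] by (simp add: mult.assoc)

lemma integrable_mult_L2_half_line:
  assumes "u \<in> L2_half_line" "v \<in> L2_half_line"
  shows "integrable half_line (\<lambda>x. u x * v x)"
proof (rule Bochner_Integration.integrable_bound)
  show "integrable half_line (\<lambda>x. (cmod (u x))\<^sup>2 + (cmod (v x))\<^sup>2)"
    using assms by (auto simp: L2_half_line_def)
  show "(\<lambda>x. u x * v x) \<in> borel_measurable half_line"
    using assms by measurable
  have "cmod (u x) * cmod (v x) \<le> (cmod (u x))\<^sup>2 + (cmod (v x))\<^sup>2" for x
    using two_mult_le_squares[of "cmod (u x)" "cmod (v x)"]
    by (smt (verit) mult_nonneg_nonneg norm_ge_zero)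
  then show "AE x in half_line. norm (u x * v x) \<le> norm ((cmod (u x))\<^sup>2 + (cmod (v x))\<^sup>2)"
    by (auto simp: norm_mult)
qed

lemma cnj_L2_half_line: "u \<in> L2_half_line \<Longrightarrow> (\<lambda>x. cnj (u x)) \<in> L2_half_line"
  by (auto simp: L2_half_line_def)

lemma add_L2_half_line:
  assumes "u \<in> L2_half_line" "v \<in> L2_half_line"
  shows "(\<lambda>x. u x + v x) \<in> L2_half_line"
proof (rule L2_half_lineI)
  show "(\<lambda>x. u x + v x) \<in> borel_measurable half_line"
    using assms by measurable
  have bound: "(cmod (a + b))\<^sup>2 \<le> 2 * (cmod a)\<^sup>2 + 2 * (cmod b)\<^sup>2" for a b :: complex
  proof -
    have "(cmod (a + b))\<^sup>2 \<le> (cmod a + cmod b)\<^sup>2"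
      by (simp add: norm_triangle_ineq power_mono)
    then show ?thesis
      using two_mult_le_squares[of "cmod a" "cmod b"] by (simp add: power2_sum)
  qed
  show "integrable half_line (\<lambda>x. (cmod (u x + v x))\<^sup>2)"
  proof (rule Bochner_Integration.integrable_bound)
    show "integrable half_line (\<lambda>x. 2 * (cmod (u x))\<^sup>2 + 2 * (cmod (v x))\<^sup>2)"
      using assms by (auto simp: L2_half_line_def)
    show "(\<lambda>x. (cmod (u x + v x))\<^sup>2) \<in> borel_measurable half_line"
      using assms by measurable
  qed (use bound in auto)
qed

lemma scale_L2_half_line:
  assumes "u \<in> L2_half_line"
  shows "(\<lambda>x. c * u x) \<in> L2_half_line"
  using assms by (auto simp: L2_half_line_def norm_mult power_mult_distrib)

lemma diff_L2_half_line:
  assumes "u \<in> L2_half_line" "v \<in> L2_half_line"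
  shows "(\<lambda>x. u x - v x) \<in> L2_half_line"
  using add_L2_half_line[OF assms(1) scale_L2_half_line[OF assms(2), of "-1"]] by simp

section \<open>The Hilbert space of the star graph\<close>

lemma L2_D: "f \<in> L2 \<Longrightarrow> f j \<in> L2_half_line"
  by (simp add: L2_def)

lemma add_L2: "f \<in> L2 \<Longrightarrow> g \<in> L2 \<Longrightarrow> (\<lambda>j x. f j x + g j x) \<in> L2"
  by (auto simp: L2_def intro: add_L2_half_line)

lemma scale_L2: "f \<in> L2 \<Longrightarrow> (\<lambda>j x. c * f j x) \<in> L2"
  by (auto simp: L2_def intro: scale_L2_half_line)

lemma diff_L2: "f \<in> L2 \<Longrightarrow> g \<in> L2 \<Longrightarrow> (\<lambda>j x. f j x - g j x) \<in> L2"
  by (auto simp: L2_def intro: diff_L2_half_line)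

lemma zero_L2: "(\<lambda>j x. 0) \<in> L2"
  by (auto simp: L2_def L2_half_line_def)

lemma sum_L2:
  assumes "\<And>i. i \<in> I \<Longrightarrow> f i \<in> L2"
  shows "(\<lambda>j x. \<Sum>i\<in>I. f i j x) \<in> L2"
  using assms by (induction I rule: infinite_finite_induct) (auto intro: zero_L2 add_L2)

lemma l2_inner_integrable:
  assumes "f \<in> L2" "g \<in> L2"
  shows "integrable half_line (\<lambda>x. cnj (f j x) * g j x)"
  using assms by (intro integrable_mult_L2_half_line cnj_L2_half_line L2_D)

lemma l2_inner_add_right:
  assumes "h \<in> L2" "f \<in> L2" "g \<in> L2"
  shows "l2_inner h (\<lambda>j x. f j x + g j x) = l2_inner h f + l2_inner h g"
  using assms by (simp add: l2_inner_def distrib_left l2_inner_integrable sum.distrib)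

lemma l2_inner_scale_right: "l2_inner h (\<lambda>j x. c * f j x) = c * l2_inner h f"
  by (simp add: l2_inner_def mult.left_commute[of _ c] sum_distrib_left)

lemma l2_inner_cnj: "cnj (l2_inner f g) = l2_inner g f"
proof -
  have "cnj (LINT x|half_line. cnj (f j x) * g j x) = (LINT x|half_line. cnj (g j x) * f j x)" for j
  proof -
    have "cnj (LINT x|half_line. cnj (f j x) * g j x) = (LINT x|half_line. cnj (cnj (f j x) * g j x))"
      by (rule Bochner_Integration.integral_cnj[symmetric])
    also have "(\<lambda>x. cnj (cnj (f j x) * g j x)) = (\<lambda>x. cnj (g j x) * f j x)"
      by (simp add: mult.commute)
    finally show ?thesis .
  qed
  then show ?thesis by (simp add: l2_inner_def)
qed

lemma l2_inner_diff_right: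
  assumes "h \<in> L2" "f \<in> L2" "g \<in> L2"
  shows "l2_inner h (\<lambda>j x. f j x - g j x) = l2_inner h f - l2_inner h g"
  using assms by (simp add: l2_inner_def right_diff_distrib l2_inner_integrable sum_subtractf)

lemma l2_inner_sum_right:
  assumes "h \<in> L2" "\<And>i. i \<in> I \<Longrightarrow> f i \<in> L2"
  shows "l2_inner h (\<lambda>j x. \<Sum>i\<in>I. f i j x) = (\<Sum>i\<in>I. l2_inner h (f i))"
  using assms
proof (induction I rule: infinite_finite_induct)
  case (insert i I)
  then have "l2_inner h (\<lambda>j x. f i j x + (\<Sum>i\<in>I. f i j x)) = l2_inner h (f i) + (\<Sum>i\<in>I. l2_inner h (f i))"
    by (subst l2_inner_add_right) (auto intro: sum_L2)
  then show ?case using insert by simp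
qed (auto simp: l2_inner_def)

lemma l2_inner_add_left:
  assumes "h \<in> L2" "f \<in> L2" "g \<in> L2"
  shows "l2_inner (\<lambda>j x. f j x + g j x) h = l2_inner f h + l2_inner g h"
  unfolding l2_inner_cnj[of h, symmetric] by (simp add: l2_inner_add_right assms)

lemma l2_inner_scale_left: "l2_inner (\<lambda>j x. c * f j x) h = cnj c * l2_inner f h"
  unfolding l2_inner_cnj[of h, symmetric] by (simp add: l2_inner_scale_right)

lemma l2_inner_self: "l2_inner f f = of_real ((l2_norm f)\<^sup>2)"
proof -
  have "l2_inner f f = of_real (\<Sum>j\<in>UNIV. integral\<^sup>L half_line (\<lambda>x. (cmod (f j x))\<^sup>2))"
    unfolding l2_inner_def of_real_sum
  proof (rule sum.cong[OF refl])
    fix j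
    have "(\<lambda>x. cnj (f j x) * f j x) = (\<lambda>x. of_real ((cmod (f j x))\<^sup>2))"
      by (simp add: complex_norm_square mult.commute del: of_real_power)
    then show "(LINT x|half_line. cnj (f j x) * f j x)
        = of_real (LINT x|half_line. (cmod (f j x))\<^sup>2)"
      using integral_complex_of_real by metis
  qed
  moreover have "0 \<le> (\<Sum>j\<in>UNIV. integral\<^sup>L half_line (\<lambda>x. (cmod (f j x))\<^sup>2))"
    by (intro sum_nonneg) auto
  ultimately show ?thesis by (simp add: l2_norm_def)
qed

lemma l2_norm_nonneg: "l2_norm f \<ge> 0"
  unfolding l2_norm_def by (intro real_sqrt_ge_zero sum_nonneg) auto

lemma l2_norm_square: "(l2_norm f)\<^sup>2 = (\<Sum>j\<in>UNIV. LINT x|half_line. (cmod (f j x))\<^sup>2)"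
  unfolding l2_norm_def by (intro real_sqrt_pow2 sum_nonneg) auto

lemma l2_inner_eq_if_l2_eq:
  assumes "l2_eq f g" "f \<in> L2" "g \<in> L2" "h \<in> L2"
  shows "l2_inner h f = l2_inner h g"
  unfolding l2_inner_def
proof (rule sum.cong[OF refl])
  fix j
  have [measurable]: "f j \<in> borel_measurable half_line" "g j \<in> borel_measurable half_line"
    "h j \<in> borel_measurable half_line"
    using assms by (auto dest: L2_D simp: L2_half_line_def)
  show "(LINT x|half_line. cnj (h j x) * f j x) = (LINT x|half_line. cnj (h j x) * g j x)"
    using assms(1) by (intro integral_cong_AE) (auto simp: l2_eq_def)
qed

lemma l2_eq_if_norm_zero:
  assumes "f \<in> L2" "l2_norm f = 0"
  shows "l2_eq f (\<lambda>j x. 0)"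
  unfolding l2_eq_def
proof
  fix j
  have "(\<Sum>j\<in>UNIV. LINT x|half_line. (cmod (f j x))\<^sup>2) = 0"
    using l2_norm_square[of f] assms(2) by simp
  then have "(LINT x|half_line. (cmod (f j x))\<^sup>2) = 0"
    by (subst (asm) sum_nonneg_eq_0_iff) auto
  moreover have "integrable half_line (\<lambda>x. (cmod (f j x))\<^sup>2)"
    using assms(1) by (auto simp: L2_def L2_half_line_def)
  ultimately have "AE x in half_line. (cmod (f j x))\<^sup>2 = 0"
    by (subst (asm) integral_nonneg_eq_0_iff_AE) auto
  then show "AE x in half_line. f j x = 0" by auto
qed

lemma l2_eqI:
  assumes "f \<in> L2" "g \<in> L2" "\<And>h. h \<in> L2 \<Longrightarrow> l2_inner h f = l2_inner h g"
  shows "l2_eq f g"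
proof -
  let ?d = "\<lambda>j x. f j x - g j x"
  have d: "?d \<in> L2" by (intro diff_L2 assms)
  have "l2_inner ?d ?d = 0"
    using assms d by (subst l2_inner_diff_right) auto
  then have "l2_norm ?d = 0" by (simp add: l2_inner_self)
  from l2_eq_if_norm_zero[OF d this] show ?thesis by (simp add: l2_eq_def)
qed

lemma norm_l2_inner_le_squares:
  assumes "f \<in> L2" "g \<in> L2"
  shows "2 * cmod (l2_inner f g) \<le> (l2_norm f)\<^sup>2 + (l2_norm g)\<^sup>2"
proof -
  have "2 * cmod (l2_inner f g) \<le> 2 * (\<Sum>j\<in>UNIV. LINT x|half_line. cmod (cnj (f j x) * g j x))"
    unfolding l2_inner_def
    by (intro mult_left_mono order.trans[OF norm_sum] sum_mono integral_norm_bound) auto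
  also have "\<dots> = (\<Sum>j\<in>UNIV. LINT x|half_line. 2 * cmod (cnj (f j x) * g j x))"
    by (simp add: sum_distrib_left)
  also have "\<dots> \<le> (\<Sum>j\<in>UNIV. LINT x|half_line. (cmod (f j x))\<^sup>2 + (cmod (g j x))\<^sup>2)"
  proof (intro sum_mono integral_mono)
    fix j
    show "integrable half_line (\<lambda>x. 2 * cmod (cnj (f j x) * g j x))"
      by (intro integrable_mult_right integrable_norm l2_inner_integrable assms)
    show "integrable half_line (\<lambda>x. (cmod (f j x))\<^sup>2 + (cmod (g j x))\<^sup>2)"
      using assms by (auto simp: L2_def L2_half_line_def)
    show "2 * cmod (cnj (f j x) * g j x) \<le> (cmod (f j x))\<^sup>2 + (cmod (g j x))\<^sup>2" for x
      using two_mult_le_squares[of "cmod (f j x)" "cmod (g j x)"] by (simp add: norm_mult)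
  qed
  also have "\<dots> = (l2_norm f)\<^sup>2 + (l2_norm g)\<^sup>2"
    using assms by (simp add: l2_norm_square L2_def L2_half_line_def sum.distrib)
  finally show ?thesis .
qed

lemma l2_norm_scale: "l2_norm (\<lambda>j x. c * f j x) = cmod c * l2_norm f"
  unfolding l2_norm_def norm_mult power_mult_distrib integral_mult_right_zero
    sum_distrib_left[symmetric] real_sqrt_mult by simp

text \<open>The additive bound is applied to \<open>f\<close> and r g with r =
  \<open>l2_norm f / l2_norm g\<close>, which makes both squares on its right side equal. Vectors of
  norm zero vanish almost everywhere and are treated first.\<close>

lemma l2_Cauchy_Schwarz:
  assumes "f \<in> L2" "g \<in> L2"
  shows "cmod (l2_inner f g) \<le> l2_norm f * l2_norm g"
proof -
  have *: "2 * (r * cmod (l2_inner f g)) \<le> (l2_norm f)\<^sup>2 + r\<^sup>2 * (l2_norm g)\<^sup>2" if "r \<ge> 0" for r :: real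
    using norm_l2_inner_le_squares[OF assms(1) scale_L2[OF assms(2)], of "of_real r"] that
    by (simp add: l2_inner_scale_right norm_mult l2_norm_scale power_mult_distrib)
  show ?thesis
  proof (cases "l2_norm g = 0")
    case True
    have "l2_eq g (\<lambda>j x. 0)" using True assms by (intro l2_eq_if_norm_zero)
    then have "l2_inner f g = l2_inner f (\<lambda>j x. 0)"
      using assms zero_L2 by (intro l2_inner_eq_if_l2_eq)
    then show ?thesis using True by (simp add: l2_inner_def)
  next
    case False
    then have g: "l2_norm g > 0" using l2_norm_nonneg[of g] by simp
    show ?thesis
    proof (cases "l2_norm f = 0")
      case True
      have "l2_eq f (\<lambda>j x. 0)" using True assms by (intro l2_eq_if_norm_zero)
      then have "l2_inner g f = l2_inner g (\<lambda>j x. 0)"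
        using assms zero_L2 by (intro l2_inner_eq_if_l2_eq)
      then have "l2_inner f g = 0" using l2_inner_cnj[of g f] by (simp add: l2_inner_def)
      then show ?thesis using True by simp
    next
      case False
      then have f: "l2_norm f > 0" using l2_norm_nonneg[of f] by simp
      let ?r = "l2_norm f / l2_norm g"
      have "2 * (?r * cmod (l2_inner f g)) \<le> (l2_norm f)\<^sup>2 + ?r\<^sup>2 * (l2_norm g)\<^sup>2"
        using f g by (intro *) simp
      also have "?r\<^sup>2 * (l2_norm g)\<^sup>2 = (l2_norm f)\<^sup>2"
        using g by (simp add: power_divide)
      finally have "?r * cmod (l2_inner f g) \<le> ?r * (l2_norm f * l2_norm g)"
        using g by (simp add: power2_eq_square)
      then show ?thesis using f g by (subst (asm) mult_le_cancel_left_pos) auto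
    qed
  qed
qed

section \<open>Integrals over the half-line\<close>

lemma half_line_integral_eq_interval:
  fixes f :: "real \<Rightarrow> real"
  shows "(LBINT x=ereal 0..\<infinity>. f x) = (LINT x|half_line. f x)"
    and "set_integrable lborel (einterval (ereal 0) \<infinity>) f \<longleftrightarrow> integrable half_line f"
proof -
  have "einterval (ereal 0) \<infinity> = {0<..}" by (auto simp: einterval_def)
  then show "(LBINT x=ereal 0..\<infinity>. f x) = (LINT x|half_line. f x)"
    "set_integrable lborel (einterval (ereal 0) \<infinity>) f \<longleftrightarrow> integrable half_line f"
    by (simp_all add: interval_lebesgue_integral_def set_lebesgue_integral_def set_integrable_def
        integral_restrict_space integrable_restrict_space)
qed

lemma half_line_FTC:
  fixes f F :: "real \<Rightarrow> real"
  assumes "\<And>x. x > 0 \<Longrightarrow> (F has_real_derivative f x) (at x)" "\<And>x. x > 0 \<Longrightarrow> isCont f x"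
    "integrable half_line f" "(F \<longlongrightarrow> A) (at_right 0)" "(F \<longlongrightarrow> B) at_top"
  shows "(LINT x|half_line. f x) = B - A"
  unfolding half_line_integral_eq_interval(1)[symmetric]
proof (rule interval_integral_FTC_integrable[where F=F])
  show "set_integrable lborel (einterval (ereal 0) \<infinity>) f"
    unfolding half_line_integral_eq_interval(2) by fact
qed (use assms in \<open>auto simp: ereal_tendsto_simps has_real_derivative_iff_has_vector_derivative[symmetric]\<close>)

text \<open>For a nonnegative integrand, limits of the antiderivative at both ends already force
  integrability. This supplies the two basic majorants, the exponential and the Poisson
  kernel.\<close>

lemma half_line_FTC_nonneg:
  fixes f F :: "real \<Rightarrow> real"
  assumes "\<And>x. x > 0 \<Longrightarrow> (F has_real_derivative f x) (at x)" "\<And>x. x > 0 \<Longrightarrow> isCont f x"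
    "\<And>x. x > 0 \<Longrightarrow> 0 \<le> f x" "(F \<longlongrightarrow> A) (at_right 0)" "(F \<longlongrightarrow> B) at_top"
  shows "integrable half_line f" "(LINT x|half_line. f x) = B - A"
proof -
  have *: "0 < (\<infinity>::ereal)" by simp
  note FTC = interval_integral_FTC_nonneg[of "ereal 0" \<infinity> F f A B, simplified ereal_tendsto_simps]
  show "integrable half_line f"
    unfolding half_line_integral_eq_interval(2)[symmetric]
    by (rule FTC(1)) (use assms in \<open>auto simp: ereal_tendsto_simps\<close>)
  show "(LINT x|half_line. f x) = B - A"
    unfolding half_line_integral_eq_interval(1)[symmetric]
    by (rule FTC(2)) (use assms in \<open>auto simp: ereal_tendsto_simps\<close>)
qed

lemma half_line_exp:
  assumes "r > 0"
  shows "integrable half_line (\<lambda>x. exp (- r * x))" "(LINT x|half_line. exp (- r * x)) = 1 / r"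
proof -
  let ?F = "\<lambda>x. - exp (- r * x) / r"
  have 1: "(?F has_real_derivative exp (- r * x)) (at x)" for x
    using assms by (auto intro!: derivative_eq_intros)
  have 2: "(?F \<longlongrightarrow> - 1 / r) (at_right 0)"
  proof -
    have "isCont ?F 0" using assms by (intro continuous_intros) auto
    then show ?thesis by (auto simp: isCont_def intro: tendsto_within_subset)
  qed
  have 3: "(?F \<longlongrightarrow> 0) at_top"
    using assms by real_asymp
  show "integrable half_line (\<lambda>x. exp (- r * x))"
    by (rule half_line_FTC_nonneg[OF 1 _ _ 2 3]) auto
  have "(LINT x|half_line. exp (- r * x)) = 0 - (- 1 / r)"
    by (rule half_line_FTC_nonneg[OF 1 _ _ 2 3]) auto
  then show "(LINT x|half_line. exp (- r * x)) = 1 / r" by simp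
qed

lemma half_line_integrable_bound:
  fixes f :: "real \<Rightarrow> 'a::{banach, second_countable_topology}" and g :: "real \<Rightarrow> real"
  assumes "integrable half_line g" "f \<in> borel_measurable half_line" "\<And>x. x > 0 \<Longrightarrow> norm (f x) \<le> g x"
  shows "integrable half_line f"
  using assms(1,2)
  by (rule Bochner_Integration.integrable_bound) (auto intro!: AE_I2 order.trans[OF assms(3)])

lemma half_line_measurable: "f \<in> borel_measurable borel \<Longrightarrow> f \<in> borel_measurable half_line"
  by (simp add: measurable_restrict_space1)

lemma half_line_Laplace_sin:
  assumes "r > 0"
  shows "integrable half_line (\<lambda>x. exp (- r * x) * sin (c * x))"
    "(LINT x|half_line. exp (- r * x) * sin (c * x)) = c / (c\<^sup>2 + r\<^sup>2)"
proof -
  let ?F = "\<lambda>x. 1 / (c\<^sup>2 + r\<^sup>2) * (- exp (- r * x) * (r * sin (c * x) + c * cos (c * x)))"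
  have pos: "0 < c\<^sup>2 + r\<^sup>2" using assms by (simp add: add_nonneg_pos)
  show int: "integrable half_line (\<lambda>x. exp (- r * x) * sin (c * x))"
    by (rule half_line_integrable_bound[OF half_line_exp(1)[OF assms]])
      (auto intro!: half_line_measurable simp: abs_mult)
  have "(?F has_real_derivative exp (- r * x) * sin (c * x)) (at x)" for x
    using pos by (auto intro!: derivative_eq_intros simp: divide_simps;
      simp add: algebra_simps power2_eq_square)
  moreover have "(?F \<longlongrightarrow> - c / (c\<^sup>2 + r\<^sup>2)) (at_right 0)"
  proof -
    have "isCont ?F 0" using pos by (intro continuous_intros) auto
    then show ?thesis by (auto simp: isCont_def intro: tendsto_within_subset)
  qed
  moreover have "(?F \<longlongrightarrow> 0) at_top"
  proof (rule Lim_null_comparison)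
    show "((\<lambda>x. exp (- r * x) * ((\<bar>r\<bar> + \<bar>c\<bar>) / (c\<^sup>2 + r\<^sup>2))) \<longlongrightarrow> 0) at_top"
      using assms by (intro tendsto_mult_left_zero) real_asymp
    have "\<bar>r * sin (c * x) + c * cos (c * x)\<bar> \<le> \<bar>r\<bar> * 1 + \<bar>c\<bar> * 1" for x
      by (intro order.trans[OF abs_triangle_ineq] add_mono) (auto simp: abs_mult intro!: mult_left_le)
    then show "\<forall>\<^sub>F x in at_top. norm (?F x) \<le> exp (- r * x) * ((\<bar>r\<bar> + \<bar>c\<bar>) / (c\<^sup>2 + r\<^sup>2))"
      using pos by (intro always_eventually allI) (auto simp: abs_mult divide_simps)
  qed
  ultimately have "(LINT x|half_line. exp (- r * x) * sin (c * x)) = 0 - (- c / (c\<^sup>2 + r\<^sup>2))"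
    by (intro half_line_FTC[OF _ _ int]) (auto intro!: continuous_intros)
  then show "(LINT x|half_line. exp (- r * x) * sin (c * x)) = c / (c\<^sup>2 + r\<^sup>2)" by simp
qed

lemma half_line_Laplace_cos:
  assumes "r > 0"
  shows "integrable half_line (\<lambda>x. exp (- r * x) * cos (c * x))"
    "(LINT x|half_line. exp (- r * x) * cos (c * x)) = r / (c\<^sup>2 + r\<^sup>2)"
proof -
  let ?F = "\<lambda>x. 1 / (c\<^sup>2 + r\<^sup>2) * (exp (- r * x) * (c * sin (c * x) - r * cos (c * x)))"
  have pos: "0 < c\<^sup>2 + r\<^sup>2" using assms by (simp add: add_nonneg_pos)
  show int: "integrable half_line (\<lambda>x. exp (- r * x) * cos (c * x))"
    by (rule half_line_integrable_bound[OF half_line_exp(1)[OF assms]])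
      (auto intro!: half_line_measurable simp: abs_mult)
  have "(?F has_real_derivative exp (- r * x) * cos (c * x)) (at x)" for x
    using pos by (auto intro!: derivative_eq_intros simp: divide_simps;
      simp add: algebra_simps power2_eq_square)
  moreover have "(?F \<longlongrightarrow> - r / (c\<^sup>2 + r\<^sup>2)) (at_right 0)"
  proof -
    have "isCont ?F 0" using pos by (intro continuous_intros) auto
    then show ?thesis by (auto simp: isCont_def intro: tendsto_within_subset)
  qed
  moreover have "(?F \<longlongrightarrow> 0) at_top"
  proof (rule Lim_null_comparison)
    show "((\<lambda>x. exp (- r * x) * ((\<bar>c\<bar> + \<bar>r\<bar>) / (c\<^sup>2 + r\<^sup>2))) \<longlongrightarrow> 0) at_top"
      using assms by (intro tendsto_mult_left_zero) real_asymp
    have "\<bar>c * sin (c * x) - r * cos (c * x)\<bar> \<le> \<bar>c\<bar> * 1 + \<bar>r\<bar> * 1" for x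
      by (intro order.trans[OF abs_triangle_ineq4] add_mono) (auto simp: abs_mult intro!: mult_left_le)
    then show "\<forall>\<^sub>F x in at_top. norm (?F x) \<le> exp (- r * x) * ((\<bar>c\<bar> + \<bar>r\<bar>) / (c\<^sup>2 + r\<^sup>2))"
      using pos by (intro always_eventually allI) (auto simp: abs_mult divide_simps)
  qed
  ultimately have "(LINT x|half_line. exp (- r * x) * cos (c * x)) = 0 - (- r / (c\<^sup>2 + r\<^sup>2))"
    by (intro half_line_FTC[OF _ _ int]) (auto intro!: continuous_intros)
  then show "(LINT x|half_line. exp (- r * x) * cos (c * x)) = r / (c\<^sup>2 + r\<^sup>2)" by simp
qed

text \<open>Up to the factor 1 / pi this is the Poisson kernel of the upper half-plane at height t
  and horizontal distance r. It is also the value of \<open>half_line_Laplace_sin\<close>, the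
  Laplace transform of sin (t k) at r.\<close>

definition poisson :: "real \<Rightarrow> real \<Rightarrow> real" where
  "poisson t r = t / (t\<^sup>2 + r\<^sup>2)"

lemma poisson_measurable [measurable]: "poisson t \<in> borel_measurable borel"
  unfolding poisson_def by measurable

lemma poisson_nonneg: "t > 0 \<Longrightarrow> 0 \<le> poisson t r"
  by (simp add: poisson_def)

lemma poisson_denom_pos: "t > 0 \<Longrightarrow> 0 < t\<^sup>2 + (r::real)\<^sup>2"
  by (simp add: add_pos_nonneg)

lemma poisson_mono: "t > 0 \<Longrightarrow> 0 \<le> r \<Longrightarrow> r \<le> s \<Longrightarrow> poisson t s \<le> poisson t r"
  unfolding poisson_def by (intro divide_left_mono mult_pos_pos poisson_denom_pos add_left_mono power_mono) auto

lemma half_line_poisson: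
  assumes "t > 0"
  shows "integrable half_line (poisson t)" "(LINT x|half_line. poisson t x) = pi / 2"
proof -
  let ?F = "\<lambda>x. arctan (x / t)"
  have 1: "(?F has_real_derivative poisson t x) (at x)" for x
    using assms poisson_denom_pos[OF assms, of x]
    by (auto intro!: derivative_eq_intros simp: poisson_def field_simps power2_eq_square)
  have 2: "(?F \<longlongrightarrow> 0) (at_right 0)"
  proof -
    have "isCont ?F 0" using assms by (intro continuous_intros) auto
    then show ?thesis by (auto simp: isCont_def intro: tendsto_within_subset)
  qed
  have "filterlim (\<lambda>x. x / t) at_top at_top"
    using assms by real_asymp
  then have 3: "(?F \<longlongrightarrow> pi / 2) at_top"
    by (rule filterlim_compose[OF tendsto_arctan_at_top])
  have 4: "isCont (poisson t) x" for x
    unfolding poisson_def using poisson_denom_pos[OF assms, of x]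
    by (intro continuous_intros) auto
  show "integrable half_line (poisson t)"
    by (rule half_line_FTC_nonneg[OF 1 4 poisson_nonneg[OF assms] 2 3])
  have "(LINT x|half_line. poisson t x) = pi / 2 - 0"
    by (rule half_line_FTC_nonneg[OF 1 4 poisson_nonneg[OF assms] 2 3])
  then show "(LINT x|half_line. poisson t x) = pi / 2" by simp
qed

lemma half_line_scale:
  fixes f :: "real \<Rightarrow> real"
  assumes "k > 0"
  shows "(LINT x|half_line. f (k * x)) = (LINT x|half_line. f x) / k"
proof -
  have "(LINT x|half_line. f x) = (LINT x|lborel. indicator {0<..} x * f x)"
    by (simp add: integral_restrict_space)
  also have "\<dots> = \<bar>k\<bar> *\<^sub>R (LINT x|lborel. indicator {0<..} (0 + k * x) * f (0 + k * x))"
    using assms by (intro lborel_integral_real_affine) auto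
  also have "(\<lambda>x. indicator {0<..} (0 + k * x) * f (0 + k * x)) = (\<lambda>x. indicator {0<..} x * f (k * x))"
    using assms by (auto simp: indicator_def zero_less_mult_iff)
  also have "(LINT x|lborel. indicator {0<..} x * f (k * x)) = (LINT x|half_line. f (k * x))"
    by (simp add: integral_restrict_space)
  finally show ?thesis using assms by simp
qed

subsection \<open>The cosine transform of the Poisson kernel\<close>

text \<open>On [k0 - 1, k0 + 1] the mean value inequality bounds the difference quotients by
  \<open>g\<close>; dominated convergence then applies along every sequence tending to k0, once its
  first terms are dropped.\<close>

lemma DERIV_parameter_integral:
  fixes f f' :: "real \<Rightarrow> 'a \<Rightarrow> real"
  assumes int: "\<And>k. integrable M (f k)" and f': "f' k0 \<in> borel_measurable M"
    and D: "\<And>k p. p \<in> space M \<Longrightarrow> ((\<lambda>k. f k p) has_real_derivative f' k p) (at k)"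
    and g: "integrable M g" and bound: "\<And>k p. p \<in> space M \<Longrightarrow> \<bar>k - k0\<bar> \<le> 1 \<Longrightarrow> \<bar>f' k p\<bar> \<le> g p"
  shows "((\<lambda>k. LINT p|M. f k p) has_real_derivative (LINT p|M. f' k0 p)) (at k0)"
  unfolding has_field_derivative_iff tendsto_at_iff_sequentially
proof (intro allI impI)
  fix X :: "nat \<Rightarrow> real"
  assume X: "\<forall>i. X i \<in> UNIV - {k0}" "X \<longlonglongrightarrow> k0"
  from LIMSEQ_D[OF X(2), of 1] obtain n0 where n0: "\<And>n. n \<ge> n0 \<Longrightarrow> \<bar>X n - k0\<bar> \<le> 1"
    by (force intro: less_imp_le)
  define Y where "Y n = X (n + n0)" for n
  have Y: "Y \<longlonglongrightarrow> k0" "\<And>n. \<bar>Y n - k0\<bar> \<le> 1" "\<And>n. Y n \<noteq> k0"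
    unfolding Y_def using X n0 by (auto intro!: LIMSEQ_ignore_initial_segment)
  have lim: "(\<lambda>n. LINT p|M. (f (Y n) p - f k0 p) / (Y n - k0)) \<longlonglongrightarrow> (LINT p|M. f' k0 p)"
  proof (rule integral_dominated_convergence)
    show "(\<lambda>p. (f (Y n) p - f k0 p) / (Y n - k0)) \<in> borel_measurable M" for n
      using int[THEN borel_measurable_integrable] by measurable
    show "AE p in M. (\<lambda>n. (f (Y n) p - f k0 p) / (Y n - k0)) \<longlonglongrightarrow> f' k0 p"
    proof (rule AE_I2)
      fix p assume "p \<in> space M"
      from D[OF this, of k0] have "((\<lambda>k. (f k p - f k0 p) / (k - k0)) \<longlongrightarrow> f' k0 p) (at k0)"
        by (simp add: has_field_derivative_iff)
      then show "(\<lambda>n. (f (Y n) p - f k0 p) / (Y n - k0)) \<longlonglongrightarrow> f' k0 p"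
        using Y by (auto simp: tendsto_at_iff_sequentially comp_def)
    qed
    show "AE p in M. norm ((f (Y n) p - f k0 p) / (Y n - k0)) \<le> g p" for n
    proof (rule AE_I2)
      fix p assume p: "p \<in> space M"
      have "norm (f (Y n) p - f k0 p) \<le> g p * norm (Y n - k0)"
      proof (rule field_differentiable_bound[where S="{k0 - 1..k0 + 1}" and f="\<lambda>k. f k p" and f'="\<lambda>k. f' k p"])
        show "((\<lambda>k. f k p) has_field_derivative f' z p) (at z within {k0 - 1..k0 + 1})" for z
          using D[OF p] by (rule has_field_derivative_at_within)
        show "norm (f' z p) \<le> g p" if "z \<in> {k0 - 1..k0 + 1}" for z
          using bound[OF p, of z] that by (auto simp: abs_le_iff)
      qed (use Y(2)[of n] in \<open>auto simp: abs_le_iff\<close>)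
      then show "norm ((f (Y n) p - f k0 p) / (Y n - k0)) \<le> g p"
        using Y(3)[of n] by (simp add: divide_simps)
    qed
  qed (use f' g in auto)
  have eq: "(\<lambda>n. LINT p|M. (f (Y n) p - f k0 p) / (Y n - k0)) =
      (\<lambda>n. ((LINT p|M. f (Y n) p) - (LINT p|M. f k0 p)) / (Y n - k0))"
    using int by simp
  have "(\<lambda>n. ((LINT p|M. f (X (n + n0)) p) - (LINT p|M. f k0 p)) / (X (n + n0) - k0))
      \<longlonglongrightarrow> (LINT p|M. f' k0 p)"
    using lim[unfolded eq] unfolding Y_def .
  then show "((\<lambda>y. ((LINT p|M. f y p) - (LINT p|M. f k0 p)) / (y - k0)) \<circ> X) \<longlonglongrightarrow> (LINT p|M. f' k0 p)"
    unfolding comp_def by (rule LIMSEQ_offset)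
qed

lemma one_minus_cos_le: "1 - cos x \<le> (x::real)\<^sup>2 / 2"
proof -
  have "1 - cos x = 2 * (sin (x / 2))\<^sup>2"
    using cos_double_sin[of "x / 2"] by simp
  also have "(sin (x / 2))\<^sup>2 \<le> (x / 2)\<^sup>2"
    using abs_sin_x_le_abs_x[of "x/2"] by (simp only: abs_le_square_iff)
  finally show ?thesis by (simp add: power2_eq_square)
qed

text \<open>
  With \<open>K k = \<integral> (1 - cos (k p)) / (p\<^sup>2 (1 + p\<^sup>2))\<close> the cosine transform \<open>I\<close> is \<open>K''\<close>; partial fractions
  give \<open>I k = K k - c k + pi / 2\<close>, so \<open>I'' = I\<close>, and boundedness singles out \<open>exp (- k)\<close>.
\<close>

lemma cos_transform_poisson_one:
  assumes "k \<ge> 0"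
  shows "(LINT p|half_line. cos (k * p) * poisson 1 p) = pi / 2 * exp (- k)"
proof -
  define I where "I k = (LINT p|half_line. cos (k * p) * poisson 1 p)" for k
  define J where "J k = (LINT p|half_line. sin (k * p) / p * poisson 1 p)" for k
  define K where "K k = (LINT p|half_line. (1 - cos (k * p)) / p\<^sup>2 * poisson 1 p)" for k
  define c where "c = (LINT p|half_line. (1 - cos p) / p\<^sup>2)"
  note P = half_line_poisson[of 1, simplified]
  have P0: "0 \<le> poisson 1 p" for p by (simp add: poisson_nonneg)
  have sinb: "\<bar>sin (k * p) / p\<bar> \<le> \<bar>k\<bar>" if "p > 0" for k p :: real
    using abs_sin_x_le_abs_x[of "k * p"] that by (simp add: abs_mult divide_simps)
  have cosb: "\<bar>(1 - cos (k * p)) / p\<^sup>2\<bar> \<le> k\<^sup>2 / 2" if "p > 0" for k p :: real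
    using one_minus_cos_le[of "k * p"] cos_le_one[of "k * p"] that
    by (simp add: power_mult_distrib divide_simps)
  have sinP: "\<bar>sin (k * p) / p * poisson 1 p\<bar> \<le> \<bar>k\<bar> * poisson 1 p" if "p > 0" for k p
    unfolding abs_mult abs_of_nonneg[OF P0] by (intro mult_right_mono sinb that P0)
  have cosP: "\<bar>(1 - cos (k * p)) / p\<^sup>2 * poisson 1 p\<bar> \<le> k\<^sup>2 / 2 * poisson 1 p" if "p > 0" for k p
    unfolding abs_mult abs_of_nonneg[OF P0] by (intro mult_right_mono cosb that P0)
  have intI: "integrable half_line (\<lambda>p. cos (k * p) * poisson 1 p)" for k
    by (rule half_line_integrable_bound[OF P(1)])
      (auto intro!: half_line_measurable mult_left_le_one_le simp: abs_mult P0)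
  have intJ: "integrable half_line (\<lambda>p. sin (k * p) / p * poisson 1 p)" for k
    by (rule half_line_integrable_bound[of "\<lambda>p. \<bar>k\<bar> * poisson 1 p"])
      (use sinP P in \<open>auto intro!: half_line_measurable simp del: abs_mult abs_divide\<close>)
  have intK: "integrable half_line (\<lambda>p. (1 - cos (k * p)) / p\<^sup>2 * poisson 1 p)" for k
    by (rule half_line_integrable_bound[of "\<lambda>p. k\<^sup>2 / 2 * poisson 1 p"])
      (use cosP P in \<open>auto intro!: half_line_measurable simp del: abs_mult abs_divide\<close>)
  have DJ: "(J has_real_derivative I k) (at k)" for k
    unfolding J_def I_def
  proof (rule DERIV_parameter_integral[OF intJ _ _ P(1)])
    show "((\<lambda>k. sin (k * p) / p * poisson 1 p) has_real_derivative cos (k * p) * poisson 1 p) (at k)"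
      if "p \<in> space half_line" for k p
      using that by (auto intro!: derivative_eq_intros)
  qed (auto intro!: half_line_measurable mult_left_le_one_le simp: abs_mult P0)
  have DK: "(K has_real_derivative J k) (at k)" for k
    unfolding J_def K_def
  proof (rule DERIV_parameter_integral[OF intK, where g="\<lambda>p. (\<bar>k\<bar> + 1) * poisson 1 p"])
    show "((\<lambda>k. (1 - cos (k * p)) / p\<^sup>2 * poisson 1 p) has_real_derivative
        sin (k * p) / p * poisson 1 p) (at k)"
      if "p \<in> space half_line" for k p
      using that by (auto intro!: derivative_eq_intros simp: power2_eq_square)
    show "\<bar>sin (l * p) / p * poisson 1 p\<bar> \<le> (\<bar>k\<bar> + 1) * poisson 1 p"
      if "p \<in> space half_line" "\<bar>l - k\<bar> \<le> 1" for l p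
    proof -
      have "\<bar>sin (l * p) / p\<bar> \<le> \<bar>k\<bar> + 1" using that sinb[of p l] by auto
      then show ?thesis unfolding abs_mult abs_of_nonneg[OF P0] by (rule mult_right_mono) (rule P0)
    qed
  qed (use P in \<open>auto intro!: half_line_measurable\<close>)
  \<comment> \<open>The integral of (1 - cos (k p)) / p^2 is homogeneous of degree one: replacing k
    p by p gives c k, and this is where the sign of k enters.\<close>
  have I: "I k = K k - c * k + pi / 2" if "k \<ge> 0" for k
  proof -
    have P1: "poisson 1 p = 1 / (1 + p\<^sup>2)" "1 + p\<^sup>2 \<noteq> 0" for p
      using poisson_denom_pos[of 1 p] by (auto simp: poisson_def)
    have eq: "(1 - cos (k * p)) / p\<^sup>2 = (1 - cos (k * p)) / p\<^sup>2 * poisson 1 p + (poisson 1 p - cos (k * p) * poisson 1 p)"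
      if "p > 0" for p
      unfolding P1 using P1(2)[of p] that by (simp add: divide_simps) (simp add: algebra_simps power2_eq_square)
    have "(LINT p|half_line. (1 - cos (k * p)) / p\<^sup>2) = c * k"
    proof (cases "k = 0")
      case False
      then have k: "k > 0" using \<open>k \<ge> 0\<close> by simp
      have "(LINT p|half_line. (1 - cos (k * p)) / p\<^sup>2)
          = (LINT p|half_line. k\<^sup>2 * ((1 - cos (k * p)) / (k * p)\<^sup>2))"
        using k by (simp add: power_mult_distrib)
      also have "\<dots> = k\<^sup>2 * (LINT p|half_line. (1 - cos (k * p)) / (k * p)\<^sup>2)"
        by (rule integral_mult_right_zero)
      also have "\<dots> = k\<^sup>2 * (c / k)"
        unfolding c_def half_line_scale[OF k, symmetric] ..
      finally show ?thesis using k by (simp add: power2_eq_square)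
    qed simp
    moreover have "(LINT p|half_line. (1 - cos (k * p)) / p\<^sup>2) =
        (LINT p|half_line. (1 - cos (k * p)) / p\<^sup>2 * poisson 1 p + (poisson 1 p - cos (k * p) * poisson 1 p))"
      by (intro Bochner_Integration.integral_cong refl eq) simp
    moreover have "\<dots> = K k + (pi / 2 - I k)"
      using intK intI P by (simp add: K_def I_def)
    ultimately show ?thesis by simp
  qed
  \<comment> \<open>\<open>I\<close> cannot be differentiated under the integral, since p sin (k p)
    / (1 + p^2) is not absolutely integrable. \<open>L\<close> agrees with \<open>I\<close> for k
    \<ge> 0 and is differentiable by its construction from \<open>K\<close>.\<close>
  define L where "L k = K k - c * k + pi / 2" for k
  have DL: "(L has_real_derivative J k - c) (at k)" for k
    unfolding L_def by (auto intro!: derivative_eq_intros DK)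
  \<comment> \<open>The equation L'' = L is factored: L' + L is a constant times exp k. Since
    \<open>J\<close> grows at most linearly and \<open>I\<close> is bounded, the constant is 0, and
    L' = - L remains.\<close>
  have "((\<lambda>k. (J k - c + L k) * exp (- k)) has_real_derivative 0) (at k within {0..})" if "k \<in> {0..}" for k
  proof -
    have "((\<lambda>k. (J k - c + L k) * exp (- k)) has_real_derivative
        (I k + (J k - c)) * exp (- k) - (J k - c + L k) * exp (- k)) (at k within {0..})"
      by (auto intro!: derivative_eq_intros has_field_derivative_at_within[OF DJ]
          has_field_derivative_at_within[OF DL])
    moreover have "I k = L k" using that by (simp add: I L_def)
    ultimately show ?thesis by (simp add: algebra_simps)
  qed
  from has_field_derivative_zero_constant[OF _ this]
  obtain C where C: "\<And>k. k \<ge> 0 \<Longrightarrow> (J k - c + L k) * exp (- k) = C" by auto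
  have "C = 0"
  proof -
    have IJ: "\<bar>I k\<bar> \<le> pi / 2" "\<bar>J k\<bar> \<le> \<bar>k\<bar> * (pi / 2)" for k
    proof -
      have "\<bar>I k\<bar> \<le> (LINT p|half_line. \<bar>cos (k * p) * poisson 1 p\<bar>)"
        unfolding I_def by (rule integral_abs_bound)
      also have "\<dots> \<le> (LINT p|half_line. poisson 1 p)"
        using intI P by (intro integral_mono integrable_abs)
          (auto intro!: mult_left_le_one_le simp: abs_mult P0)
      finally show "\<bar>I k\<bar> \<le> pi / 2" using P by simp
      have "\<bar>J k\<bar> \<le> (LINT p|half_line. \<bar>sin (k * p) / p * poisson 1 p\<bar>)"
        unfolding J_def by (rule integral_abs_bound)
      also have "\<dots> \<le> (LINT p|half_line. \<bar>k\<bar> * poisson 1 p)"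
        using intJ P sinP by (intro integral_mono integrable_abs) auto
      finally show "\<bar>J k\<bar> \<le> \<bar>k\<bar> * (pi / 2)" unfolding integral_mult_right_zero half_line_poisson(2)[OF zero_less_one] .
    qed
    have "\<bar>C\<bar> \<le> (k * (pi / 2) + \<bar>c\<bar> + pi / 2) * exp (- k)" if "k \<ge> 0" for k
    proof -
      have LI: "L k = I k" using I[OF that] by (simp add: L_def)
      have Jk: "\<bar>J k\<bar> \<le> k * (pi / 2)" using IJ(2)[of k] unfolding abs_of_nonneg[OF that] .
      have "\<bar>J k - c + I k\<bar> \<le> \<bar>J k\<bar> + \<bar>c\<bar> + \<bar>I k\<bar>" by arith
      also have "\<dots> \<le> k * (pi / 2) + \<bar>c\<bar> + pi / 2"
        by (intro add_mono order_refl Jk IJ(1))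
      finally have "\<bar>J k - c + L k\<bar> \<le> k * (pi / 2) + \<bar>c\<bar> + pi / 2" unfolding LI .
      then show ?thesis unfolding C[OF that, symmetric] abs_mult abs_exp_cancel by (rule mult_right_mono) simp
    qed
    then have "\<forall>\<^sub>F k in at_top. \<bar>C\<bar> \<le> (k * (pi / 2) + \<bar>c\<bar> + pi / 2) * exp (- k)"
      by (intro eventually_at_top_linorderI) auto
    moreover have "((\<lambda>k. (k * (pi / 2) + \<bar>c\<bar> + pi / 2) * exp (- k)) \<longlongrightarrow> 0) at_top"
      by real_asymp
    ultimately have "\<bar>C\<bar> \<le> 0"
      by (intro tendsto_lowerbound[of _ _ at_top]) auto
    then show ?thesis by simp
  qed
  then have JL: "J k - c = - L k" if "k \<ge> 0" for k
    using C[OF that] by simp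
  have "((\<lambda>k. L k * exp k) has_real_derivative 0) (at k within {0..})" if "k \<in> {0..}" for k
  proof -
    have "((\<lambda>k. L k * exp k) has_real_derivative (J k - c) * exp k + L k * exp k) (at k within {0..})"
      by (auto intro!: derivative_eq_intros has_field_derivative_at_within[OF DL])
    then show ?thesis using JL[of k] that by simp
  qed
  from has_field_derivative_zero_constant[OF _ this]
  obtain D where D: "\<And>k. k \<ge> 0 \<Longrightarrow> L k * exp k = D" by auto
  have "L 0 = pi / 2" by (simp add: L_def K_def)
  then have "L k * exp k = pi / 2" using D[of 0] D[OF assms] by simp
  then have "L k = pi / 2 * exp (- k)" by (simp add: exp_minus divide_simps)
  moreover have "I k = L k" using assms by (simp add: I L_def)
  ultimately show ?thesis by (simp add: I_def)
qed

lemma cos_transform_poisson: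
  assumes "t > 0" "k \<ge> 0"
  shows "(LINT p|half_line. cos (k * p) * poisson t p) = pi / 2 * exp (- t * k)"
proof -
  have "poisson t (t * p) = poisson 1 p / t" for p
    using assms poisson_denom_pos[of 1 p] poisson_denom_pos[of t "t * p"]
    by (simp add: poisson_def divide_simps) (simp add: algebra_simps power2_eq_square)
  then have "(LINT p|half_line. cos (k * (t * p)) * poisson t (t * p)) =
      (LINT p|half_line. cos ((t * k) * p) * poisson 1 p) / t"
    by (simp add: ac_simps)
  also have "\<dots> = pi / 2 * exp (- t * k) / t"
    using assms by (subst cos_transform_poisson_one) auto
  finally have "(LINT p|half_line. cos (k * p) * poisson t p) / t = pi / 2 * exp (- t * k) / t"
    unfolding half_line_scale[OF assms(1), of "\<lambda>p. cos (k * p) * poisson t p"] .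
  then show ?thesis unfolding divide_cancel_right using assms by simp
qed

section \<open>Integral operators with kernels bounded by a convolution kernel\<close>

lemma pair_half_line_measurable:
  assumes "f \<in> borel_measurable (borel \<Otimes>\<^sub>M borel)"
  shows "f \<in> borel_measurable (half_line \<Otimes>\<^sub>M half_line)"
proof -
  have "(\<lambda>p. (fst p, snd p)) \<in> measurable (half_line \<Otimes>\<^sub>M half_line) (borel \<Otimes>\<^sub>M borel)"
    by (intro measurable_Pair measurable_compose[OF measurable_fst measurable_ident_half_line]
        measurable_compose[OF measurable_snd measurable_ident_half_line])
  from measurable_compose[OF this assms] show ?thesis by simp
qed

lemma AE_half_line_if_positive: "(\<And>x. x > 0 \<Longrightarrow> P x) \<Longrightarrow> AE x in half_line. P x"
  by (intro AE_I2) simp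

lemma exp_L2_half_line: "k > 0 \<Longrightarrow> (\<lambda>x. complex_of_real (exp (- k * x))) \<in> L2_half_line"
proof (rule L2_half_lineI)
  assume "k > 0"
  have "(\<lambda>x. (cmod (complex_of_real (exp (- k * x))))\<^sup>2) = (\<lambda>x. exp (- (2 * k) * x))"
    by (simp add: power2_eq_square mult_exp_exp ac_simps)
  with \<open>k > 0\<close> show "integrable half_line (\<lambda>x. (cmod (complex_of_real (exp (- k * x))))\<^sup>2)"
    using half_line_exp(1)[of "2 * k"] by simp
qed (auto intro!: half_line_measurable)

text \<open>The hypotheses of Schur's test for a kernel dominated by a function of |x - y|: row and
  column integrals are at most twice the integral of \<open>g\<close>. The resolvent, Dirichlet and
  cylinder kernels are all instances.\<close>

locale kernel_bound =
  fixes g :: "real \<Rightarrow> real" and k :: "real \<Rightarrow> real \<Rightarrow> real"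
  assumes g_measurable [measurable]: "g \<in> borel_measurable borel"
    and g_nonneg: "\<And>r. 0 \<le> g r"
    and g_integrable: "integrable half_line g"
    and k_measurable [measurable]: "(\<lambda>p. k (fst p) (snd p)) \<in> borel_measurable (borel \<Otimes>\<^sub>M borel)"
    and k_bound: "\<And>x y. x > 0 \<Longrightarrow> y > 0 \<Longrightarrow> \<bar>k x y\<bar> \<le> g \<bar>x - y\<bar>"
begin

abbreviation G :: real where "G \<equiv> integral\<^sup>L half_line g"

lemma G_nonneg: "0 \<le> G"
  using g_nonneg by simp

lemma convolution_measurable [measurable]:
  "(\<lambda>p. g \<bar>fst p - snd p\<bar>) \<in> borel_measurable (half_line \<Otimes>\<^sub>M half_line)"
  by (rule pair_half_line_measurable) measurable

lemma kernel_measurable [measurable]: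
  "(\<lambda>p. k (fst p) (snd p)) \<in> borel_measurable (half_line \<Otimes>\<^sub>M half_line)"
  by (rule pair_half_line_measurable) measurable

text \<open>The factor 2 arises because |x - y| runs through the half-line once on each side of x:
  the zero extension of \<open>g\<close> and its mirror image add up to g |z| except at z =
  0.\<close>

lemma convolution_integral:
  shows "integrable half_line (\<lambda>y. g \<bar>x - y\<bar>)" "(LINT y|half_line. g \<bar>x - y\<bar>) \<le> 2 * G"
proof -
  define h where "h z = indicator {0<..} z * g z" for z
  have h: "integrable lborel h" "integral\<^sup>L lborel h = G"
    using g_integrable by (simp_all add: h_def[abs_def] integrable_restrict_space integral_restrict_space)
  have h': "integrable lborel (\<lambda>z. h (0 + (-1) * z))"
    using h(1) by (intro lborel_integrable_real_affine) auto
  have "G = \<bar>-1\<bar> *\<^sub>R (LINT z|lborel. h (0 + (-1) * z))"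
    unfolding h(2)[symmetric] by (rule lborel_integral_real_affine) simp
  then have h'': "(LINT z|lborel. h (0 + (-1) * z)) = G" by simp
  have sum: "AE z in lborel. h z + h (0 + (-1) * z) = g \<bar>z\<bar>"
    using AE_lborel_singleton[of 0] by eventually_elim (auto simp: h_def indicator_def)
  have i: "integrable lborel (\<lambda>z. h z + h (0 + (-1) * z))"
    using h h' by auto
  have m [measurable]: "h \<in> borel_measurable borel" unfolding h_def by measurable
  have I: "integrable lborel (\<lambda>z. g \<bar>z\<bar>)"
    by (rule integrable_cong_AE[THEN iffD1, OF _ _ sum i]) auto
  have "(LINT z|lborel. g \<bar>z\<bar>) = (LINT z|lborel. h z + h (0 + (-1) * z))"
    using sum by (intro integral_cong_AE) auto
  also have "\<dots> = 2 * G" using h h' h'' by (subst Bochner_Integration.integral_add) auto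
  finally have G2: "(LINT z|lborel. g \<bar>z\<bar>) = 2 * G" .
  have I': "integrable lborel (\<lambda>y. g \<bar>x + (-1) * y\<bar>)"
    using lborel_integrable_real_affine[OF I, of "-1" x] by simp
  have "(LINT z|lborel. g \<bar>z\<bar>) = \<bar>-1\<bar> *\<^sub>R (LINT y|lborel. g \<bar>x + (-1) * y\<bar>)"
    by (rule lborel_integral_real_affine) simp
  then have G3: "(LINT y|lborel. g \<bar>x - y\<bar>) = 2 * G" using G2 by simp
  have I2: "integrable lborel (\<lambda>y. indicator {0<..} y * g \<bar>x - y\<bar>)"
    using I' integrable_mult_indicator[of "{0<..}" lborel "\<lambda>y. g \<bar>x - y\<bar>"] by simp
  then show "integrable half_line (\<lambda>y. g \<bar>x - y\<bar>)"
    by (simp add: integrable_restrict_space)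
  have "(LINT y|half_line. g \<bar>x - y\<bar>) = (LINT y|lborel. indicator {0<..} y * g \<bar>x - y\<bar>)"
    by (simp add: integral_restrict_space)
  also have "\<dots> \<le> (LINT y|lborel. g \<bar>x - y\<bar>)"
    using I' g_nonneg by (intro integral_mono I2) (auto simp: indicator_def)
  finally show "(LINT y|half_line. g \<bar>x - y\<bar>) \<le> 2 * G" using G3 by simp
qed

lemma convolution_pair:
  fixes v :: "real \<Rightarrow> real"
  assumes v: "integrable half_line v" "\<And>x. x > 0 \<Longrightarrow> 0 \<le> v x"
  shows "integrable (half_line \<Otimes>\<^sub>M half_line) (\<lambda>p. g \<bar>fst p - snd p\<bar> * v (fst p))"
    and "(LINT p|(half_line \<Otimes>\<^sub>M half_line). g \<bar>fst p - snd p\<bar> * v (fst p)) \<le> 2 * G * integral\<^sup>L half_line v"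
proof -
  have [measurable]: "v \<in> borel_measurable half_line" using v by auto
  have inner: "(LINT y|half_line. g \<bar>x - y\<bar> * v x) = (LINT y|half_line. g \<bar>x - y\<bar>) * v x" for x
    by simp
  have b: "0 \<le> (LINT y|half_line. g \<bar>x - y\<bar>) * v x \<and> (LINT y|half_line. g \<bar>x - y\<bar>) * v x \<le> 2 * G * v x"
    if "x > 0" for x
    using v(2)[OF that] convolution_integral(2)[of x] g_nonneg
    by (auto intro!: mult_right_mono mult_nonneg_nonneg)
  have m: "(\<lambda>x. (LINT y|half_line. g \<bar>x - y\<bar>) * v x) \<in> borel_measurable half_line"
  proof (rule borel_measurable_times)
    have "(\<lambda>p. g \<bar>fst p - snd p\<bar>) = (\<lambda>(x, y). g \<bar>x - y\<bar>)" by auto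
    then show "(\<lambda>x. LINT y|half_line. g \<bar>x - y\<bar>) \<in> borel_measurable half_line"
      using half_line.borel_measurable_lebesgue_integral convolution_measurable by metis
  qed measurable
  have i: "integrable half_line (\<lambda>x. (LINT y|half_line. g \<bar>x - y\<bar>) * v x)"
    by (rule half_line_integrable_bound[OF integrable_mult_right[OF v(1), of "2 * G"] m]) (use b in auto)
  show I: "integrable (half_line \<Otimes>\<^sub>M half_line) (\<lambda>p. g \<bar>fst p - snd p\<bar> * v (fst p))"
  proof (rule half_line2.Fubini_integrable)
    show "integrable half_line (\<lambda>x. LINT y|half_line. norm (g \<bar>fst (x, y) - snd (x, y)\<bar> * v (fst (x, y))))"
      by (rule Bochner_Integration.integrable_cong[THEN iffD1, OF refl _ i])
        (use v(2) g_nonneg in \<open>simp add: abs_mult\<close>)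
    show "AE x in half_line. integrable half_line (\<lambda>y. g \<bar>fst (x, y) - snd (x, y)\<bar> * v (fst (x, y)))"
      using convolution_integral(1) by (intro AE_I2) auto
  qed measurable
  have "(LINT p|(half_line \<Otimes>\<^sub>M half_line). g \<bar>fst p - snd p\<bar> * v (fst p)) =
      (LINT x|half_line. (LINT y|half_line. g \<bar>x - y\<bar>) * v x)"
    using half_line2.integral_fst'[OF I] by simp
  also have "\<dots> \<le> (LINT x|half_line. 2 * G * v x)"
    using i v(1) b by (intro integral_mono_AE AE_half_line_if_positive) auto
  finally show "(LINT p|(half_line \<Otimes>\<^sub>M half_line). g \<bar>fst p - snd p\<bar> * v (fst p)) \<le> 2 * G * integral\<^sup>L half_line v"
    by simp
qed

lemma convolution_pair_snd:
  fixes v :: "real \<Rightarrow> real"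
  assumes v: "integrable half_line v" "\<And>x. x > 0 \<Longrightarrow> 0 \<le> v x"
  shows "integrable (half_line \<Otimes>\<^sub>M half_line) (\<lambda>p. g \<bar>fst p - snd p\<bar> * v (snd p))"
    and "(LINT p|(half_line \<Otimes>\<^sub>M half_line). g \<bar>fst p - snd p\<bar> * v (snd p)) \<le> 2 * G * integral\<^sup>L half_line v"
proof -
  have eq: "(\<lambda>(x, y). g \<bar>fst (y, x) - snd (y, x)\<bar> * v (fst (y, x))) = (\<lambda>p. g \<bar>fst p - snd p\<bar> * v (snd p))"
    by (auto simp: abs_minus_commute)
  show "integrable (half_line \<Otimes>\<^sub>M half_line) (\<lambda>p. g \<bar>fst p - snd p\<bar> * v (snd p))"
    using half_line2.integrable_product_swap[OF convolution_pair(1)[OF v]] unfolding eq .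
  have "(LINT p|(half_line \<Otimes>\<^sub>M half_line). g \<bar>fst p - snd p\<bar> * v (snd p)) =
      (LINT p|(half_line \<Otimes>\<^sub>M half_line). g \<bar>fst p - snd p\<bar> * v (fst p))"
    using half_line2.integral_product_swap[of "\<lambda>p. g \<bar>fst p - snd p\<bar> * v (fst p)"] v(1)
    unfolding eq by simp
  then show "(LINT p|(half_line \<Otimes>\<^sub>M half_line). g \<bar>fst p - snd p\<bar> * v (snd p)) \<le> 2 * G * integral\<^sup>L half_line v"
    using convolution_pair(2)[OF v] by simp
qed

text \<open>Schur's test, in the form of the inequality \<open>2 \<bar>v\<bar> \<bar>w\<bar> \<le> \<bar>v\<bar>\<^sup>2 + \<bar>w\<bar>\<^sup>2\<close> under the integral.\<close>

lemma convolution_form: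
  assumes v: "v \<in> L2_half_line" and w: "w \<in> L2_half_line"
  shows "integrable (half_line \<Otimes>\<^sub>M half_line) (\<lambda>p. g \<bar>fst p - snd p\<bar> * (cmod (w (fst p)) * cmod (v (snd p))))"
    and "(LINT p|(half_line \<Otimes>\<^sub>M half_line). g \<bar>fst p - snd p\<bar> * (cmod (w (fst p)) * cmod (v (snd p))))
      \<le> G * ((LINT x|half_line. (cmod (w x))\<^sup>2) + (LINT x|half_line. (cmod (v x))\<^sup>2))"
proof -
  have [measurable]: "v \<in> borel_measurable half_line" "w \<in> borel_measurable half_line"
    using v w by (auto simp: L2_half_line_def)
  let ?d = "\<lambda>p. (g \<bar>fst p - snd p\<bar> * (cmod (w (fst p)))\<^sup>2 + g \<bar>fst p - snd p\<bar> * (cmod (v (snd p)))\<^sup>2) / 2"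
  note W = convolution_pair[OF L2_half_line_square[OF w]]
  note V = convolution_pair_snd[OF L2_half_line_square[OF v]]
  have d: "integrable (half_line \<Otimes>\<^sub>M half_line) ?d" using W V by auto
  have le: "g \<bar>fst p - snd p\<bar> * (cmod (w (fst p)) * cmod (v (snd p))) \<le> ?d p" for p
    using mult_left_mono[OF two_mult_le_squares[of "cmod (w (fst p))" "cmod (v (snd p))"] g_nonneg[of "\<bar>fst p - snd p\<bar>"]]
    by (simp add: distrib_left)
  show i: "integrable (half_line \<Otimes>\<^sub>M half_line) (\<lambda>p. g \<bar>fst p - snd p\<bar> * (cmod (w (fst p)) * cmod (v (snd p))))"
  proof (rule Bochner_Integration.integrable_bound[OF d])
    show "AE p in half_line \<Otimes>\<^sub>M half_line. norm (g \<bar>fst p - snd p\<bar> * (cmod (w (fst p)) * cmod (v (snd p)))) \<le> norm (?d p)"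
      using le g_nonneg by (intro AE_I2) (force intro: order.trans[OF _ abs_ge_self])
  qed measurable
  have "(LINT p|(half_line \<Otimes>\<^sub>M half_line). g \<bar>fst p - snd p\<bar> * (cmod (w (fst p)) * cmod (v (snd p)))) \<le>
     integral\<^sup>L (half_line \<Otimes>\<^sub>M half_line) ?d"
    using i d le by (intro integral_mono) auto
  also have "\<dots> = ((LINT p|(half_line \<Otimes>\<^sub>M half_line). g \<bar>fst p - snd p\<bar> * (cmod (w (fst p)))\<^sup>2) +
      (LINT p|(half_line \<Otimes>\<^sub>M half_line). g \<bar>fst p - snd p\<bar> * (cmod (v (snd p)))\<^sup>2)) / 2"
    using W V by simp
  also have "\<dots> \<le> (2 * G * (LINT x|half_line. (cmod (w x))\<^sup>2) + 2 * G * (LINT x|half_line. (cmod (v x))\<^sup>2)) / 2"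
    using W(2) V(2) by (intro divide_right_mono add_mono) auto
  also have "\<dots> = G * ((LINT x|half_line. (cmod (w x))\<^sup>2) + (LINT x|half_line. (cmod (v x))\<^sup>2))"
    by (simp add: distrib_left)
  finally show "(LINT p|(half_line \<Otimes>\<^sub>M half_line). g \<bar>fst p - snd p\<bar> * (cmod (w (fst p)) * cmod (v (snd p))))
      \<le> G * ((LINT x|half_line. (cmod (w x))\<^sup>2) + (LINT x|half_line. (cmod (v x))\<^sup>2))" .
qed

definition op :: "(real \<Rightarrow> complex) \<Rightarrow> real \<Rightarrow> complex" where
  "op v x = (LINT y|half_line. of_real (k x y) * v y)"

lemma AE_space_pair: "(\<And>x y. x > 0 \<Longrightarrow> y > 0 \<Longrightarrow> P (x, y)) \<Longrightarrow> AE p in half_line \<Otimes>\<^sub>M half_line. P p"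
  by (intro AE_I2) (auto simp: space_pair_measure)

lemma form_integrable:
  assumes v: "v \<in> L2_half_line" and w: "w \<in> L2_half_line"
  shows "integrable (half_line \<Otimes>\<^sub>M half_line) (\<lambda>p. w (fst p) * (of_real (k (fst p) (snd p)) * v (snd p)))"
proof -
  have [measurable]: "v \<in> borel_measurable half_line" "w \<in> borel_measurable half_line"
    using v w by (auto simp: L2_half_line_def)
  show ?thesis
  proof (rule Bochner_Integration.integrable_bound[OF convolution_form(1)[OF v w]])
    show "AE p in half_line \<Otimes>\<^sub>M half_line. norm (w (fst p) * (of_real (k (fst p) (snd p)) * v (snd p)))
        \<le> norm (g \<bar>fst p - snd p\<bar> * (cmod (w (fst p)) * cmod (v (snd p))))"
    proof (rule AE_space_pair)
      fix x y :: real assume "x > 0" "y > 0"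
      then have "cmod (w x) * cmod (v y) * \<bar>k x y\<bar> \<le> cmod (w x) * cmod (v y) * g \<bar>x - y\<bar>"
        by (intro mult_left_mono k_bound) auto
      then show "norm (w (fst (x, y)) * (of_real (k (fst (x, y)) (snd (x, y))) * v (snd (x, y))))
        \<le> norm (g \<bar>fst (x, y) - snd (x, y)\<bar> * (cmod (w (fst (x, y))) * cmod (v (snd (x, y)))))"
        using g_nonneg[of "\<bar>x - y\<bar>"] by (simp add: norm_mult ac_simps)
    qed
  qed measurable
qed

text \<open>Joint integrability is available only after pairing with a square integrable function of
  x. The choice exp (- x) is nowhere zero, so it can be divided out for each x afterwards.\<close>

lemma AE_kernel_integrable:
  assumes v: "v \<in> L2_half_line"
  shows "AE x in half_line. integrable half_line (\<lambda>y. of_real (k x y) * v y)"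
proof -
  have "AE x in half_line. integrable half_line (\<lambda>y. complex_of_real (exp (- 1 * x)) * (of_real (k x y) * v y))"
    using half_line2.AE_integrable_fst'[OF form_integrable[OF v exp_L2_half_line[of 1]]] by simp
  then show ?thesis
  proof eventually_elim
    case (elim x)
    from integrable_mult_right[OF elim, of "of_real (exp x)"]
    show ?case
      by (simp add: mult.assoc[symmetric] exp_minus flip: of_real_mult)
  qed
qed

lemma op_measurable:
  assumes v: "v \<in> L2_half_line"
  shows "op v \<in> borel_measurable half_line"
proof -
  have [measurable]: "v \<in> borel_measurable half_line" using v by (auto simp: L2_half_line_def)
  have "(\<lambda>p. of_real (k (fst p) (snd p)) * v (snd p)) \<in> borel_measurable (half_line \<Otimes>\<^sub>M half_line)"
    by measurable
  then have "case_prod (\<lambda>x y. of_real (k x y) * v y) \<in> borel_measurable (half_line \<Otimes>\<^sub>M half_line)"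
    by (simp add: case_prod_beta')
  then show ?thesis unfolding op_def[abs_def] by (rule half_line.borel_measurable_lebesgue_integral)
qed

lemma form_eq:
  assumes v: "v \<in> L2_half_line" and w: "w \<in> L2_half_line"
  shows "(LINT x|half_line. w x * op v x) =
    (LINT p|(half_line \<Otimes>\<^sub>M half_line). w (fst p) * (of_real (k (fst p) (snd p)) * v (snd p)))"
  using half_line2.integral_fst'[OF form_integrable[OF v w]] by (simp add: op_def)

lemma op_swap:
  assumes v: "v \<in> L2_half_line" and w: "(\<lambda>x. complex_of_real (w x)) \<in> L2_half_line"
  shows "(LINT x|half_line. op v x * of_real (w x)) = (LINT y|half_line. v y * of_real (LINT x|half_line. k x y * w x))"
    and "integrable half_line (\<lambda>y. v y * of_real (LINT x|half_line. k x y * w x))"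
proof -
  note I = form_integrable[OF v w]
  have inner: "(LINT x|half_line. of_real (w x) * (of_real (k x y) * v y)) =
      v y * of_real (LINT x|half_line. k x y * w x)" for y
  proof -
    have "(LINT x|half_line. of_real (w x) * (of_real (k x y) * v y)) =
      (LINT x|half_line. v y * of_real (k x y * w x))"
      by (intro Bochner_Integration.integral_cong refl) simp
    then show ?thesis unfolding integral_mult_right_zero integral_complex_of_real .
  qed
  have "(LINT x|half_line. op v x * of_real (w x)) = (LINT x|half_line. of_real (w x) * op v x)"
    by (simp add: mult.commute)
  also have "\<dots> = (LINT p|(half_line \<Otimes>\<^sub>M half_line). of_real (w (fst p)) * (of_real (k (fst p) (snd p)) * v (snd p)))"
    by (rule form_eq[OF v w])
  also have "\<dots> = (LINT y|half_line. v y * of_real (LINT x|half_line. k x y * w x))"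
    using half_line2.integral_snd[of "\<lambda>x y. of_real (w x) * (of_real (k x y) * v y)"] I
    by (simp add: case_prod_beta' inner)
  finally show "(LINT x|half_line. op v x * of_real (w x)) = (LINT y|half_line. v y * of_real (LINT x|half_line. k x y * w x))" .
  show "integrable half_line (\<lambda>y. v y * of_real (LINT x|half_line. k x y * w x))"
    using half_line2.integrable_snd[of "\<lambda>x y. of_real (w x) * (of_real (k x y) * v y)"] I
    by (simp add: case_prod_beta' inner)
qed

text \<open>Schur's test: at almost every x, a Cauchy-Schwarz estimate with respect to the weight g
  |x - y| costs one factor 2 G, and integrating \<open>A\<close> over x costs another, hence 4 G^2.
  Cauchy-Schwarz itself is obtained from \<open>key\<close> by optimizing over c.\<close>

lemma op_L2:
  assumes v: "v \<in> L2_half_line"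
  shows "op v \<in> L2_half_line"
    and "(LINT x|half_line. (cmod (op v x))\<^sup>2) \<le> 4 * G\<^sup>2 * (LINT x|half_line. (cmod (v x))\<^sup>2)"
proof -
  have [measurable]: "v \<in> borel_measurable half_line" using v by (auto simp: L2_half_line_def)
  note m [measurable] = op_measurable[OF v]
  define A where "A x = (LINT y|half_line. g \<bar>x - y\<bar> * (cmod (v y))\<^sup>2)" for x
  note V = convolution_pair_snd[OF L2_half_line_square[OF v]]
  have A: "integrable half_line A" "integral\<^sup>L half_line A \<le> 2 * G * (LINT x|half_line. (cmod (v x))\<^sup>2)"
    "AE x in half_line. integrable half_line (\<lambda>y. g \<bar>x - y\<bar> * (cmod (v y))\<^sup>2)"
    using half_line2.integrable_fst'[OF V(1)] half_line2.integral_fst'[OF V(1)] V(2)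
      half_line2.AE_integrable_fst'[OF V(1)] by (simp_all add: A_def[abs_def])
  have bound: "AE x in half_line. (cmod (op v x))\<^sup>2 \<le> 2 * G * A x"
    using A(3) AE_kernel_integrable[OF v] AE_space[of half_line]
  proof eventually_elim
    case (elim x)
    then have x: "x > 0" by simp
    define X where "X = (LINT y|half_line. \<bar>k x y\<bar> * cmod (v y))"
    have iX: "integrable half_line (\<lambda>y. \<bar>k x y\<bar> * cmod (v y))"
      using integrable_norm[OF elim(2)] by (simp add: norm_mult)
    have X0: "0 \<le> X" unfolding X_def by (intro integral_nonneg_AE) auto
    have "cmod (op v x) \<le> X"
      unfolding op_def X_def using integral_norm_bound[of half_line "\<lambda>y. of_real (k x y) * v y"]
      by (simp add: norm_mult)
    have A0: "0 \<le> A x" unfolding A_def using g_nonneg by (intro integral_nonneg_AE) auto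
    have key: "2 * c * X \<le> c\<^sup>2 * (2 * G) + A x" if c: "c \<ge> 0" for c
    proof -
      have "2 * c * X = (LINT y|half_line. 2 * c * (\<bar>k x y\<bar> * cmod (v y)))" by (simp add: X_def)
      also have "\<dots> \<le> (LINT y|half_line. c\<^sup>2 * g \<bar>x - y\<bar> + g \<bar>x - y\<bar> * (cmod (v y))\<^sup>2)"
      proof (intro integral_mono_AE AE_half_line_if_positive)
        fix y :: real assume y: "y > 0"
        have "2 * c * (\<bar>k x y\<bar> * cmod (v y)) \<le> 2 * c * (g \<bar>x - y\<bar> * cmod (v y))"
          using c k_bound[OF x y] by (intro mult_left_mono mult_right_mono) auto
        also have "\<dots> = g \<bar>x - y\<bar> * (2 * (c * cmod (v y)))" by simp
        also have "\<dots> \<le> g \<bar>x - y\<bar> * (c\<^sup>2 + (cmod (v y))\<^sup>2)"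
          by (intro mult_left_mono two_mult_le_squares g_nonneg)
        finally show "2 * c * (\<bar>k x y\<bar> * cmod (v y)) \<le> c\<^sup>2 * g \<bar>x - y\<bar> + g \<bar>x - y\<bar> * (cmod (v y))\<^sup>2"
          by (simp add: algebra_simps)
      qed (use iX convolution_integral(1)[of x] elim(1) in auto)
      also have "\<dots> = c\<^sup>2 * (LINT y|half_line. g \<bar>x - y\<bar>) + A x"
        using convolution_integral(1)[of x] elim(1) by (simp add: A_def)
      also have "\<dots> \<le> c\<^sup>2 * (2 * G) + A x"
        using convolution_integral(2)[of x] by (intro add_mono mult_left_mono) auto
      finally show ?thesis .
    qed
    have "X\<^sup>2 \<le> 2 * G * A x"
    proof (cases "G = 0")
      case True
      have "X = 0"
      proof (rule ccontr)
        assume "X \<noteq> 0"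
        then have "X > 0" using X0 by simp
        \<comment> \<open>For G = 0 the estimate reads 2 c X \<le> A x for every c \<ge> 0; the
          chosen c makes the left side equal to A x + 1.\<close>
        then show False using key[of "(A x + 1) / (2 * X)"] A0 True by simp
      qed
      then show ?thesis using True by simp
    next
      case False
      then have G: "G > 0" using G_nonneg by simp
      \<comment> \<open>c = X / (2 G) maximizes 2 c X - 2 G c^2.\<close>
      have "2 * (X / (2 * G)) * X \<le> (X / (2 * G))\<^sup>2 * (2 * G) + A x"
        using X0 G by (intro key) auto
      then have "X\<^sup>2 / (2 * G) \<le> A x"
        using G by (simp add: power2_eq_square field_simps)
      then show ?thesis using G by (simp add: field_simps)
    qed
    moreover have "(cmod (op v x))\<^sup>2 \<le> X\<^sup>2"
      using \<open>cmod (op v x) \<le> X\<close> by (intro power_mono) auto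
    ultimately show ?case by simp
  qed
  have i: "integrable half_line (\<lambda>x. (cmod (op v x))\<^sup>2)"
  proof (rule Bochner_Integration.integrable_bound[OF integrable_mult_right[OF A(1), of "2 * G"]])
    show "AE x in half_line. norm ((cmod (op v x))\<^sup>2) \<le> norm (2 * G * A x)"
      using bound by eventually_elim auto
  qed measurable
  with m show "op v \<in> L2_half_line" by (rule L2_half_lineI)
  have "(LINT x|half_line. (cmod (op v x))\<^sup>2) \<le> (LINT x|half_line. 2 * G * A x)"
    using i A(1) bound by (intro integral_mono_AE) auto
  also have "\<dots> = 2 * G * integral\<^sup>L half_line A" by simp
  also have "\<dots> \<le> 2 * G * (2 * G * (LINT x|half_line. (cmod (v x))\<^sup>2))"
    using A(2) G_nonneg by (intro mult_left_mono) auto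
  finally show "(LINT x|half_line. (cmod (op v x))\<^sup>2) \<le> 4 * G\<^sup>2 * (LINT x|half_line. (cmod (v x))\<^sup>2)"
    by (simp add: power2_eq_square ac_simps)
qed

end

section \<open>Superpositions of resolvent kernels\<close>

text \<open>The Green function of - d^2/dx^2 + \<kappa>^2 on the whole line at distance r. The
  Dirichlet condition at 0 is obtained from it by subtracting the mirror image, at distance x +
  y.\<close>

definition resolvent_a :: "real \<Rightarrow> real \<Rightarrow> real" where
  "resolvent_a \<kappa> r = exp (- \<kappa> * r) / (2 * \<kappa>)"

definition resolvent_b :: "real \<Rightarrow> real \<Rightarrow> real \<Rightarrow> real \<Rightarrow> real" where
  "resolvent_b N \<alpha> \<kappa> r = exp (- \<kappa> * r) / (N * \<kappa> + \<alpha>)"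

definition cylinder_a :: "real \<Rightarrow> real \<Rightarrow> real" where
  "cylinder_a t r = poisson t r / pi"

text \<open>The Laplace transform in q comes from writing 1 / (N \<kappa> + \<alpha>) as the
  integral of exp (- (N \<kappa> + \<alpha>) q): the part exp (- N \<kappa> q) lengthens the path r
  by N q.\<close>

definition poisson_tail :: "real \<Rightarrow> real \<Rightarrow> real \<Rightarrow> real \<Rightarrow> real" where
  "poisson_tail N \<alpha> t r = (LINT q|half_line. exp (- \<alpha> * q) * poisson t (r + N * q))"

definition cylinder_b :: "real \<Rightarrow> real \<Rightarrow> real \<Rightarrow> real \<Rightarrow> real" where
  "cylinder_b N \<alpha> t r = 2 / (N * pi) * (poisson t r - \<alpha> * poisson_tail N \<alpha> t r)"

text \<open>
  \<open>exp (- t \<surd>s)\<close> is the superposition of \<open>1 / (s + \<kappa>\<^sup>2)\<close> with weight \<open>2 / pi * \<kappa> * sin (t \<kappa>)\<close>; the factor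
  \<open>exp (- \<epsilon> \<kappa>)\<close> makes the integral over \<open>\<kappa>\<close> converge absolutely.
\<close>

definition weight :: "real \<Rightarrow> real \<Rightarrow> real \<Rightarrow> real" where
  "weight t \<epsilon> \<kappa> = 2 / pi * (exp (- \<epsilon> * \<kappa>) * (\<kappa> * sin (t * \<kappa>)))"

lemma weight_measurable [measurable]: "weight t \<epsilon> \<in> borel_measurable borel"
  unfolding weight_def by measurable

text \<open>|sin (t \<kappa>)| \<le> t \<kappa> provides a second factor \<kappa>. The resulting
  \<kappa>^2 absorbs the size 1 / \<kappa>^2 of the resolvents near \<kappa> = 0.\<close>

lemma abs_weight_le:
  assumes "t > 0" "\<kappa> > 0"
  shows "\<bar>weight t \<epsilon> \<kappa>\<bar> \<le> 2 / pi * t * (\<kappa>\<^sup>2 * exp (- \<epsilon> * \<kappa>))"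
proof -
  have "\<bar>weight t \<epsilon> \<kappa>\<bar> = 2 / pi * exp (- \<epsilon> * \<kappa>) * \<kappa> * \<bar>sin (t * \<kappa>)\<bar>"
    using assms by (simp add: weight_def abs_mult)
  also have "\<dots> \<le> 2 / pi * exp (- \<epsilon> * \<kappa>) * \<kappa> * (t * \<kappa>)"
    using assms abs_sin_x_le_abs_x[of "t * \<kappa>"] by (intro mult_left_mono) (auto simp: abs_mult)
  finally show ?thesis by (simp add: power2_eq_square ac_simps)
qed

lemma integrable_product_half_line:
  fixes u v :: "real \<Rightarrow> real"
  assumes u: "integrable half_line u" and v: "integrable half_line v"
  shows "integrable (half_line \<Otimes>\<^sub>M half_line) (\<lambda>p. u (fst p) * v (snd p))"
proof (rule half_line2.Fubini_integrable)
  have [measurable]: "u \<in> borel_measurable half_line" "v \<in> borel_measurable half_line"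
    using u v by auto
  show "(\<lambda>p. u (fst p) * v (snd p)) \<in> borel_measurable (half_line \<Otimes>\<^sub>M half_line)"
    by measurable
  have "(\<lambda>x. LINT y|half_line. norm (u (fst (x, y)) * v (snd (x, y)))) =
      (\<lambda>x. \<bar>u x\<bar> * (LINT y|half_line. \<bar>v y\<bar>))"
    by (simp add: abs_mult)
  then show "integrable half_line (\<lambda>x. LINT y|half_line. norm (u (fst (x, y)) * v (snd (x, y))))"
    using u by simp
  show "AE x in half_line. integrable half_line (\<lambda>y. u (fst (x, y)) * v (snd (x, y)))"
    using v by (intro AE_I2) auto
qed

lemma poisson_le: "t > 0 \<Longrightarrow> poisson t r \<le> 1 / t"
  using poisson_mono[of t 0 "\<bar>r\<bar>"] by (simp add: poisson_def power2_eq_square)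

lemma poisson_tail_integrable:
  assumes "t > 0" "\<alpha> > 0"
  shows "integrable half_line (\<lambda>q. exp (- \<alpha> * q) * poisson t (r + N * q))"
proof (rule half_line_integrable_bound[OF integrable_mult_left[OF half_line_exp(1)[OF assms(2)], of "1 / t"]])
  show "norm (exp (- \<alpha> * q) * poisson t (r + N * q)) \<le> exp (- \<alpha> * q) * (1 / t)" for q
    unfolding real_norm_def abs_mult abs_exp_cancel abs_of_nonneg[OF poisson_nonneg[OF assms(1)]]
    by (intro mult_left_mono poisson_le assms) simp
qed (auto intro!: half_line_measurable)

text \<open>\<alpha> exp (- \<alpha> q) is a probability density on the half-line, so \<alpha> times
  the tail averages \<open>poisson t\<close> over arguments that are at least r, where it is
  decreasing.\<close>

lemma poisson_tail_bounds:
  assumes "t > 0" "\<alpha> > 0" "N > 0" "r \<ge> 0"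
  shows "0 \<le> poisson_tail N \<alpha> t r" "\<alpha> * poisson_tail N \<alpha> t r \<le> poisson t r"
proof -
  show "0 \<le> poisson_tail N \<alpha> t r"
    unfolding poisson_tail_def using poisson_nonneg[OF assms(1)] by (intro integral_nonneg_AE AE_I2) simp
  have "poisson_tail N \<alpha> t r \<le> (LINT q|half_line. exp (- \<alpha> * q) * poisson t r)"
    unfolding poisson_tail_def
    by (intro integral_mono_AE poisson_tail_integrable AE_half_line_if_positive mult_left_mono poisson_mono
        integrable_mult_left half_line_exp(1) assms) (use assms in auto)
  also have "\<dots> = poisson t r / \<alpha>"
    using half_line_exp(2)[OF assms(2)] by simp
  finally show "\<alpha> * poisson_tail N \<alpha> t r \<le> poisson t r"
    using assms by (simp add: field_simps)
qed

text \<open>Dominated convergence copes with continuity almost everywhere in p. This form is made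
  for \<open>dirichlet_kernel'\<close>, which jumps where its two arguments coincide.\<close>

lemma isCont_parameter_integral:
  fixes f :: "real \<Rightarrow> 'a \<Rightarrow> 'b::{banach, second_countable_topology}"
  assumes "\<And>k. f k \<in> borel_measurable M" "AE p in M. isCont (\<lambda>k. f k p) k0"
    "integrable M g" "\<And>k. \<bar>k - k0\<bar> \<le> 1 \<Longrightarrow> AE p in M. norm (f k p) \<le> g p"
  shows "isCont (\<lambda>k. LINT p|M. f k p) k0"
  unfolding continuous_at_sequentially comp_def
proof (intro allI impI)
  fix X :: "nat \<Rightarrow> real" assume X: "X \<longlonglongrightarrow> k0"
  from LIMSEQ_D[OF this, of 1] obtain n0 where n0: "\<And>n. n \<ge> n0 \<Longrightarrow> \<bar>X n - k0\<bar> \<le> 1"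
    by (force intro: less_imp_le)
  have X': "(\<lambda>n. X (n + n0)) \<longlonglongrightarrow> k0" using X by (rule LIMSEQ_ignore_initial_segment)
  have "(\<lambda>n. LINT p|M. f (X (n + n0)) p) \<longlonglongrightarrow> (LINT p|M. f k0 p)"
  proof (rule integral_dominated_convergence)
    show "AE p in M. (\<lambda>n. f (X (n + n0)) p) \<longlonglongrightarrow> f k0 p"
      using assms(2) by eventually_elim (rule isCont_tendsto_compose[OF _ X'])
    show "AE p in M. norm (f (X (n + n0)) p) \<le> g p" for n
      by (rule assms(4)) (use n0 in auto)
  qed (use assms in auto)
  then show "(\<lambda>n. LINT p|M. f (X n) p) \<longlonglongrightarrow> (LINT p|M. f k0 p)"
    by (rule LIMSEQ_offset)
qed

lemma isCont_poisson: "t > 0 \<Longrightarrow> isCont (poisson t) r"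
  unfolding poisson_def using poisson_denom_pos[of t r] by (intro continuous_intros) auto

lemma isCont_poisson_tail:
  assumes "t > 0" "\<alpha> > 0"
  shows "isCont (poisson_tail N \<alpha> t) r"
  unfolding poisson_tail_def
proof (rule isCont_parameter_integral[OF _ _ integrable_mult_left[OF half_line_exp(1)[OF assms(2)], of "1 / t"]])
  show "AE q in half_line. norm (exp (- \<alpha> * q) * poisson t (k + N * q)) \<le> exp (- \<alpha> * q) * (1 / t)" for k
    unfolding real_norm_def abs_mult abs_exp_cancel abs_of_nonneg[OF poisson_nonneg[OF assms(1)]]
    by (intro AE_I2 mult_left_mono poisson_le assms) simp
  show "AE q in half_line. isCont (\<lambda>k. exp (- \<alpha> * q) * poisson t (k + N * q)) r"
    by (intro AE_I2 continuous_intros isCont_o2[OF _ isCont_poisson] assms)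
qed (auto intro!: half_line_measurable)

lemma isCont_cylinder_a: "t > 0 \<Longrightarrow> isCont (cylinder_a t) r"
  unfolding cylinder_a_def by (intro continuous_intros isCont_poisson) auto

lemma isCont_cylinder_b: "t > 0 \<Longrightarrow> \<alpha> > 0 \<Longrightarrow> isCont (cylinder_b N \<alpha> t) r"
  unfolding cylinder_b_def by (intro continuous_intros isCont_poisson isCont_poisson_tail)

text \<open>The factor \<kappa> of the weight cancels the denominator 2 \<kappa>, which leaves the
  Laplace transform of sin (t \<kappa>) at r + \<epsilon>: the regularization is nothing but a shift
  of the distance.\<close>

lemma weight_resolvent_a:
  assumes "t > 0" "\<epsilon> > 0" "r \<ge> 0"
  shows "integrable half_line (\<lambda>\<kappa>. weight t \<epsilon> \<kappa> * resolvent_a \<kappa> r)"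
    "(LINT \<kappa>|half_line. weight t \<epsilon> \<kappa> * resolvent_a \<kappa> r) = cylinder_a t (r + \<epsilon>)"
proof -
  have pos: "0 < r + \<epsilon>" using assms by simp
  have eq: "weight t \<epsilon> \<kappa> * resolvent_a \<kappa> r = 1 / pi * (exp (- (r + \<epsilon>) * \<kappa>) * sin (t * \<kappa>))"
    if "\<kappa> > 0" for \<kappa>
  proof -
    have "exp (- (r + \<epsilon>) * \<kappa>) = exp (- \<epsilon> * \<kappa>) * exp (- \<kappa> * r)"
      by (simp add: mult_exp_exp algebra_simps)
    then show ?thesis using that by (simp add: weight_def resolvent_a_def)
  qed
  note L = half_line_Laplace_sin[OF pos, of t]
  show "integrable half_line (\<lambda>\<kappa>. weight t \<epsilon> \<kappa> * resolvent_a \<kappa> r)"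
    using eq by (intro Bochner_Integration.integrable_cong[THEN iffD1, OF refl _ integrable_mult_right[OF L(1), of "1 / pi"]]) simp
  have "(LINT \<kappa>|half_line. weight t \<epsilon> \<kappa> * resolvent_a \<kappa> r)
      = (LINT \<kappa>|half_line. 1 / pi * (exp (- (r + \<epsilon>) * \<kappa>) * sin (t * \<kappa>)))"
    by (intro Bochner_Integration.integral_cong refl eq) simp
  also have "\<dots> = 1 / pi * (t / (t\<^sup>2 + (r + \<epsilon>)\<^sup>2))"
    unfolding integral_mult_right_zero L(2) ..
  finally show "(LINT \<kappa>|half_line. weight t \<epsilon> \<kappa> * resolvent_a \<kappa> r) = cylinder_a t (r + \<epsilon>)"
    by (simp add: cylinder_a_def poisson_def)
qed

text \<open>\<open>F\<close> replaces 1 / (N \<kappa> + \<alpha>) by its Laplace integral over q.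
  Integrating over q first gives \<open>D\<close>; integrating over \<kappa> first gives Poisson
  kernels at r + \<epsilon> + N q, hence \<open>poisson_tail\<close>.\<close>

lemma weight_resolvent_b:
  assumes "t > 0" "\<epsilon> > 0" "r \<ge> 0" "N > 0" "\<alpha> > 0"
  shows "integrable half_line (\<lambda>\<kappa>. weight t \<epsilon> \<kappa> * resolvent_b N \<alpha> \<kappa> r)"
    "(LINT \<kappa>|half_line. weight t \<epsilon> \<kappa> * resolvent_b N \<alpha> \<kappa> r) = cylinder_b N \<alpha> t (r + \<epsilon>)"
proof -
  have pos: "0 < r + \<epsilon>" using assms by simp
  define F where "F = (\<lambda>p. exp (- (r + \<epsilon>) * fst p) * sin (t * fst p) * (exp (- (N * fst p + \<alpha>) * snd p)))"
  note L = half_line_Laplace_sin[OF pos, of t]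
  have m: "F \<in> borel_measurable (half_line \<Otimes>\<^sub>M half_line)"
    unfolding F_def by (rule pair_half_line_measurable) measurable
  have iF: "integrable (half_line \<Otimes>\<^sub>M half_line) F"
  proof (rule Bochner_Integration.integrable_bound[OF _ m])
    show "integrable (half_line \<Otimes>\<^sub>M half_line) (\<lambda>p. exp (- (r + \<epsilon>) * fst p) * exp (- \<alpha> * snd p))"
      by (rule integrable_product_half_line half_line_exp pos assms)+
    show "AE p in half_line \<Otimes>\<^sub>M half_line. norm (F p) \<le> norm (exp (- (r + \<epsilon>) * fst p) * exp (- \<alpha> * snd p))"
    proof (intro AE_I2)
      fix p :: "real \<times> real" assume "p \<in> space (half_line \<Otimes>\<^sub>M half_line)"
      then have "fst p > 0" "snd p > 0" by (auto simp: space_pair_measure)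
      then have "exp (- (N * fst p + \<alpha>) * snd p) \<le> exp (- \<alpha> * snd p)"
        using assms by (simp add: algebra_simps)
      then have "exp (- (r + \<epsilon>) * fst p) * \<bar>sin (t * fst p)\<bar> * exp (- (N * fst p + \<alpha>) * snd p)
          \<le> exp (- (r + \<epsilon>) * fst p) * 1 * exp (- \<alpha> * snd p)"
        by (intro mult_mono) auto
      then show "norm (F p) \<le> norm (exp (- (r + \<epsilon>) * fst p) * exp (- \<alpha> * snd p))"
        by (simp add: F_def abs_mult)
    qed
  qed
  have in1: "(LINT q|half_line. F (\<kappa>, q)) = exp (- (r + \<epsilon>) * \<kappa>) * sin (t * \<kappa>) / (N * \<kappa> + \<alpha>)" if "\<kappa> > 0" for \<kappa>
    using half_line_exp(2)[of "N * \<kappa> + \<alpha>"] assms that by (simp add: F_def add_pos_pos)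
  have in2: "(LINT \<kappa>|half_line. F (\<kappa>, q)) = exp (- \<alpha> * q) * poisson t (r + \<epsilon> + N * q)" if "q > 0" for q
  proof -
    have "F (\<kappa>, q) = exp (- \<alpha> * q) * (exp (- (r + \<epsilon> + N * q) * \<kappa>) * sin (t * \<kappa>))" for \<kappa>
    proof -
      have "exp (- (r + \<epsilon>) * \<kappa>) * exp (- (N * \<kappa> + \<alpha>) * q) = exp (- \<alpha> * q) * exp (- (r + \<epsilon> + N * q) * \<kappa>)"
        unfolding mult_exp_exp by (simp add: algebra_simps)
      then show ?thesis by (simp add: F_def)
    qed
    moreover have "0 < r + \<epsilon> + N * q" using assms that by (simp add: add_nonneg_pos)
    ultimately show ?thesis
      using half_line_Laplace_sin(2)[of "r + \<epsilon> + N * q" t] by (simp add: poisson_def)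
  qed
  define D where "D = (\<lambda>\<kappa>. exp (- (r + \<epsilon>) * \<kappa>) * sin (t * \<kappa>) / (N * \<kappa> + \<alpha>))"
  have iD: "integrable half_line D"
    using half_line2.integrable_fst'[OF iF] in1
    by (intro Bochner_Integration.integrable_cong[THEN iffD1, OF refl _ half_line2.integrable_fst'[OF iF]]) (simp add: D_def)
  have "integral\<^sup>L half_line D = (LINT \<kappa>|half_line. LINT q|half_line. F (\<kappa>, q))"
    using in1 by (intro Bochner_Integration.integral_cong) (auto simp: D_def)
  also have "\<dots> = (LINT q|half_line. LINT \<kappa>|half_line. F (\<kappa>, q))"
    using half_line2.Fubini_integral[of "\<lambda>\<kappa> q. F (\<kappa>, q)"] iF by (simp add: case_prod_beta')
  also have "\<dots> = poisson_tail N \<alpha> t (r + \<epsilon>)"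
    unfolding poisson_tail_def using in2 by (intro Bochner_Integration.integral_cong) auto
  finally have D: "integral\<^sup>L half_line D = poisson_tail N \<alpha> t (r + \<epsilon>)" .
  define S where "S = (\<lambda>\<kappa>. exp (- (r + \<epsilon>) * \<kappa>) * sin (t * \<kappa>))"
  have S: "integrable half_line S" "integral\<^sup>L half_line S = poisson t (r + \<epsilon>)"
    using L by (simp_all add: S_def poisson_def)
  have eq: "weight t \<epsilon> \<kappa> * resolvent_b N \<alpha> \<kappa> r = 2 / (N * pi) * (S \<kappa> - \<alpha> * D \<kappa>)" if "\<kappa> > 0" for \<kappa>
  proof -
    have n: "N * \<kappa> + \<alpha> > 0" using assms that by (simp add: add_pos_pos)
    have "exp (- (r + \<epsilon>) * \<kappa>) = exp (- \<epsilon> * \<kappa>) * exp (- \<kappa> * r)"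
      unfolding mult_exp_exp by (simp add: algebra_simps)
    then have "weight t \<epsilon> \<kappa> * resolvent_b N \<alpha> \<kappa> r = 2 / pi * (S \<kappa> * \<kappa> / (N * \<kappa> + \<alpha>))"
      by (simp add: weight_def resolvent_b_def S_def)
    \<comment> \<open>From \<kappa> / (N \<kappa> + \<alpha>) = (1 - \<alpha> / (N \<kappa> +
      \<alpha>)) / N: the first summand is the scale-free (Kirchhoff) part, the second the
      correction due to \<alpha>.\<close>
    also have "S \<kappa> * \<kappa> / (N * \<kappa> + \<alpha>) = (S \<kappa> - \<alpha> * (S \<kappa> / (N * \<kappa> + \<alpha>))) / N"
    proof -
      have "N * \<kappa> + \<alpha> \<noteq> 0" "N \<noteq> 0" using n assms by auto
      then show ?thesis by (simp add: divide_simps) (simp add: algebra_simps)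
    qed
    also have "S \<kappa> / (N * \<kappa> + \<alpha>) = D \<kappa>" by (simp add: S_def D_def)
    finally show ?thesis by simp
  qed
  have i: "integrable half_line (\<lambda>\<kappa>. 2 / (N * pi) * (S \<kappa> - \<alpha> * D \<kappa>))"
    using S(1) iD by (intro integrable_mult_right Bochner_Integration.integrable_diff)
  show "integrable half_line (\<lambda>\<kappa>. weight t \<epsilon> \<kappa> * resolvent_b N \<alpha> \<kappa> r)"
    using eq by (intro Bochner_Integration.integrable_cong[THEN iffD1, OF refl _ i]) simp
  have "(LINT \<kappa>|half_line. weight t \<epsilon> \<kappa> * resolvent_b N \<alpha> \<kappa> r) = (LINT \<kappa>|half_line. 2 / (N * pi) * (S \<kappa> - \<alpha> * D \<kappa>))"
    by (intro Bochner_Integration.integral_cong refl eq) simp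
  also have "\<dots> = 2 / (N * pi) * (poisson t (r + \<epsilon>) - \<alpha> * poisson_tail N \<alpha> t (r + \<epsilon>))"
    unfolding integral_mult_right_zero using S iD D
    by (subst Bochner_Integration.integral_diff) (auto simp del: mult_cancel_left)
  finally show "(LINT \<kappa>|half_line. weight t \<epsilon> \<kappa> * resolvent_b N \<alpha> \<kappa> r) = cylinder_b N \<alpha> t (r + \<epsilon>)"
    by (simp add: cylinder_b_def)
qed

section \<open>The Abel-regularized exponential\<close>

definition regularized_exp :: "real \<Rightarrow> real \<Rightarrow> real \<Rightarrow> real" where
  "regularized_exp t \<epsilon> s = (LINT \<kappa>|half_line. weight t \<epsilon> \<kappa> / (s + \<kappa>\<^sup>2))"

text \<open>\<kappa> / (k^2 + \<kappa>^2) is the integral of exp (- \<kappa> p) cos (k p) over p.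
  After exchanging the integrations, the one over \<kappa> is a Laplace transform of sin (t
  \<kappa>) at p + \<epsilon>, and letting \<epsilon> tend to 0 is harmless in the resulting cosine
  transform.\<close>

lemma regularized_exp_eq:
  assumes "t > 0" "\<epsilon> > 0"
  shows "regularized_exp t \<epsilon> (k\<^sup>2) = 2 / pi * (LINT p|half_line. cos (k * p) * poisson t (p + \<epsilon>))"
proof -
  define F where "F = (\<lambda>q. exp (- \<epsilon> * fst q) * sin (t * fst q) * (exp (- fst q * snd q) * cos (k * snd q)))"
  have m: "F \<in> borel_measurable (half_line \<Otimes>\<^sub>M half_line)"
    unfolding F_def by (rule pair_half_line_measurable) measurable
  have iF: "integrable (half_line \<Otimes>\<^sub>M half_line) F"
  proof (rule half_line2.Fubini_integrable[OF m])
    show "AE \<kappa> in half_line. integrable half_line (\<lambda>p. F (\<kappa>, p))"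
      using half_line_Laplace_cos(1)
      by (intro AE_half_line_if_positive) (auto simp: F_def intro!: integrable_mult_right)
    show "integrable half_line (\<lambda>\<kappa>. LINT p|half_line. norm (F (\<kappa>, p)))"
    proof (rule half_line_integrable_bound[OF integrable_mult_right[OF half_line_exp(1)[OF assms(2)], of t]])
      have "(\<lambda>q. norm (F q)) \<in> borel_measurable (half_line \<Otimes>\<^sub>M half_line)" using m by measurable
      then have "case_prod (\<lambda>\<kappa> p. norm (F (\<kappa>, p))) \<in> borel_measurable (half_line \<Otimes>\<^sub>M half_line)"
        by (simp add: case_prod_beta')
      then show "(\<lambda>\<kappa>. LINT p|half_line. norm (F (\<kappa>, p))) \<in> borel_measurable half_line"
        by (rule half_line.borel_measurable_lebesgue_integral)
      fix \<kappa> :: real assume \<kappa>: "\<kappa> > 0"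
      \<comment> \<open>Bounding |sin (t \<kappa>)| by t \<kappa> compensates the 1 / \<kappa> that
        the integral over p produces, so the \<kappa>-integral converges at 0 as well.\<close>
      have "(LINT p|half_line. norm (F (\<kappa>, p))) \<le> (LINT p|half_line. exp (- \<epsilon> * \<kappa>) * (t * \<kappa>) * exp (- \<kappa> * p))"
      proof (rule integral_mono_AE)
        show "integrable half_line (\<lambda>p. norm (F (\<kappa>, p)))"
          using half_line_Laplace_cos(1)[OF \<kappa>]
          by (intro integrable_norm) (auto simp: F_def intro!: integrable_mult_right)
        show "integrable half_line (\<lambda>p. exp (- \<epsilon> * \<kappa>) * (t * \<kappa>) * exp (- \<kappa> * p))"
          using half_line_exp(1)[OF \<kappa>] by (rule integrable_mult_right)
        show "AE p in half_line. norm (F (\<kappa>, p)) \<le> exp (- \<epsilon> * \<kappa>) * (t * \<kappa>) * exp (- \<kappa> * p)"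
        proof (rule AE_I2)
          fix p
          have "exp (- \<epsilon> * \<kappa>) * \<bar>sin (t * \<kappa>)\<bar> * (exp (- \<kappa> * p) * \<bar>cos (k * p)\<bar>)
              \<le> exp (- \<epsilon> * \<kappa>) * (t * \<kappa>) * (exp (- \<kappa> * p) * 1)"
            using assms \<kappa> abs_sin_x_le_abs_x[of "t * \<kappa>"] by (intro mult_mono) (auto simp: abs_mult)
          then show "norm (F (\<kappa>, p)) \<le> exp (- \<epsilon> * \<kappa>) * (t * \<kappa>) * exp (- \<kappa> * p)"
            by (simp add: F_def abs_mult)
        qed
      qed
      also have "\<dots> = t * exp (- \<epsilon> * \<kappa>)"
        unfolding integral_mult_right_zero half_line_exp(2)[OF \<kappa>] using \<kappa> by simp
      finally show "norm (LINT p|half_line. norm (F (\<kappa>, p))) \<le> t * exp (- \<epsilon> * \<kappa>)"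
        by simp
    qed
  qed
  have in1: "weight t \<epsilon> \<kappa> / (k\<^sup>2 + \<kappa>\<^sup>2) = 2 / pi * (LINT p|half_line. F (\<kappa>, p))" if "\<kappa> > 0" for \<kappa>
    using half_line_Laplace_cos(2)[OF that, of k] by (simp add: F_def weight_def)
  have in2: "(LINT \<kappa>|half_line. F (\<kappa>, p)) = cos (k * p) * poisson t (p + \<epsilon>)" if "p > 0" for p
  proof -
    have "F (\<kappa>, p) = cos (k * p) * (exp (- (p + \<epsilon>) * \<kappa>) * sin (t * \<kappa>))" for \<kappa>
    proof -
      have "exp (- (p + \<epsilon>) * \<kappa>) = exp (- \<epsilon> * \<kappa>) * exp (- \<kappa> * p)"
        unfolding mult_exp_exp by (simp add: algebra_simps)
      then show ?thesis by (simp add: F_def)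
    qed
    then show ?thesis
      using half_line_Laplace_sin(2)[of "p + \<epsilon>" t] assms that by (simp add: poisson_def)
  qed
  have "regularized_exp t \<epsilon> (k\<^sup>2) = (LINT \<kappa>|half_line. 2 / pi * (LINT p|half_line. F (\<kappa>, p)))"
    unfolding regularized_exp_def by (intro Bochner_Integration.integral_cong refl in1) simp
  also have "\<dots> = 2 / pi * (LINT \<kappa>|half_line. LINT p|half_line. F (\<kappa>, p))"
    by (rule integral_mult_right_zero)
  also have "(LINT \<kappa>|half_line. LINT p|half_line. F (\<kappa>, p)) = (LINT p|half_line. LINT \<kappa>|half_line. F (\<kappa>, p))"
    using half_line2.Fubini_integral[of "\<lambda>\<kappa> q. F (\<kappa>, q)"] iF by (simp add: case_prod_beta')
  also have "\<dots> = (LINT p|half_line. cos (k * p) * poisson t (p + \<epsilon>))"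
    by (intro Bochner_Integration.integral_cong refl in2) simp
  finally show ?thesis .
qed

lemma poisson_cos_bound:
  assumes "t > 0" "\<epsilon> \<ge> 0" "p > 0"
  shows "\<bar>cos (k * p) * poisson t (p + \<epsilon>)\<bar> \<le> poisson t p"
proof -
  have "\<bar>cos (k * p)\<bar> * poisson t (p + \<epsilon>) \<le> 1 * poisson t p"
    using assms by (intro mult_mono poisson_mono poisson_nonneg) auto
  then show ?thesis by (simp add: abs_mult poisson_nonneg[OF assms(1)])
qed

text \<open>The mass pi / 2 of the Poisson kernel matches the prefactor 2 / pi. The bound is uniform
  in \<epsilon> and k, so constants dominate when \<epsilon> tends to 0 under a finite spectral
  measure.\<close>

lemma abs_regularized_exp_le:
  assumes "t > 0" "\<epsilon> > 0"
  shows "\<bar>regularized_exp t \<epsilon> (k\<^sup>2)\<bar> \<le> 1"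
proof -
  have "integrable half_line (\<lambda>p. cos (k * p) * poisson t (p + \<epsilon>))"
    by (rule half_line_integrable_bound[OF half_line_poisson(1)[OF assms(1)]])
      (use poisson_cos_bound[of t \<epsilon>] assms in \<open>auto intro!: half_line_measurable\<close>)
  then have "\<bar>LINT p|half_line. cos (k * p) * poisson t (p + \<epsilon>)\<bar> \<le> integral\<^sup>L half_line (poisson t)"
    using poisson_cos_bound[of t \<epsilon>] assms half_line_poisson(1)[OF assms(1)]
    by (intro order.trans[OF integral_abs_bound] integral_mono_AE AE_half_line_if_positive) auto
  also have "\<dots> = pi / 2" by (rule half_line_poisson(2)[OF assms(1)])
  finally show ?thesis unfolding regularized_exp_eq[OF assms] by (simp add: abs_mult)
qed

lemma regularized_exp_tendsto:
  assumes "t > 0" "k \<ge> 0"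
  shows "(\<lambda>n. regularized_exp t (1 / Suc n) (k\<^sup>2)) \<longlonglongrightarrow> exp (- t * k)"
proof -
  have "(\<lambda>n. LINT p|half_line. cos (k * p) * poisson t (p + 1 / Suc n)) \<longlonglongrightarrow>
      (LINT p|half_line. cos (k * p) * poisson t p)"
  proof (rule integral_dominated_convergence[OF _ _ half_line_poisson(1)[OF assms(1)]])
    show "AE p in half_line. (\<lambda>n. cos (k * p) * poisson t (p + 1 / Suc n)) \<longlonglongrightarrow> cos (k * p) * poisson t p"
    proof (rule AE_I2)
      fix p
      have "(\<lambda>n. p + 1 / Suc n) \<longlonglongrightarrow> p + 0"
        using LIMSEQ_inverse_real_of_nat by (intro tendsto_intros) (simp add: inverse_eq_divide)
      then show "(\<lambda>n. cos (k * p) * poisson t (p + 1 / Suc n)) \<longlonglongrightarrow> cos (k * p) * poisson t p"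
        by (intro tendsto_intros isCont_tendsto_compose[OF isCont_poisson[OF assms(1)]]) simp
    qed
    show "AE p in half_line. norm (cos (k * p) * poisson t (p + 1 / Suc n)) \<le> poisson t p" for n
      using poisson_cos_bound[OF assms(1), of "1 / Suc n"] by (intro AE_half_line_if_positive) simp
  qed (auto intro!: half_line_measurable)
  then have "(\<lambda>n. 2 / pi * (LINT p|half_line. cos (k * p) * poisson t (p + 1 / Suc n))) \<longlonglongrightarrow>
      2 / pi * (pi / 2 * exp (- t * k))"
    unfolding cos_transform_poisson[OF assms] by (rule tendsto_mult_left)
  then show ?thesis using assms by (simp add: regularized_exp_eq)
qed

section \<open>Kernels on the star graph\<close>

definition star_kernel :: "(real \<Rightarrow> real) \<Rightarrow> (real \<Rightarrow> real) \<Rightarrow> 'n::finite \<Rightarrow> 'n \<Rightarrow> real \<Rightarrow> real \<Rightarrow> real" where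
  "star_kernel a b j l x y = (if j = l then a \<bar>x - y\<bar> - a (x + y) else 0) + b (x + y)"

lemma star_kernel_commute: "star_kernel a b j l x y = star_kernel a b l j y x"
  by (simp add: star_kernel_def abs_minus_commute add.commute)

definition star_op :: "(real \<Rightarrow> real) \<Rightarrow> (real \<Rightarrow> real) \<Rightarrow> 'n::finite wave \<Rightarrow> 'n wave" where
  "star_op a b f = (\<lambda>j x. \<Sum>l\<in>UNIV. LINT y|half_line. of_real (star_kernel a b j l x y) * f l y)"

text \<open>Kept as double integrals, so that the integration over \<kappa> can be exchanged with x
  and y jointly; \<open>l2_inner_star_op\<close> identifies it with the form of
  \<open>star_op\<close>.\<close>

definition star_form :: "(real \<Rightarrow> real) \<Rightarrow> (real \<Rightarrow> real) \<Rightarrow> 'n::finite wave \<Rightarrow> 'n wave \<Rightarrow> complex" where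
  "star_form a b h f = (\<Sum>j\<in>UNIV. \<Sum>l\<in>UNIV. LINT p|(half_line \<Otimes>\<^sub>M half_line).
     cnj (h j (fst p)) * (of_real (star_kernel a b j l (fst p) (snd p)) * f l (snd p)))"

text \<open>With r = |x - y| and s = x + y, the single inequality for a and b covers equal edges
  (difference of a plus b) as well as distinct edges (b alone).\<close>

locale star_kernel_bound =
  fixes a b g :: "real \<Rightarrow> real"
  assumes measurable_abg: "a \<in> borel_measurable borel" "b \<in> borel_measurable borel" "g \<in> borel_measurable borel"
    and nonneg_g: "\<And>r. 0 \<le> g r"
    and integrable_g: "integrable half_line g"
    and bound_abg: "\<And>r s. 0 \<le> r \<Longrightarrow> r \<le> s \<Longrightarrow> \<bar>a r - a s\<bar> + \<bar>b s\<bar> \<le> g r"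
begin

lemma star_kernel_le:
  assumes "x > 0" "y > 0"
  shows "\<bar>star_kernel a b j l x y\<bar> \<le> g \<bar>x - y\<bar>"
  using bound_abg[of "\<bar>x - y\<bar>" "x + y"] assms by (auto simp: star_kernel_def abs_if split: if_splits)

lemma kernel_bound: "kernel_bound g (star_kernel a b j l)"
proof
  note [measurable] = measurable_abg
  show "(\<lambda>p. star_kernel a b j l (fst p) (snd p)) \<in> borel_measurable (borel \<Otimes>\<^sub>M borel)"
    unfolding star_kernel_def by measurable
qed (fact measurable_abg nonneg_g integrable_g star_kernel_le)+

lemma star_op_eq: "star_op a b f = (\<lambda>j x. \<Sum>l\<in>UNIV. kernel_bound.op (star_kernel a b j l) (f l) x)"
  by (simp add: star_op_def kernel_bound.op_def[OF kernel_bound])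

lemma star_op_L2:
  assumes "f \<in> L2"
  shows "star_op a b f \<in> L2"
  unfolding L2_def star_op_eq
proof (intro CollectI allI)
  fix j
  have "(\<lambda>x. \<Sum>l\<in>I. kernel_bound.op (star_kernel a b j l) (f l) x) \<in> L2_half_line" if "finite I" for I
    using that
  proof (induction I)
    case empty
    then show ?case by (simp add: L2_half_line_def)
  next
    case (insert l I)
    show ?case unfolding sum.insert[OF insert.hyps]
      by (intro add_L2_half_line kernel_bound.op_L2(1)[OF kernel_bound L2_D[OF assms]] insert.IH)
  qed
  then show "(\<lambda>x. \<Sum>l\<in>UNIV. kernel_bound.op (star_kernel a b j l) (f l) x) \<in> L2_half_line" by simp
qed

text \<open>One factor N comes from Cauchy-Schwarz over the source edges, the other from summing
  over the target edges; each single kernel contributes the Schur constant.\<close>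

lemma star_op_norm:
  fixes f :: "'n::finite wave"
  assumes f: "f \<in> L2"
  shows "(l2_norm (star_op a b f))\<^sup>2 \<le> (real CARD('n))\<^sup>2 * (4 * (integral\<^sup>L half_line g)\<^sup>2) * (l2_norm f)\<^sup>2"
proof -
  let ?N = "real CARD('n)" and ?C = "4 * (integral\<^sup>L half_line g)\<^sup>2"
  let ?u = "\<lambda>j l. kernel_bound.op (star_kernel a b j l) (f l)"
  have u: "?u j l \<in> L2_half_line"
    "(LINT x|half_line. (cmod (?u j l x))\<^sup>2) \<le> ?C * (LINT x|half_line. (cmod (f l x))\<^sup>2)" for j l
    using kernel_bound.op_L2[OF kernel_bound L2_D[OF f]] by auto
  have "(LINT x|half_line. (cmod (star_op a b f j x))\<^sup>2) \<le> ?N * (?C * (l2_norm f)\<^sup>2)" for j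
  proof -
    have "(LINT x|half_line. (cmod (star_op a b f j x))\<^sup>2) \<le>
        (LINT x|half_line. (\<Sum>l\<in>UNIV. (cmod (?u j l x))\<^sup>2) * ?N)"
    proof (rule integral_mono)
      show "integrable half_line (\<lambda>x. (cmod (star_op a b f j x))\<^sup>2)"
        by (intro L2_half_line_square L2_D star_op_L2 f)
      show "integrable half_line (\<lambda>x. (\<Sum>l\<in>UNIV. (cmod (?u j l x))\<^sup>2) * ?N)"
        by (intro integrable_mult_left Bochner_Integration.integrable_sum L2_half_line_square u)
      show "(cmod (star_op a b f j x))\<^sup>2 \<le> (\<Sum>l\<in>UNIV. (cmod (?u j l x))\<^sup>2) * ?N" for x
      proof -
        have "(cmod (star_op a b f j x))\<^sup>2 \<le> (\<Sum>l\<in>UNIV. cmod (?u j l x))\<^sup>2"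
          unfolding star_op_eq by (intro power_mono norm_sum) auto
        also have "\<dots> \<le> (\<Sum>l\<in>UNIV. (cmod (?u j l x))\<^sup>2) * ?N"
          by (rule sum_squared_le_sum_of_squares)
        finally show ?thesis .
      qed
    qed
    also have "\<dots> = (\<Sum>l\<in>UNIV. LINT x|half_line. (cmod (?u j l x))\<^sup>2) * ?N"
      by (simp add: L2_half_line_square u)
    also have "\<dots> \<le> (\<Sum>l\<in>UNIV. ?C * (LINT x|half_line. (cmod (f l x))\<^sup>2)) * ?N"
      by (intro mult_right_mono sum_mono u) auto
    finally show ?thesis unfolding l2_norm_square[of f] by (simp add: sum_distrib_left mult.commute)
  qed
  then have "(l2_norm (star_op a b f))\<^sup>2 \<le> (\<Sum>j\<in>(UNIV::'n set). ?N * (?C * (l2_norm f)\<^sup>2))"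
    unfolding l2_norm_square[of "star_op a b f"] by (rule sum_mono)
  then show ?thesis by (simp add: power2_eq_square mult.assoc)
qed

lemma form_integrable:
  assumes "h \<in> L2" "f \<in> L2"
  shows "integrable (half_line \<Otimes>\<^sub>M half_line)
     (\<lambda>p. cnj (h j (fst p)) * (of_real (star_kernel a b j l (fst p) (snd p)) * f l (snd p)))"
  using kernel_bound.form_integrable[OF kernel_bound L2_D[OF assms(2)] cnj_L2_half_line[OF L2_D[OF assms(1)]]] .

lemma l2_inner_star_op:
  assumes h: "h \<in> L2" and f: "f \<in> L2"
  shows "l2_inner h (star_op a b f) = star_form a b h f"
proof -
  have "(LINT x|half_line. cnj (h j x) * star_op a b f j x) =
     (\<Sum>l\<in>UNIV. LINT p|(half_line \<Otimes>\<^sub>M half_line).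
       cnj (h j (fst p)) * (of_real (star_kernel a b j l (fst p) (snd p)) * f l (snd p)))" for j
  proof -
    have "(LINT x|half_line. cnj (h j x) * star_op a b f j x) =
        (LINT x|half_line. (\<Sum>l\<in>UNIV. cnj (h j x) * kernel_bound.op (star_kernel a b j l) (f l) x))"
      unfolding star_op_eq by (simp add: sum_distrib_left)
    also have "\<dots> = (\<Sum>l\<in>UNIV. LINT x|half_line. cnj (h j x) * kernel_bound.op (star_kernel a b j l) (f l) x)"
      by (intro Bochner_Integration.integral_sum integrable_mult_L2_half_line cnj_L2_half_line L2_D[OF h]
          kernel_bound.op_L2(1)[OF kernel_bound L2_D[OF f]])
    also have "\<dots> = (\<Sum>l\<in>UNIV. LINT p|(half_line \<Otimes>\<^sub>M half_line).
       cnj (h j (fst p)) * (of_real (star_kernel a b j l (fst p) (snd p)) * f l (snd p)))"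
      by (intro sum.cong refl kernel_bound.form_eq[OF kernel_bound] L2_D[OF f] cnj_L2_half_line[OF L2_D[OF h]])
    finally show ?thesis .
  qed
  then show ?thesis by (simp add: l2_inner_def star_form_def)
qed

lemma star_form_add_right:
  assumes "h \<in> L2" "f \<in> L2" "f' \<in> L2"
  shows "star_form a b h (\<lambda>j x. f j x + c * f' j x) = star_form a b h f + c * star_form a b h f'"
proof -
  have "(LINT p|(half_line \<Otimes>\<^sub>M half_line). cnj (h j (fst p)) *
        (of_real (star_kernel a b j l (fst p) (snd p)) * (f l (snd p) + c * f' l (snd p)))) =
     (LINT p|(half_line \<Otimes>\<^sub>M half_line). cnj (h j (fst p)) * (of_real (star_kernel a b j l (fst p) (snd p)) * f l (snd p))
      + c * (cnj (h j (fst p)) * (of_real (star_kernel a b j l (fst p) (snd p)) * f' l (snd p))))" for j l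
    by (simp add: algebra_simps)
  also have "\<dots> j l = (LINT p|(half_line \<Otimes>\<^sub>M half_line). cnj (h j (fst p)) * (of_real (star_kernel a b j l (fst p) (snd p)) * f l (snd p)))
      + c * (LINT p|(half_line \<Otimes>\<^sub>M half_line). cnj (h j (fst p)) * (of_real (star_kernel a b j l (fst p) (snd p)) * f' l (snd p)))" for j l
    using form_integrable assms by (subst Bochner_Integration.integral_add) auto
  finally show ?thesis
    by (simp add: star_form_def sum.distrib sum_distrib_left)
qed

text \<open>The kernel is real and invariant under exchanging (j, x) with (l, y). In particular the
  diagonal values \<open>star_form a b f f\<close> are real, and taking real parts loses nothing
  there.\<close>

lemma star_form_cnj:
  assumes "h \<in> L2" "f \<in> L2"
  shows "cnj (star_form a b h f) = star_form a b f h"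
proof -
  have "cnj (LINT p|(half_line \<Otimes>\<^sub>M half_line). cnj (h j (fst p)) * (of_real (star_kernel a b j l (fst p) (snd p)) * f l (snd p)))
     = (LINT p|(half_line \<Otimes>\<^sub>M half_line). cnj (f l (fst p)) * (of_real (star_kernel a b l j (fst p) (snd p)) * h j (snd p)))"
    for j l
  proof -
    let ?F = "\<lambda>p. cnj (f l (fst p)) * (of_real (star_kernel a b l j (fst p) (snd p)) * h j (snd p))"
    have "cnj (LINT p|(half_line \<Otimes>\<^sub>M half_line). cnj (h j (fst p)) * (of_real (star_kernel a b j l (fst p) (snd p)) * f l (snd p)))
      = (LINT p|(half_line \<Otimes>\<^sub>M half_line). cnj (cnj (h j (fst p)) * (of_real (star_kernel a b j l (fst p) (snd p)) * f l (snd p))))"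
      by (rule Bochner_Integration.integral_cnj[symmetric])
    also have "\<dots> = (LINT (x, y)|(half_line \<Otimes>\<^sub>M half_line). ?F (y, x))"
      by (intro Bochner_Integration.integral_cong refl)
        (auto simp: star_kernel_commute[of a b j l])
    also have "\<dots> = integral\<^sup>L (half_line \<Otimes>\<^sub>M half_line) ?F"
      using form_integrable[OF assms(2,1)] by (intro half_line2.integral_product_swap) auto
    finally show ?thesis .
  qed
  then have "cnj (star_form a b h f) = (\<Sum>j\<in>UNIV. \<Sum>l\<in>UNIV.
     LINT p|(half_line \<Otimes>\<^sub>M half_line). cnj (f l (fst p)) * (of_real (star_kernel a b l j (fst p) (snd p)) * h j (snd p)))"
    by (simp add: star_form_def)
  also have "\<dots> = star_form a b f h"
    unfolding star_form_def by (rule sum.swap)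
  finally show ?thesis .
qed

end

section \<open>Exponential and Poisson kernels on the graph\<close>

text \<open>Each of the two parts is at most exp (- \<kappa> r) / \<kappa>; for the vertex part this
  uses N \<kappa> + \<alpha> \<ge> \<kappa>.\<close>

lemma resolvent_bound:
  assumes "\<kappa> > 0" "\<alpha> > 0" "N \<ge> 1"
  shows "star_kernel_bound (resolvent_a \<kappa>) (resolvent_b N \<alpha> \<kappa>) (\<lambda>r. 2 / \<kappa> * exp (- \<kappa> * r))"
proof
  show "integrable half_line (\<lambda>r. 2 / \<kappa> * exp (- \<kappa> * r))"
    by (intro integrable_mult_right half_line_exp(1) assms)
  fix r s :: real assume rs: "0 \<le> r" "r \<le> s"
  have e: "exp (- \<kappa> * s) \<le> exp (- \<kappa> * r)" using assms rs by simp
  have "\<bar>resolvent_a \<kappa> r - resolvent_a \<kappa> s\<bar> = (exp (- \<kappa> * r) - exp (- \<kappa> * s)) / (2 * \<kappa>)"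
    using e assms by (simp add: resolvent_a_def diff_divide_distrib[symmetric])
  also have "\<dots> \<le> exp (- \<kappa> * r) / \<kappa>"
    using e assms by (intro frac_le) auto
  finally have 1: "\<bar>resolvent_a \<kappa> r - resolvent_a \<kappa> s\<bar> \<le> exp (- \<kappa> * r) / \<kappa>" .
  have "1 * \<kappa> \<le> N * \<kappa>" using assms by (intro mult_right_mono) auto
  then have n: "\<kappa> \<le> N * \<kappa> + \<alpha>" using assms by linarith
  have "\<bar>resolvent_b N \<alpha> \<kappa> s\<bar> = exp (- \<kappa> * s) / (N * \<kappa> + \<alpha>)"
    using n assms by (simp add: resolvent_b_def)
  also have "\<dots> \<le> exp (- \<kappa> * r) / \<kappa>"
    by (intro frac_le e n assms) simp
  finally have "\<bar>resolvent_b N \<alpha> \<kappa> s\<bar> \<le> exp (- \<kappa> * r) / \<kappa>" .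
  with 1 show "\<bar>resolvent_a \<kappa> r - resolvent_a \<kappa> s\<bar> + \<bar>resolvent_b N \<alpha> \<kappa> s\<bar> \<le> 2 / \<kappa> * exp (- \<kappa> * r)"
    by simp
qed (use assms in \<open>auto simp: resolvent_a_def[abs_def] resolvent_b_def[abs_def]\<close>)

lemma cylinder_measurable:
  assumes "t > 0" "\<alpha> > 0"
  shows "cylinder_a t \<in> borel_measurable borel" "cylinder_b N \<alpha> t \<in> borel_measurable borel"
  using isCont_cylinder_a isCont_cylinder_b assms
  by (auto intro!: borel_measurable_continuous_onI continuous_at_imp_continuous_on)

text \<open>Monotonicity of the Poisson kernel makes the bound independent of \<epsilon>, so one
  dominating kernel serves the whole limit \<epsilon> to 0; \<epsilon> = 0 is the cylinder kernel
  itself.\<close>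

lemma cylinder_bound:
  assumes "t > 0" "\<alpha> > 0" "N \<ge> 1" "\<epsilon> \<ge> 0"
  shows "star_kernel_bound (\<lambda>r. cylinder_a t (r + \<epsilon>)) (\<lambda>r. cylinder_b N \<alpha> t (r + \<epsilon>)) (\<lambda>r. 5 / pi * poisson t r)"
proof
  note [measurable] = cylinder_measurable[OF assms(1,2)]
  show "(\<lambda>r. cylinder_a t (r + \<epsilon>)) \<in> borel_measurable borel" by measurable
  show "(\<lambda>r. cylinder_b N \<alpha> t (r + \<epsilon>)) \<in> borel_measurable borel" by measurable
  show "(\<lambda>r. 5 / pi * poisson t r) \<in> borel_measurable borel" by measurable
  show "0 \<le> 5 / pi * poisson t r" for r using poisson_nonneg[OF assms(1)] by simp
  show "integrable half_line (\<lambda>r. 5 / pi * poisson t r)"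
    by (intro integrable_mult_right half_line_poisson(1) assms)
  fix r s :: real assume rs: "0 \<le> r" "r \<le> s"
  have P: "0 \<le> poisson t (s + \<epsilon>)" "poisson t (s + \<epsilon>) \<le> poisson t (r + \<epsilon>)" "poisson t (r + \<epsilon>) \<le> poisson t r"
    "poisson t (s + \<epsilon>) \<le> poisson t r"
    using assms rs by (auto intro!: poisson_nonneg poisson_mono)
  have "\<bar>cylinder_a t (r + \<epsilon>) - cylinder_a t (s + \<epsilon>)\<bar> = (poisson t (r + \<epsilon>) - poisson t (s + \<epsilon>)) / pi"
    using P by (simp add: cylinder_a_def diff_divide_distrib[symmetric])
  also have "\<dots> \<le> poisson t r / pi"
    using P by (intro divide_right_mono) auto
  finally have 1: "\<bar>cylinder_a t (r + \<epsilon>) - cylinder_a t (s + \<epsilon>)\<bar> \<le> poisson t r / pi" .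
  have T: "0 \<le> \<alpha> * poisson_tail N \<alpha> t (s + \<epsilon>)" "\<alpha> * poisson_tail N \<alpha> t (s + \<epsilon>) \<le> poisson t (s + \<epsilon>)"
    using poisson_tail_bounds[of t \<alpha> N "s + \<epsilon>"] assms rs by auto
  have "\<bar>cylinder_b N \<alpha> t (s + \<epsilon>)\<bar> = 2 / (N * pi) * \<bar>poisson t (s + \<epsilon>) - \<alpha> * poisson_tail N \<alpha> t (s + \<epsilon>)\<bar>"
    unfolding cylinder_b_def abs_mult using assms by simp
  also have "\<dots> \<le> 2 / pi * poisson t r"
    using assms P T by (intro mult_mono) (auto intro!: frac_le)
  finally have "\<bar>cylinder_b N \<alpha> t (s + \<epsilon>)\<bar> \<le> 2 / pi * poisson t r" .
  \<comment> \<open>The two parts amount to 3 / pi; the constant 5 / pi leaves room.\<close>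
  moreover have "poisson t r / pi + 2 / pi * poisson t r \<le> 5 / pi * poisson t r"
    using poisson_nonneg[OF assms(1), of r] by (simp add: divide_simps)
  ultimately show "\<bar>cylinder_a t (r + \<epsilon>) - cylinder_a t (s + \<epsilon>)\<bar> + \<bar>cylinder_b N \<alpha> t (s + \<epsilon>)\<bar>
      \<le> 5 / pi * poisson t r"
    using 1 by linarith
qed

lemma weight_star_kernel:
  assumes "t > 0" "\<epsilon> > 0" "\<alpha> > 0" "N \<ge> 1" "x > 0" "y > 0"
  shows "(LINT \<kappa>|half_line. weight t \<epsilon> \<kappa> * star_kernel (resolvent_a \<kappa>) (resolvent_b N \<alpha> \<kappa>) j l x y) =
    star_kernel (\<lambda>r. cylinder_a t (r + \<epsilon>)) (\<lambda>r. cylinder_b N \<alpha> t (r + \<epsilon>)) j l x y"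
proof -
  have xy: "0 \<le> \<bar>x - y\<bar>" "0 \<le> x + y" "N > 0" using assms by auto
  note A1 = weight_resolvent_a[OF assms(1,2) xy(1)] and A2 = weight_resolvent_a[OF assms(1,2) xy(2)]
    and B = weight_resolvent_b[OF assms(1,2) xy(2,3) assms(3)]
  show ?thesis
    using A1 A2 B by (simp add: star_kernel_def distrib_left right_diff_distrib)
qed

text \<open>Fubini in (\<kappa>, (x, y)): Schur's bound on the resolvent form is of size 2 /
  \<kappa>^2, the weight contributes \<kappa>^2 exp (- \<epsilon> \<kappa>), and the product is
  integrable. Pointwise in x and y the \<kappa>-integral is then
  \<open>weight_star_kernel\<close>.\<close>

lemma weight_star_form:
  fixes f :: "'n::finite wave"
  assumes t: "t > 0" and \<epsilon>: "\<epsilon> > 0" and \<alpha>: "\<alpha> > 0" and N: "N \<ge> 1" and f: "f \<in> L2"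
  shows "(LINT \<kappa>|half_line. of_real (weight t \<epsilon> \<kappa>) * star_form (resolvent_a \<kappa>) (resolvent_b N \<alpha> \<kappa>) f f) =
    star_form (\<lambda>r. cylinder_a t (r + \<epsilon>)) (\<lambda>r. cylinder_b N \<alpha> t (r + \<epsilon>)) f f"
    and "integrable half_line (\<lambda>\<kappa>. of_real (weight t \<epsilon> \<kappa>) * star_form (resolvent_a \<kappa>) (resolvent_b N \<alpha> \<kappa>) f f)"
proof -
  let ?P = "half_line \<Otimes>\<^sub>M half_line"
  interpret P: pair_sigma_finite half_line ?P
    by (intro pair_sigma_finite.intro sigma_finite_half_line half_line2.sigma_finite_measure_axioms)
  define K where "K j l \<kappa> = star_kernel (resolvent_a \<kappa>) (resolvent_b N \<alpha> \<kappa>) (j::'n) l" for j l \<kappa>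
  define F where "F j l q = of_real (weight t \<epsilon> (fst q)) * (cnj (f j (fst (snd q))) *
     (of_real (K j l (fst q) (fst (snd q)) (snd (snd q))) * f l (snd (snd q))))" for j l q
  define c where "c j l = (LINT x|half_line. (cmod (f j x))\<^sup>2) + (LINT x|half_line. (cmod (f l x))\<^sup>2)" for j l
  note R = resolvent_bound[OF _ \<alpha> N]
  have [measurable]: "f j \<in> borel_measurable half_line" for j
    using f by (auto simp: L2_def L2_half_line_def)
  have mF: "F j l \<in> borel_measurable (half_line \<Otimes>\<^sub>M ?P)" for j l
  proof -
    have id: "(\<lambda>q. (fst q, (fst (snd q), snd (snd q)))) \<in> measurable (half_line \<Otimes>\<^sub>M ?P) (borel \<Otimes>\<^sub>M (borel \<Otimes>\<^sub>M borel))"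
      by (intro measurable_Pair measurable_compose[OF _ measurable_ident_half_line]) measurable
    have "(\<lambda>q. weight t \<epsilon> (fst q) * K j l (fst q) (fst (snd q)) (snd (snd q))) \<in>
        borel_measurable (borel \<Otimes>\<^sub>M (borel \<Otimes>\<^sub>M borel))"
      unfolding K_def star_kernel_def resolvent_a_def resolvent_b_def by measurable
    from measurable_compose[OF id this]
    have [measurable]: "(\<lambda>q. weight t \<epsilon> (fst q) * K j l (fst q) (fst (snd q)) (snd (snd q))) \<in>
        borel_measurable (half_line \<Otimes>\<^sub>M ?P)" by simp
    have "F j l = (\<lambda>q. of_real (weight t \<epsilon> (fst q) * K j l (fst q) (fst (snd q)) (snd (snd q))) *
        (cnj (f j (fst (snd q))) * f l (snd (snd q))))"
      by (auto simp: F_def fun_eq_iff)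
    moreover have "\<dots> \<in> borel_measurable (half_line \<Otimes>\<^sub>M ?P)" by measurable
    ultimately show ?thesis by simp
  qed
  have iK: "integrable ?P (\<lambda>p. cnj (f j (fst p)) * (of_real (K j l \<kappa> (fst p) (snd p)) * f l (snd p)))"
    if "\<kappa> > 0" for j l \<kappa>
    using star_kernel_bound.form_integrable[OF R[OF that] f f, of j l] by (simp add: K_def)
  have norm_le: "(LINT p|?P. norm (F j l (\<kappa>, p))) \<le> 4 * t / pi * c j l * exp (- \<epsilon> * \<kappa>)" if \<kappa>: "\<kappa> > 0" for j l \<kappa>
  proof -
    interpret S: star_kernel_bound "resolvent_a \<kappa>" "resolvent_b N \<alpha> \<kappa>" "\<lambda>r. 2 / \<kappa> * exp (- \<kappa> * r)"
      by (rule R[OF \<kappa>])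
    have SK: "kernel_bound (\<lambda>r. 2 / \<kappa> * exp (- \<kappa> * r)) (K j l \<kappa>)"
      unfolding K_def by (rule S.kernel_bound)
    interpret SK: kernel_bound "\<lambda>r. 2 / \<kappa> * exp (- \<kappa> * r)" "K j l \<kappa>" by (rule SK)
    note C = SK.convolution_form[OF L2_D[OF f, of l] L2_D[OF f, of j]]
    have "(LINT p|?P. norm (F j l (\<kappa>, p))) \<le> (LINT p|?P. \<bar>weight t \<epsilon> \<kappa>\<bar> *
        (2 / \<kappa> * exp (- \<kappa> * \<bar>fst p - snd p\<bar>) * (cmod (f j (fst p)) * cmod (f l (snd p)))))"
    proof (rule integral_mono_AE)
      show "integrable ?P (\<lambda>p. norm (F j l (\<kappa>, p)))"
        using iK[OF \<kappa>, of j l] unfolding F_def fst_conv snd_conv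
        by (intro integrable_norm integrable_mult_right)
      show "integrable ?P (\<lambda>p. \<bar>weight t \<epsilon> \<kappa>\<bar> *
          (2 / \<kappa> * exp (- \<kappa> * \<bar>fst p - snd p\<bar>) * (cmod (f j (fst p)) * cmod (f l (snd p)))))"
        using C(1) by (rule integrable_mult_right)
      show "AE p in ?P. norm (F j l (\<kappa>, p)) \<le> \<bar>weight t \<epsilon> \<kappa>\<bar> *
          (2 / \<kappa> * exp (- \<kappa> * \<bar>fst p - snd p\<bar>) * (cmod (f j (fst p)) * cmod (f l (snd p))))"
      proof (rule SK.AE_space_pair)
        fix x y :: real assume "x > 0" "y > 0"
        from SK.k_bound[OF this] have "\<bar>K j l \<kappa> x y\<bar> * (cmod (f j x) * cmod (f l y)) \<le>
            2 / \<kappa> * exp (- \<kappa> * \<bar>x - y\<bar>) * (cmod (f j x) * cmod (f l y))"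
          by (intro mult_right_mono) auto
        then have "\<bar>weight t \<epsilon> \<kappa>\<bar> * (\<bar>K j l \<kappa> x y\<bar> * (cmod (f j x) * cmod (f l y))) \<le>
            \<bar>weight t \<epsilon> \<kappa>\<bar> * (2 / \<kappa> * exp (- \<kappa> * \<bar>x - y\<bar>) * (cmod (f j x) * cmod (f l y)))"
          by (rule mult_left_mono) simp
        then show "norm (F j l (\<kappa>, (x, y))) \<le> \<bar>weight t \<epsilon> \<kappa>\<bar> *
          (2 / \<kappa> * exp (- \<kappa> * \<bar>fst (x, y) - snd (x, y)\<bar>) * (cmod (f j (fst (x, y))) * cmod (f l (snd (x, y)))))"
          by (simp add: F_def norm_mult ac_simps)
      qed
    qed
    also have "\<dots> = \<bar>weight t \<epsilon> \<kappa>\<bar> * (LINT p|?P.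
        2 / \<kappa> * exp (- \<kappa> * \<bar>fst p - snd p\<bar>) * (cmod (f j (fst p)) * cmod (f l (snd p))))"
      by (rule integral_mult_right_zero)
    also have "\<dots> \<le> (2 / pi * t * (\<kappa>\<^sup>2 * exp (- \<epsilon> * \<kappa>))) * ((2 / \<kappa> * (1 / \<kappa>)) * c j l)"
    proof (intro mult_mono abs_weight_le t \<kappa>)
      have "SK.G = 2 / \<kappa> * (1 / \<kappa>)" unfolding integral_mult_right_zero half_line_exp(2)[OF \<kappa>] ..
      with C(2) show "(LINT p|?P. 2 / \<kappa> * exp (- \<kappa> * \<bar>fst p - snd p\<bar>) * (cmod (f j (fst p)) * cmod (f l (snd p))))
        \<le> 2 / \<kappa> * (1 / \<kappa>) * c j l"
        by (simp only: c_def)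
      show "0 \<le> (LINT p|?P. 2 / \<kappa> * exp (- \<kappa> * \<bar>fst p - snd p\<bar>) * (cmod (f j (fst p)) * cmod (f l (snd p))))"
        using \<kappa> by (intro integral_nonneg_AE AE_I2) simp
    qed (use t in auto)
    also have "\<dots> = 4 * t / pi * c j l * exp (- \<epsilon> * \<kappa>)"
      using \<kappa> by (simp add: power2_eq_square)
    finally show ?thesis .
  qed
  have iF: "integrable (half_line \<Otimes>\<^sub>M ?P) (F j l)" for j l
  proof (rule P.Fubini_integrable[OF mF])
    show "AE \<kappa> in half_line. integrable ?P (\<lambda>p. F j l (\<kappa>, p))"
      using iK unfolding F_def fst_conv snd_conv
      by (intro AE_half_line_if_positive integrable_mult_right)
    show "integrable half_line (\<lambda>\<kappa>. LINT p|?P. norm (F j l (\<kappa>, p)))"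
    proof (rule half_line_integrable_bound[OF integrable_mult_right[OF half_line_exp(1)[OF \<epsilon>], of "4 * t / pi * c j l"]])
      have "(\<lambda>q. norm (F j l q)) \<in> borel_measurable (half_line \<Otimes>\<^sub>M ?P)" using mF by measurable
      then have "case_prod (\<lambda>\<kappa> p. norm (F j l (\<kappa>, p))) \<in> borel_measurable (half_line \<Otimes>\<^sub>M ?P)"
        by (simp add: case_prod_beta')
      then show "(\<lambda>\<kappa>. LINT p|?P. norm (F j l (\<kappa>, p))) \<in> borel_measurable half_line"
        by (rule half_line2.P.borel_measurable_lebesgue_integral)
    qed (use norm_le in simp)
  qed
  have sf: "of_real (weight t \<epsilon> \<kappa>) * star_form (resolvent_a \<kappa>) (resolvent_b N \<alpha> \<kappa>) f f =
     (\<Sum>j\<in>UNIV. \<Sum>l\<in>UNIV. LINT p|?P. F j l (\<kappa>, p))" for \<kappa>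
    by (simp add: star_form_def F_def K_def sum_distrib_left)
  have iF1: "integrable half_line (\<lambda>\<kappa>. LINT p|?P. F j l (\<kappa>, p))" for j l
    by (rule P.integrable_fst'[OF iF])
  show "integrable half_line (\<lambda>\<kappa>. of_real (weight t \<epsilon> \<kappa>) * star_form (resolvent_a \<kappa>) (resolvent_b N \<alpha> \<kappa>) f f)"
    unfolding sf by (intro Bochner_Integration.integrable_sum iF1)
  have in2: "(LINT \<kappa>|half_line. F j l (\<kappa>, p)) = cnj (f j (fst p)) *
      (of_real (star_kernel (\<lambda>r. cylinder_a t (r + \<epsilon>)) (\<lambda>r. cylinder_b N \<alpha> t (r + \<epsilon>)) j l (fst p) (snd p)) * f l (snd p))"
    if "p \<in> space ?P" for j l p
  proof -
    have xy: "fst p > 0" "snd p > 0" using that by (auto simp: space_pair_measure)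
    have "(LINT \<kappa>|half_line. F j l (\<kappa>, p)) = (LINT \<kappa>|half_line. cnj (f j (fst p)) * f l (snd p) *
        of_real (weight t \<epsilon> \<kappa> * K j l \<kappa> (fst p) (snd p)))"
      by (intro Bochner_Integration.integral_cong refl) (simp add: F_def)
    also have "\<dots> = cnj (f j (fst p)) * f l (snd p) * of_real (LINT \<kappa>|half_line. weight t \<epsilon> \<kappa> * K j l \<kappa> (fst p) (snd p))"
      unfolding integral_mult_right_zero integral_complex_of_real ..
    also have "(LINT \<kappa>|half_line. weight t \<epsilon> \<kappa> * K j l \<kappa> (fst p) (snd p)) =
        star_kernel (\<lambda>r. cylinder_a t (r + \<epsilon>)) (\<lambda>r. cylinder_b N \<alpha> t (r + \<epsilon>)) j l (fst p) (snd p)"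
      unfolding K_def by (rule weight_star_kernel[OF t \<epsilon> \<alpha> N xy])
    finally show ?thesis by simp
  qed
  have "(LINT \<kappa>|half_line. of_real (weight t \<epsilon> \<kappa>) * star_form (resolvent_a \<kappa>) (resolvent_b N \<alpha> \<kappa>) f f)
     = (\<Sum>j\<in>UNIV. \<Sum>l\<in>UNIV. LINT \<kappa>|half_line. LINT p|?P. F j l (\<kappa>, p))"
    unfolding sf by (simp add: iF1)
  also have "\<dots> = (\<Sum>j\<in>UNIV. \<Sum>l\<in>UNIV. LINT p|?P. LINT \<kappa>|half_line. F j l (\<kappa>, p))"
    using P.Fubini_integral[of "\<lambda>\<kappa> p. F j l (\<kappa>, p)" for j l] iF by (simp add: case_prod_beta')
  also have "\<dots> = star_form (\<lambda>r. cylinder_a t (r + \<epsilon>)) (\<lambda>r. cylinder_b N \<alpha> t (r + \<epsilon>)) f f"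
    unfolding star_form_def by (intro sum.cong refl Bochner_Integration.integral_cong in2)
  finally show "(LINT \<kappa>|half_line. of_real (weight t \<epsilon> \<kappa>) * star_form (resolvent_a \<kappa>) (resolvent_b N \<alpha> \<kappa>) f f) =
    star_form (\<lambda>r. cylinder_a t (r + \<epsilon>)) (\<lambda>r. cylinder_b N \<alpha> t (r + \<epsilon>)) f f" .
qed

text \<open>The kernels are continuous in the shift and share the Poisson majorant of
  \<open>cylinder_bound\<close>, whose form is integrable by Schur's test.\<close>

lemma star_form_tendsto:
  fixes f :: "'n::finite wave"
  assumes t: "t > 0" and \<alpha>: "\<alpha> > 0" and N: "N \<ge> 1" and f: "f \<in> L2"
  shows "(\<lambda>n. star_form (\<lambda>r. cylinder_a t (r + 1 / Suc n)) (\<lambda>r. cylinder_b N \<alpha> t (r + 1 / Suc n)) f f)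
    \<longlonglongrightarrow> star_form (cylinder_a t) (cylinder_b N \<alpha> t) f f"
  unfolding star_form_def
proof (intro tendsto_sum)
  fix j l :: 'n
  let ?P = "half_line \<Otimes>\<^sub>M half_line"
  let ?K = "\<lambda>\<epsilon>::real. star_kernel (\<lambda>r. cylinder_a t (r + \<epsilon>)) (\<lambda>r. cylinder_b N \<alpha> t (r + \<epsilon>)) j l"
  let ?F = "\<lambda>\<epsilon> p. cnj (f j (fst p)) * (of_real (?K \<epsilon> (fst p) (snd p)) * f l (snd p))"
  let ?Z = "star_kernel (cylinder_a t) (cylinder_b N \<alpha> t) j l"
  let ?Y = "\<lambda>p. cnj (f j (fst p)) * (of_real (?Z (fst p) (snd p)) * f l (snd p))"
  note B = cylinder_bound[OF t \<alpha> N]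
  have B0: "star_kernel_bound (cylinder_a t) (cylinder_b N \<alpha> t) (\<lambda>r. 5 / pi * poisson t r)"
    using B[of 0] by simp
  interpret K: kernel_bound "\<lambda>r. 5 / pi * poisson t r" ?Z
    by (rule star_kernel_bound.kernel_bound[OF B0])
  show "(\<lambda>n. integral\<^sup>L ?P (?F (1 / real (Suc n)))) \<longlonglongrightarrow> integral\<^sup>L ?P ?Y"
  proof (rule integral_dominated_convergence[OF _ _ K.convolution_form(1)[OF L2_D[OF f, of l] L2_D[OF f, of j]]])
    show "?F (1 / real (Suc n)) \<in> borel_measurable ?P" for n
      using star_kernel_bound.form_integrable[OF B[of "1 / real (Suc n)"] f f] by auto
    show "?Y \<in> borel_measurable ?P"
      using star_kernel_bound.form_integrable[OF B0 f f] by auto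
    show "AE p in ?P. (\<lambda>n. ?F (1 / real (Suc n)) p) \<longlonglongrightarrow> ?Y p"
    proof (rule AE_I2)
      fix p
      have s: "(\<lambda>n. r + 1 / real (Suc n)) \<longlonglongrightarrow> r" for r :: real
        using tendsto_add[OF tendsto_const LIMSEQ_inverse_real_of_nat, of r] by (simp add: inverse_eq_divide)
      have "(\<lambda>n. ?K (1 / real (Suc n)) (fst p) (snd p)) \<longlonglongrightarrow> ?Z (fst p) (snd p)"
        unfolding star_kernel_def
        by (cases "j = l")
          (auto intro!: tendsto_intros isCont_tendsto_compose[OF isCont_cylinder_a[OF t] s]
            isCont_tendsto_compose[OF isCont_cylinder_b[OF t \<alpha>] s] simp del: of_nat_Suc)
      then show "(\<lambda>n. ?F (1 / real (Suc n)) p) \<longlonglongrightarrow> ?Y p"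
        by (intro tendsto_intros)
    qed
    show "AE p in ?P. norm (?F (1 / real (Suc n)) p) \<le>
      5 / pi * poisson t \<bar>fst p - snd p\<bar> * (cmod (f j (fst p)) * cmod (f l (snd p)))" for n
    proof (rule K.AE_space_pair)
      fix x y :: real assume "x > 0" "y > 0"
      from star_kernel_bound.star_kernel_le[OF B[of "1 / real (Suc n)"] this, of j l]
      have "\<bar>?K (1 / real (Suc n)) x y\<bar> * (cmod (f j x) * cmod (f l y)) \<le>
          5 / pi * poisson t \<bar>x - y\<bar> * (cmod (f j x) * cmod (f l y))"
        by (intro mult_right_mono) auto
      then show "norm (?F (1 / real (Suc n)) (x, y)) \<le>
        5 / pi * poisson t \<bar>fst (x, y) - snd (x, y)\<bar> * (cmod (f j (fst (x, y))) * cmod (f l (snd (x, y))))"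
        by (simp add: norm_mult ac_simps)
    qed
  qed
qed

section \<open>The resolvent of the Hamiltonian\<close>

lemma test_function_continuous: "test_function p p' \<Longrightarrow> continuous_on UNIV p" "test_function p p' \<Longrightarrow> continuous_on UNIV p'"
  unfolding test_function_def by (auto intro!: DERIV_continuous_on)

lemma test_function_support:
  assumes "test_function p p'"
  obtains a b where "0 < a" "a \<le> b" "\<And>x. x \<notin> {a..b} \<Longrightarrow> p x = 0" "\<And>x. x \<notin> {a..b} \<Longrightarrow> p' x = 0"
proof -
  obtain a b0 where a: "0 < a" and p0: "\<And>x. x \<notin> {a..b0} \<Longrightarrow> p x = 0"
    and D: "\<And>x. (p has_real_derivative p' x) (at x)"
    using assms by (auto simp: test_function_def)
  \<comment> \<open>The given b0 may lie below a; enlarging it yields a nonempty interval that still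
    contains the support.\<close>
  define b where "b = max a b0"
  have p: "p x = 0" if "x \<notin> {a..b}" for x
  proof -
    have "x \<notin> {a..b0}" using that by (auto simp: b_def)
    then show ?thesis by (rule p0)
  qed
  have "p' x = 0" if x: "x \<notin> {a..b}" for x
  proof -
    have "open (- {a..b})" by auto
    then have "\<forall>\<^sub>F z in nhds x. z \<in> - {a..b}" using x by (intro eventually_nhds_in_open) auto
    then have "\<forall>\<^sub>F z in nhds x. p z = 0" by eventually_elim (use p in auto)
    then have "(p has_real_derivative 0) (at x)"
      by (subst DERIV_cong_ev[OF refl _ refl, where g="\<lambda>_. 0"]) auto
    then show ?thesis using D DERIV_unique by blast
  qed
  then show ?thesis using that[of a b] a p by (auto simp: b_def)
qed

lemma compactly_supported_L2_half_line:
  fixes p :: "real \<Rightarrow> real"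
  assumes "continuous_on UNIV p" "\<And>x. x \<notin> {a..b} \<Longrightarrow> p x = 0"
  shows "(\<lambda>x. complex_of_real (p x)) \<in> L2_half_line"
proof (rule L2_half_lineI)
  have [measurable]: "p \<in> borel_measurable borel"
    using assms(1) by (rule borel_measurable_continuous_onI)
  show "(\<lambda>x. complex_of_real (p x)) \<in> borel_measurable half_line"
    by (rule half_line_measurable) measurable
  have "set_integrable lborel {a..b} (\<lambda>x. (p x)\<^sup>2)"
    by (intro borel_integrable_atLeastAtMost' continuous_intros continuous_on_subset[OF assms(1)]) auto
  moreover have "(\<lambda>x. indicator {a..b} x *\<^sub>R (p x)\<^sup>2) = (\<lambda>x. (p x)\<^sup>2)"
    using assms(2) by (auto simp: indicator_def fun_eq_iff)
  ultimately have "integrable lborel (\<lambda>x. (p x)\<^sup>2)" by (simp add: set_integrable_def)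
  then have "integrable lborel (\<lambda>x. indicator {0<..} x *\<^sub>R (p x)\<^sup>2)"
    by (intro integrable_mult_indicator) auto
  then show "integrable half_line (\<lambda>x. (cmod (complex_of_real (p x)))\<^sup>2)"
    by (simp add: integrable_restrict_space)
qed

lemma test_function_L2_half_line:
  assumes "test_function p p'"
  shows "(\<lambda>x. complex_of_real (p x)) \<in> L2_half_line" "(\<lambda>x. complex_of_real (p' x)) \<in> L2_half_line"
  using test_function_support[OF assms] test_function_continuous[OF assms]
  by (metis compactly_supported_L2_half_line)+

lemma L2_half_line_locally_integrable:
  assumes "u \<in> L2_half_line"
  shows "locally_integrable u"
  unfolding locally_integrable_def
proof (intro allI impI)
  fix a b :: real assume a: "0 < a"
  have "(\<lambda>x. of_real (indicator {a..b} x)) \<in> L2_half_line"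
  proof (rule L2_half_lineI)
    have "integrable lborel (indicator {a..b} :: real \<Rightarrow> real)"
      by (intro integrable_real_indicator) (auto simp: emeasure_lborel_Icc_eq)
    then have "integrable lborel (\<lambda>x. indicator {0<..} x *\<^sub>R (indicator {a..b} x :: real))"
      by (intro integrable_mult_indicator) auto
    moreover have "(\<lambda>x. (cmod (of_real (indicator {a..b} x)))\<^sup>2) = (indicator {a..b} :: real \<Rightarrow> real)"
      by (auto simp: indicator_def)
    ultimately show "integrable half_line (\<lambda>x. (cmod (of_real (indicator {a..b} x)))\<^sup>2)"
      by (simp add: integrable_restrict_space)
  qed (rule half_line_measurable, measurable)
  from integrable_mult_L2_half_line[OF this assms]
  have "integrable lborel (\<lambda>x. indicator {0<..} x *\<^sub>R (of_real (indicator {a..b} x) * u x))"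
    by (simp add: integrable_restrict_space)
  moreover have "(\<lambda>x. indicator {0<..} x *\<^sub>R (of_real (indicator {a..b} x) * u x)) = (\<lambda>x. indicator {a..b} x *\<^sub>R u x)"
    using a by (auto simp: indicator_def fun_eq_iff)
  ultimately show "set_integrable lborel {a..b} u" by (simp add: set_integrable_def)
qed

lemma weak_derivative_add_scale:
  assumes "weak_derivative u u'" "weak_derivative v v'"
    "u \<in> L2_half_line" "u' \<in> L2_half_line" "v \<in> L2_half_line" "v' \<in> L2_half_line"
  shows "weak_derivative (\<lambda>x. u x + c * v x) (\<lambda>x. u' x + c * v' x)"
  unfolding weak_derivative_def
proof (intro conjI allI impI)
  show "locally_integrable (\<lambda>x. u x + c * v x)" "locally_integrable (\<lambda>x. u' x + c * v' x)"
    using assms by (auto intro!: L2_half_line_locally_integrable add_L2_half_line scale_L2_half_line)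
  fix p p' assume t: "test_function p p'"
  note T = test_function_L2_half_line[OF t]
  note I = integrable_mult_L2_half_line
  have 1: "(LINT x|half_line. (u x + c * v x) * of_real (p' x)) =
    (LINT x|half_line. u x * of_real (p' x)) + c * (LINT x|half_line. v x * of_real (p' x))"
    using I[OF assms(3) T(2)] I[OF assms(5) T(2)]
    by (simp add: distrib_right mult.assoc)
  have 2: "(LINT x|half_line. (u' x + c * v' x) * of_real (p x)) =
    (LINT x|half_line. u' x * of_real (p x)) + c * (LINT x|half_line. v' x * of_real (p x))"
    using I[OF assms(4) T(1)] I[OF assms(6) T(1)]
    by (simp add: distrib_right mult.assoc)
  show "(LINT x|half_line. (u x + c * v x) * of_real (p' x)) = - (LINT x|half_line. (u' x + c * v' x) * of_real (p x))"
    unfolding 1 2 using assms(1,2) t by (simp add: weak_derivative_def)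
qed

text \<open>Integrating by parts on both sides of the break point y leaves only the jump F y - G y,
  because the test function vanishes at 0 and far out. The jump term is the source from which a
  Green function acts as a delta function.\<close>

lemma test_function_by_parts:
  fixes F G F' G' :: "real \<Rightarrow> real"
  assumes t: "test_function p p'" and y: "y > 0"
    and F: "\<And>x. (F has_real_derivative F' x) (at x)" "continuous_on UNIV F'"
    and G: "\<And>x. (G has_real_derivative G' x) (at x)" "continuous_on UNIV G'"
  shows "(LINT x|half_line. (if x < y then F x else G x) * p' x) =
    (F y - G y) * p y - (LINT x|half_line. (if x < y then F' x else G' x) * p x)"
proof -
  obtain a b where ab: "0 < a" "a \<le> b" "\<And>x. x \<notin> {a..b} \<Longrightarrow> p x = 0" "\<And>x. x \<notin> {a..b} \<Longrightarrow> p' x = 0"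
    using test_function_support[OF t] by blast
  \<comment> \<open>The right end must lie beyond the break point and beyond the support, so that p
    Y = 0 removes the outer boundary term.\<close>
  define Y where "Y = max y b + 1"
  have Y: "y \<le> Y" "b < Y" by (auto simp: Y_def)
  have cont: "continuous_on UNIV F" "continuous_on UNIV G" "continuous_on UNIV p" "continuous_on UNIV p'"
    using F(1) G(1) test_function_continuous[OF t] by (auto intro!: DERIV_continuous_on)
  have isC: "isCont f x" if "continuous_on UNIV f" for f :: "real \<Rightarrow> real" and x
    using that by (simp add: continuous_on_eq_continuous_at)
  have split: "(LINT x|half_line. (if x < y then f x else g x) * q x) =
      (LINT x|lborel. (f x * q x) * indicator {0..y} x) + (LINT x|lborel. (g x * q x) * indicator {y..Y} x)"
    if fg: "continuous_on UNIV f" "continuous_on UNIV g" "continuous_on UNIV q" and q: "\<forall>x. x \<notin> {a..b} \<longrightarrow> q x = 0"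
    for f g q :: "real \<Rightarrow> real"
  proof -
    have [measurable]: "f \<in> borel_measurable borel" "g \<in> borel_measurable borel" "q \<in> borel_measurable borel"
      using fg by (auto intro: borel_measurable_continuous_onI)
    have "integrable lborel (\<lambda>x. indicator {c..d} x *\<^sub>R (h x * q x))" if "continuous_on UNIV h" for c d and h :: "real \<Rightarrow> real"
      unfolding set_integrable_def[symmetric]
      by (intro borel_integrable_atLeastAtMost' continuous_intros continuous_on_subset[OF that]
          continuous_on_subset[OF fg(3)]) auto
    then have i: "integrable lborel (\<lambda>x. (h x * q x) * indicator {c..d} x)" if "continuous_on UNIV h" for c d and h :: "real \<Rightarrow> real"
      using that by (simp add: mult.commute)
    have "(LINT x|half_line. (if x < y then f x else g x) * q x) =
        (LINT x|lborel. indicator {0<..} x *\<^sub>R ((if x < y then f x else g x) * q x))"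
      by (subst integral_restrict_space) auto
    also have "\<dots> = (LINT x|lborel. (f x * q x) * indicator {0..y} x + (g x * q x) * indicator {y..Y} x)"
    proof (rule integral_cong_AE)
      show "AE x in lborel. indicator {0<..} x *\<^sub>R ((if x < y then f x else g x) * q x) =
          (f x * q x) * indicator {0..y} x + (g x * q x) * indicator {y..Y} x"
        using AE_lborel_singleton[of 0] AE_lborel_singleton[of y]
      proof eventually_elim
        case (elim x)
        show ?case
        proof (cases "x \<in> {a..b}")
          case True
          then show ?thesis using elim ab y Y by (auto simp: indicator_def)
        next
          case False
          then show ?thesis using q by simp
        qed
      qed
    qed measurable
    also have "\<dots> = (LINT x|lborel. (f x * q x) * indicator {0..y} x) + (LINT x|lborel. (g x * q x) * indicator {y..Y} x)"
      by (intro Bochner_Integration.integral_add i fg)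
    finally show ?thesis .
  qed
  have D: "\<And>x. (p has_real_derivative p' x) (at x)" using t by (simp add: test_function_def)
  have p0: "p 0 = 0" "p Y = 0" using ab Y by auto
  have i1: "(LINT x|lborel. (F x * p' x) * indicator {0..y} x) =
      F y * p y - F 0 * p 0 - (LINT x|lborel. (F' x * p x) * indicator {0..y} x)"
    using y by (intro integral_by_parts F(1) D isC F(2) test_function_continuous(2)[OF t]) auto
  have i2: "(LINT x|lborel. (G x * p' x) * indicator {y..Y} x) =
      G Y * p Y - G y * p y - (LINT x|lborel. (G' x * p x) * indicator {y..Y} x)"
    using Y by (intro integral_by_parts G(1) D isC G(2) test_function_continuous(2)[OF t]) auto
  have sup: "\<forall>x. x \<notin> {a..b} \<longrightarrow> p' x = 0" "\<forall>x. x \<notin> {a..b} \<longrightarrow> p x = 0"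
    using ab by auto
  show ?thesis
    using split[OF cont(1,2,4) sup(1)] split[OF F(2) G(2) cont(3) sup(2)] i1 i2
    unfolding p0 by (simp only: left_diff_distrib)
qed

section \<open>The Dirichlet Green function on one edge\<close>

text \<open>The same as \<open>resolvent_a\<close> at |x - y| minus \<open>resolvent_a\<close> at x
  + y, but with explicit branches: each branch is smooth on the whole line, as
  \<open>test_function_by_parts\<close> requires. \<open>dirichlet_kernel'\<close> is its derivative
  in x.\<close>

definition dirichlet_kernel :: "real \<Rightarrow> real \<Rightarrow> real \<Rightarrow> real" where
  "dirichlet_kernel \<kappa> x y = (if x < y then (exp (- \<kappa> * (y - x)) - exp (- \<kappa> * (x + y))) / (2 * \<kappa>)
     else (exp (- \<kappa> * (x - y)) - exp (- \<kappa> * (x + y))) / (2 * \<kappa>))"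

definition dirichlet_kernel' :: "real \<Rightarrow> real \<Rightarrow> real \<Rightarrow> real" where
  "dirichlet_kernel' \<kappa> x y = (if x < y then (exp (- \<kappa> * (y - x)) + exp (- \<kappa> * (x + y))) / 2
     else (exp (- \<kappa> * (x + y)) - exp (- \<kappa> * (x - y))) / 2)"

text \<open>The kernel is continuous across x = y, so the first identity has no jump term. Its
  derivative drops by 1 there, which produces p y, and both branches satisfy F'' = \<kappa>^2
  F.\<close>

lemma dirichlet_kernel_by_parts:
  assumes "test_function p p'" "y > 0" "\<kappa> > 0"
  shows "(LINT x|half_line. dirichlet_kernel \<kappa> x y * p' x) = - (LINT x|half_line. dirichlet_kernel' \<kappa> x y * p x)"
    and "(LINT x|half_line. dirichlet_kernel' \<kappa> x y * p' x) = p y - \<kappa>\<^sup>2 * (LINT x|half_line. dirichlet_kernel \<kappa> x y * p x)"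
proof -
  let ?F = "\<lambda>x. (exp (- \<kappa> * (y - x)) - exp (- \<kappa> * (x + y))) / (2 * \<kappa>)"
  let ?G = "\<lambda>x. (exp (- \<kappa> * (x - y)) - exp (- \<kappa> * (x + y))) / (2 * \<kappa>)"
  let ?F' = "\<lambda>x. (exp (- \<kappa> * (y - x)) + exp (- \<kappa> * (x + y))) / 2"
  let ?G' = "\<lambda>x. (exp (- \<kappa> * (x + y)) - exp (- \<kappa> * (x - y))) / 2"
  have D: "(?F has_real_derivative ?F' x) (at x)" "(?G has_real_derivative ?G' x) (at x)"
    "(?F' has_real_derivative \<kappa>\<^sup>2 * ?F x) (at x)" "(?G' has_real_derivative \<kappa>\<^sup>2 * ?G x) (at x)" for x
    using assms(3) by (auto intro!: derivative_eq_intros simp: field_simps power2_eq_square)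
  have C: "continuous_on UNIV ?F'" "continuous_on UNIV ?G'" "continuous_on UNIV (\<lambda>x. \<kappa>\<^sup>2 * ?F x)"
    "continuous_on UNIV (\<lambda>x. \<kappa>\<^sup>2 * ?G x)"
    using assms(3) by (auto intro!: continuous_intros)
  show "(LINT x|half_line. dirichlet_kernel \<kappa> x y * p' x) = - (LINT x|half_line. dirichlet_kernel' \<kappa> x y * p x)"
    using test_function_by_parts[OF assms(1,2) D(1) C(1) D(2) C(2)]
    by (simp add: dirichlet_kernel_def dirichlet_kernel'_def)
  have "(LINT x|half_line. (if x < y then \<kappa>\<^sup>2 * ?F x else \<kappa>\<^sup>2 * ?G x) * p x) =
     (LINT x|half_line. \<kappa>\<^sup>2 * (dirichlet_kernel \<kappa> x y * p x))"
    by (intro Bochner_Integration.integral_cong refl) (simp add: dirichlet_kernel_def)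
  also have "\<dots> = \<kappa>\<^sup>2 * (LINT x|half_line. dirichlet_kernel \<kappa> x y * p x)"
    by (rule integral_mult_right_zero)
  finally have 2: "(LINT x|half_line. (if x < y then \<kappa>\<^sup>2 * ?F x else \<kappa>\<^sup>2 * ?G x) * p x) =
     \<kappa>\<^sup>2 * (LINT x|half_line. dirichlet_kernel \<kappa> x y * p x)" .
  have 1: "?F' y - ?G' y = 1" by (simp add: field_simps)
  show "(LINT x|half_line. dirichlet_kernel' \<kappa> x y * p' x) = p y - \<kappa>\<^sup>2 * (LINT x|half_line. dirichlet_kernel \<kappa> x y * p x)"
    using test_function_by_parts[OF assms(1,2) D(3) C(3) D(4) C(4)]
    unfolding 1 2 dirichlet_kernel'_def by simp
qed

lemma dirichlet_kernel_measurable: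
  "(\<lambda>p. dirichlet_kernel \<kappa> (fst p) (snd p)) \<in> borel_measurable (borel \<Otimes>\<^sub>M borel)"
  "(\<lambda>p. dirichlet_kernel' \<kappa> (fst p) (snd p)) \<in> borel_measurable (borel \<Otimes>\<^sub>M borel)"
  unfolding dirichlet_kernel_def dirichlet_kernel'_def by measurable

text \<open>The first two bounds hold for every real x, at the price of exp (\<kappa> |x|): the
  operators are evaluated at and around x = 0, where boundary values are read off. The last two are
  the convolution bounds for \<open>kernel_bound\<close>.\<close>

lemma dirichlet_kernel_le:
  assumes "\<kappa> > 0" "y > 0"
  shows "\<bar>dirichlet_kernel \<kappa> x y\<bar> \<le> 1 / \<kappa> * (exp (\<kappa> * \<bar>x\<bar>) * exp (- \<kappa> * y))"
    "\<bar>dirichlet_kernel' \<kappa> x y\<bar> \<le> exp (\<kappa> * \<bar>x\<bar>) * exp (- \<kappa> * y)"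
    "x > 0 \<Longrightarrow> \<bar>dirichlet_kernel \<kappa> x y\<bar> \<le> 1 / \<kappa> * exp (- \<kappa> * \<bar>x - y\<bar>)"
    "x > 0 \<Longrightarrow> \<bar>dirichlet_kernel' \<kappa> x y\<bar> \<le> exp (- \<kappa> * \<bar>x - y\<bar>)"
proof -
  have key: "\<bar>dirichlet_kernel \<kappa> x y\<bar> \<le> 1 / \<kappa> * e" "\<bar>dirichlet_kernel' \<kappa> x y\<bar> \<le> e"
    if "exp (- \<kappa> * \<bar>x - y\<bar>) \<le> e" "exp (- \<kappa> * (x + y)) \<le> e" for e
  proof -
    define s r where "s = exp (- \<kappa> * (x + y))" and "r = exp (- \<kappa> * \<bar>x - y\<bar>)"
    have rs: "0 \<le> r" "0 \<le> s" "r \<le> e" "s \<le> e" using that by (auto simp: r_def s_def)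
    have k: "dirichlet_kernel \<kappa> x y = (r - s) / (2 * \<kappa>)"
      by (auto simp: dirichlet_kernel_def r_def s_def)
    have k': "dirichlet_kernel' \<kappa> x y = (if x < y then (r + s) / 2 else (s - r) / 2)"
      by (auto simp: dirichlet_kernel'_def r_def s_def)
    have "\<bar>r - s\<bar> \<le> 2 * e" using rs by auto
    then show "\<bar>dirichlet_kernel \<kappa> x y\<bar> \<le> 1 / \<kappa> * e"
      unfolding k using assms by (simp add: field_simps)
    show "\<bar>dirichlet_kernel' \<kappa> x y\<bar> \<le> e"
      unfolding k' using rs by auto
  qed
  have a: "- \<kappa> * \<bar>x - y\<bar> \<le> \<kappa> * \<bar>x\<bar> + - \<kappa> * y" "- \<kappa> * (x + y) \<le> \<kappa> * \<bar>x\<bar> + - \<kappa> * y"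
  proof -
    have "\<kappa> * y \<le> \<kappa> * (\<bar>x\<bar> + \<bar>x - y\<bar>)" "\<kappa> * (- x) \<le> \<kappa> * \<bar>x\<bar>"
      by (intro mult_left_mono; use assms in linarith)+
    then show "- \<kappa> * \<bar>x - y\<bar> \<le> \<kappa> * \<bar>x\<bar> + - \<kappa> * y" "- \<kappa> * (x + y) \<le> \<kappa> * \<bar>x\<bar> + - \<kappa> * y"
      by (simp_all add: algebra_simps)
  qed
  then have e1: "exp (- \<kappa> * \<bar>x - y\<bar>) \<le> exp (\<kappa> * \<bar>x\<bar>) * exp (- \<kappa> * y)"
    "exp (- \<kappa> * (x + y)) \<le> exp (\<kappa> * \<bar>x\<bar>) * exp (- \<kappa> * y)"
    unfolding mult_exp_exp by simp_all
  show "\<bar>dirichlet_kernel \<kappa> x y\<bar> \<le> 1 / \<kappa> * (exp (\<kappa> * \<bar>x\<bar>) * exp (- \<kappa> * y))"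
    "\<bar>dirichlet_kernel' \<kappa> x y\<bar> \<le> exp (\<kappa> * \<bar>x\<bar>) * exp (- \<kappa> * y)"
    by (rule key[OF e1])+
  assume "x > 0"
  then have e2: "exp (- \<kappa> * (x + y)) \<le> exp (- \<kappa> * \<bar>x - y\<bar>)"
    using assms by auto
  show "\<bar>dirichlet_kernel \<kappa> x y\<bar> \<le> 1 / \<kappa> * exp (- \<kappa> * \<bar>x - y\<bar>)"
    "\<bar>dirichlet_kernel' \<kappa> x y\<bar> \<le> exp (- \<kappa> * \<bar>x - y\<bar>)"
    by (rule key[OF order_refl e2])+
qed

locale dirichlet =
  fixes \<kappa> :: real
  assumes \<kappa>: "\<kappa> > 0"
begin

lemma kernel_bound: "kernel_bound (\<lambda>r. 1 / \<kappa> * exp (- \<kappa> * r)) (dirichlet_kernel \<kappa>)"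
  by standard (use \<kappa> dirichlet_kernel_measurable dirichlet_kernel_le(3) half_line_exp(1)[OF \<kappa>] in auto)

lemma kernel_bound': "kernel_bound (\<lambda>r. exp (- \<kappa> * r)) (dirichlet_kernel' \<kappa>)"
  by standard (use \<kappa> dirichlet_kernel_measurable dirichlet_kernel_le(4) half_line_exp(1)[OF \<kappa>] in auto)

sublocale D: kernel_bound "\<lambda>r. 1 / \<kappa> * exp (- \<kappa> * r)" "dirichlet_kernel \<kappa>"
  by (rule kernel_bound)

sublocale D': kernel_bound "\<lambda>r. exp (- \<kappa> * r)" "dirichlet_kernel' \<kappa>"
  by (rule kernel_bound')

lemma exp_mult_integrable:
  assumes "v \<in> L2_half_line"
  shows "integrable half_line (\<lambda>y. of_real (exp (- \<kappa> * y)) * v y)"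
  by (intro integrable_mult_L2_half_line exp_L2_half_line \<kappa> assms)

lemma kernel_integrand_measurable:
  assumes v: "v \<in> L2_half_line"
  shows "(\<lambda>y. complex_of_real (dirichlet_kernel \<kappa> x y) * v y) \<in> borel_measurable half_line"
    "(\<lambda>y. complex_of_real (dirichlet_kernel' \<kappa> x y) * v y) \<in> borel_measurable half_line"
proof -
  have [measurable]: "v \<in> borel_measurable half_line" using v by (simp add: L2_half_line_def)
  have xy: "(\<lambda>y. (x, y)) \<in> measurable borel (borel \<Otimes>\<^sub>M borel)" by simp
  have [measurable]: "(\<lambda>y. dirichlet_kernel \<kappa> x y) \<in> borel_measurable half_line"
    "(\<lambda>y. dirichlet_kernel' \<kappa> x y) \<in> borel_measurable half_line"
    using measurable_compose[OF xy dirichlet_kernel_measurable(1)[of \<kappa>]]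
      measurable_compose[OF xy dirichlet_kernel_measurable(2)[of \<kappa>]]
    by (simp_all add: half_line_measurable)
  show "(\<lambda>y. complex_of_real (dirichlet_kernel \<kappa> x y) * v y) \<in> borel_measurable half_line"
    "(\<lambda>y. complex_of_real (dirichlet_kernel' \<kappa> x y) * v y) \<in> borel_measurable half_line"
    by measurable
qed

lemma kernel_integrable:
  assumes v: "v \<in> L2_half_line"
  shows "integrable half_line (\<lambda>y. of_real (dirichlet_kernel \<kappa> x y) * v y)"
proof (rule half_line_integrable_bound)
  show "integrable half_line (\<lambda>y. 1 / \<kappa> * exp (\<kappa> * \<bar>x\<bar>) * norm (of_real (exp (- \<kappa> * y)) * v y))"
    by (intro integrable_mult_right integrable_norm exp_mult_integrable v)
  fix y :: real assume "y > 0"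
  from mult_right_mono[OF dirichlet_kernel_le(1)[OF \<kappa> this, of x], of "cmod (v y)"]
  show "norm (of_real (dirichlet_kernel \<kappa> x y) * v y) \<le> 1 / \<kappa> * exp (\<kappa> * \<bar>x\<bar>) * norm (of_real (exp (- \<kappa> * y)) * v y)"
    by (simp add: norm_mult)
qed (rule kernel_integrand_measurable[OF v])

lemma isCont_op:
  assumes v: "v \<in> L2_half_line"
  shows "isCont (D.op v) x" "isCont (D'.op v) x"
proof -
  have x: "exp (\<kappa> * \<bar>z\<bar>) \<le> exp (\<kappa> * (\<bar>x\<bar> + 1))" if "\<bar>z - x\<bar> \<le> 1" for z
    using \<kappa> that by auto
  let ?g = "\<lambda>y. norm (of_real (exp (- \<kappa> * y)) * v y)"
  have g: "integrable half_line (\<lambda>y. c * ?g y)" for c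
    by (intro integrable_mult_right integrable_norm exp_mult_integrable v)
  \<comment> \<open>The derivative kernel jumps across y = x, so continuity in the parameter can
    fail only on this null set.\<close>
  have AE: "AE y in half_line. y \<noteq> x"
    using AE_lborel_singleton[of x] by (subst AE_restrict_space_iff) auto
  have c: "isCont (\<lambda>z. dirichlet_kernel \<kappa> z y) x \<and> isCont (\<lambda>z. dirichlet_kernel' \<kappa> z y) x" if "y \<noteq> x" for y
  proof -
    \<comment> \<open>Off the diagonal the case distinction is locally constant in x, so near x each
      kernel coincides with one of its smooth branches.\<close>
    have ev: "\<forall>\<^sub>F z in nhds x. (z < y) = (x < y)"
    proof (cases "x < y")
      case True
      then have "\<forall>\<^sub>F z in nhds x. z \<in> {..<y}" by (intro eventually_nhds_in_open) auto
      then show ?thesis by eventually_elim (use True in auto)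
    next
      case False
      then have "\<forall>\<^sub>F z in nhds x. z \<in> {y<..}" using that by (intro eventually_nhds_in_open) auto
      then show ?thesis by eventually_elim (use False in auto)
    qed
    have c1: "isCont (\<lambda>z. if x < y then (exp (- \<kappa> * (y - z)) - exp (- \<kappa> * (z + y))) / (2 * \<kappa>)
          else (exp (- \<kappa> * (z - y)) - exp (- \<kappa> * (z + y))) / (2 * \<kappa>)) x"
      using \<kappa> by (cases "x < y") (auto intro!: continuous_intros)
    have n1: "\<forall>\<^sub>F z in nhds x. dirichlet_kernel \<kappa> z y =
        (if x < y then (exp (- \<kappa> * (y - z)) - exp (- \<kappa> * (z + y))) / (2 * \<kappa>)
          else (exp (- \<kappa> * (z - y)) - exp (- \<kappa> * (z + y))) / (2 * \<kappa>))"
      using ev by eventually_elim (simp add: dirichlet_kernel_def)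
    have c2: "isCont (\<lambda>z. if x < y then (exp (- \<kappa> * (y - z)) + exp (- \<kappa> * (z + y))) / 2
          else (exp (- \<kappa> * (z + y)) - exp (- \<kappa> * (z - y))) / 2) x"
      by (cases "x < y") (auto intro!: continuous_intros)
    have n2: "\<forall>\<^sub>F z in nhds x. dirichlet_kernel' \<kappa> z y =
        (if x < y then (exp (- \<kappa> * (y - z)) + exp (- \<kappa> * (z + y))) / 2
          else (exp (- \<kappa> * (z + y)) - exp (- \<kappa> * (z - y))) / 2)"
      using ev by eventually_elim (simp add: dirichlet_kernel'_def)
    show ?thesis unfolding isCont_cong[OF n1] isCont_cong[OF n2] using c1 c2 ..
  qed
  show "isCont (D.op v) x"
    unfolding D.op_def[abs_def]
  proof (rule isCont_parameter_integral[OF kernel_integrand_measurable(1)[OF v] _ g])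
    show "AE y in half_line. isCont (\<lambda>k. of_real (dirichlet_kernel \<kappa> k y) * v y) x"
      using AE by eventually_elim (use c in \<open>auto intro!: continuous_intros\<close>)
    fix z assume z: "\<bar>z - x\<bar> \<le> 1"
    show "AE y in half_line. norm (of_real (dirichlet_kernel \<kappa> z y) * v y) \<le> 1 / \<kappa> * exp (\<kappa> * (\<bar>x\<bar> + 1)) * ?g y"
    proof (rule AE_half_line_if_positive)
      fix y :: real assume y: "y > 0"
      have "\<bar>dirichlet_kernel \<kappa> z y\<bar> \<le> 1 / \<kappa> * (exp (\<kappa> * (\<bar>x\<bar> + 1)) * exp (- \<kappa> * y))"
        using \<kappa> x[OF z] by (intro order.trans[OF dirichlet_kernel_le(1)[OF \<kappa> y]] mult_left_mono mult_right_mono) auto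
      from mult_right_mono[OF this, of "cmod (v y)"]
      show "norm (of_real (dirichlet_kernel \<kappa> z y) * v y) \<le> 1 / \<kappa> * exp (\<kappa> * (\<bar>x\<bar> + 1)) * ?g y"
        by (simp add: norm_mult)
    qed
  qed
  show "isCont (D'.op v) x"
    unfolding D'.op_def[abs_def]
  proof (rule isCont_parameter_integral[OF kernel_integrand_measurable(2)[OF v] _ g])
    show "AE y in half_line. isCont (\<lambda>k. of_real (dirichlet_kernel' \<kappa> k y) * v y) x"
      using AE by eventually_elim (use c in \<open>auto intro!: continuous_intros\<close>)
    fix z assume z: "\<bar>z - x\<bar> \<le> 1"
    show "AE y in half_line. norm (of_real (dirichlet_kernel' \<kappa> z y) * v y) \<le> exp (\<kappa> * (\<bar>x\<bar> + 1)) * ?g y"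
    proof (rule AE_half_line_if_positive)
      fix y :: real assume y: "y > 0"
      have "\<bar>dirichlet_kernel' \<kappa> z y\<bar> \<le> exp (\<kappa> * (\<bar>x\<bar> + 1)) * exp (- \<kappa> * y)"
        using \<kappa> x[OF z] by (intro order.trans[OF dirichlet_kernel_le(2)[OF \<kappa> y]] mult_right_mono) auto
      from mult_right_mono[OF this, of "cmod (v y)"]
      show "norm (of_real (dirichlet_kernel' \<kappa> z y) * v y) \<le> exp (\<kappa> * (\<bar>x\<bar> + 1)) * ?g y"
        by (simp add: norm_mult)
    qed
  qed
qed

text \<open>Fubini (\<open>op_swap\<close>) moves the kernel onto the test function; for each fixed
  y > 0 the identity is then an integration by parts in x. The jump term p y becomes the summand -
  v.\<close>

lemma weak_derivative_op:
  assumes v: "v \<in> L2_half_line"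
  shows "weak_derivative (D.op v) (D'.op v)"
    and "weak_derivative (D'.op v) (\<lambda>x. of_real (\<kappa>\<^sup>2) * D.op v x - v x)"
proof -
  note L = D.op_L2(1)[OF v] D'.op_L2(1)[OF v]
  show "weak_derivative (D.op v) (D'.op v)"
    unfolding weak_derivative_def
  proof (intro conjI allI impI L2_half_line_locally_integrable L)
    fix p p' assume t: "test_function p p'"
    note T = test_function_L2_half_line[OF t]
    have "(LINT x|half_line. D.op v x * of_real (p' x)) = (LINT y|half_line. - (v y * of_real (LINT x|half_line. dirichlet_kernel' \<kappa> x y * p x)))"
      unfolding D.op_swap(1)[OF v T(2)]
      by (intro Bochner_Integration.integral_cong refl) (simp add: dirichlet_kernel_by_parts(1)[OF t _ \<kappa>])
    then show "(LINT x|half_line. D.op v x * of_real (p' x)) = - (LINT x|half_line. D'.op v x * of_real (p x))"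
      unfolding D'.op_swap(1)[OF v T(1)] by simp
  qed
  show "weak_derivative (D'.op v) (\<lambda>x. of_real (\<kappa>\<^sup>2) * D.op v x - v x)"
    unfolding weak_derivative_def
  proof (intro conjI allI impI L2_half_line_locally_integrable L diff_L2_half_line scale_L2_half_line v)
    fix p p' assume t: "test_function p p'"
    note T = test_function_L2_half_line[OF t]
    note I = integrable_mult_L2_half_line
    let ?P = "\<lambda>y. v y * of_real (LINT x|half_line. dirichlet_kernel \<kappa> x y * p x)"
    have "(LINT x|half_line. D'.op v x * of_real (p' x)) = (LINT y|half_line. v y * of_real (p y) - of_real (\<kappa>\<^sup>2) * ?P y)"
      unfolding D'.op_swap(1)[OF v T(2)]
      by (intro Bochner_Integration.integral_cong refl)
        (simp add: dirichlet_kernel_by_parts(2)[OF t _ \<kappa>] right_diff_distrib)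
    also have "\<dots> = (LINT y|half_line. v y * of_real (p y)) - of_real (\<kappa>\<^sup>2) * (LINT y|half_line. ?P y)"
      using I[OF v T(1)] D.op_swap(2)[OF v T(1)] by simp
    also have "\<dots> = (LINT y|half_line. v y * of_real (p y)) - of_real (\<kappa>\<^sup>2) * (LINT x|half_line. D.op v x * of_real (p x))"
      unfolding D.op_swap(1)[OF v T(1)] ..
    also have "\<dots> = - (LINT x|half_line. (of_real (\<kappa>\<^sup>2) * D.op v x - v x) * of_real (p x))"
      using I[OF v T(1)] I[OF L(1) T(1)] by (simp add: left_diff_distrib mult.assoc)
    finally show "(LINT x|half_line. D'.op v x * of_real (p' x)) =
        - (LINT x|half_line. (of_real (\<kappa>\<^sup>2) * D.op v x - v x) * of_real (p x))" .
  qed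
qed

lemma op_at_0:
  "D.op v 0 = 0" "D'.op v 0 = (LINT y|half_line. of_real (exp (- \<kappa> * y)) * v y)"
proof -
  have "D.op v 0 = (LINT y|half_line. 0)"
    unfolding D.op_def by (intro Bochner_Integration.integral_cong refl) (simp add: dirichlet_kernel_def)
  then show "D.op v 0 = 0" by simp
  show "D'.op v 0 = (LINT y|half_line. of_real (exp (- \<kappa> * y)) * v y)"
    unfolding D'.op_def by (intro Bochner_Integration.integral_cong refl) (simp add: dirichlet_kernel'_def)
qed

lemma weak_derivative_exp:
  "weak_derivative (\<lambda>x. of_real (exp (- \<kappa> * x))) (\<lambda>x. - of_real \<kappa> * of_real (exp (- \<kappa> * x)))"
  unfolding weak_derivative_def
proof (intro conjI allI impI L2_half_line_locally_integrable scale_L2_half_line exp_L2_half_line \<kappa>)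
  fix p p' assume t: "test_function p p'"
  have D: "((\<lambda>x. exp (- \<kappa> * x)) has_real_derivative - \<kappa> * exp (- \<kappa> * x)) (at x)" for x
    by (auto intro!: derivative_eq_intros)
  have C: "continuous_on UNIV (\<lambda>x. - \<kappa> * exp (- \<kappa> * x))" by (intro continuous_intros)
  have "(LINT x|half_line. exp (- \<kappa> * x) * p' x) = - (LINT x|half_line. - \<kappa> * exp (- \<kappa> * x) * p x)"
    \<comment> \<open>Both branches are the same function, so the break point 1 is arbitrary and
      there is no jump.\<close>
    using test_function_by_parts[OF t zero_less_one D C D C] by simp
  then have "complex_of_real (LINT x|half_line. exp (- \<kappa> * x) * p' x) = - of_real (LINT x|half_line. - \<kappa> * exp (- \<kappa> * x) * p x)"
    by (simp only: of_real_minus)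
  then show "(LINT x|half_line. complex_of_real (exp (- \<kappa> * x)) * of_real (p' x)) =
      - (LINT x|half_line. - complex_of_real \<kappa> * of_real (exp (- \<kappa> * x)) * of_real (p x))"
    unfolding integral_complex_of_real[symmetric] by simp
qed

end

text \<open>Variation of constants: on each edge the Dirichlet solution plus B exp (- \<kappa> x).
  All edges then have value B at the vertex and derivative \<open>I j\<close> - \<kappa> B, and the
  vertex condition becomes (N \<kappa> + \<alpha>) B = (sum of all \<open>I j\<close>), which
  determines B. Expanding B as an integral against \<open>f\<close> yields the part of the kernel
  shared by all pairs of edges.\<close>

theorem resolvent_in_hamiltonian:
  fixes f :: "'n::finite wave"
  defines "N \<equiv> real CARD('n)"
  assumes \<kappa>: "\<kappa> > 0" and \<alpha>: "\<alpha> > 0" and f: "f \<in> L2"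
  shows "(star_op (resolvent_a \<kappa>) (resolvent_b N \<alpha> \<kappa>) f,
    \<lambda>j x. f j x - of_real (\<kappa>\<^sup>2) * star_op (resolvent_a \<kappa>) (resolvent_b N \<alpha> \<kappa>) f j x) \<in> star_hamiltonian \<alpha>"
proof -
  interpret dirichlet \<kappa> by standard fact
  define e where "e x = complex_of_real (exp (- \<kappa> * x))" for x
  define I where "I l = (LINT y|half_line. of_real (exp (- \<kappa> * y)) * f l y)" for l
  define B where "B = (\<Sum>l\<in>UNIV. I l) / of_real (N * \<kappa> + \<alpha>)"
  define U where "U j x = D.op (f j) x + B * e x" for j x
  define U' where "U' j x = D'.op (f j) x + B * (- of_real \<kappa> * e x)" for j x
  have N: "N \<ge> 1" by (simp add: N_def Suc_leI)
  have pos: "N * \<kappa> + \<alpha> > 0" using N \<kappa> \<alpha> by (simp add: add_nonneg_pos)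
  have fj: "f j \<in> L2_half_line" for j using f by (rule L2_D)
  have eL: "e \<in> L2_half_line" unfolding e_def[abs_def] by (rule exp_L2_half_line[OF \<kappa>])
  have ed: "weak_derivative e (\<lambda>x. - of_real \<kappa> * e x)"
    unfolding e_def[abs_def] by (rule weak_derivative_exp)
  have ed': "weak_derivative (\<lambda>x. - of_real \<kappa> * e x) (\<lambda>x. of_real (\<kappa>\<^sup>2) * e x)"
  proof -
    have "weak_derivative (\<lambda>x. 0) (\<lambda>x. 0)"
      by (auto simp: weak_derivative_def locally_integrable_def set_integrable_def)
    from weak_derivative_add_scale[OF this ed, of "- of_real \<kappa>"] eL
      scale_L2_half_line[OF eL, of "- of_real \<kappa>"] show ?thesis
      by (simp add: scale_L2_half_line zero_L2[THEN L2_D] power2_eq_square mult.assoc)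
  qed
  have U: "star_op (resolvent_a \<kappa>) (resolvent_b N \<alpha> \<kappa>) f = U"
  proof (intro ext)
    fix j x
    have k: "of_real (star_kernel (resolvent_a \<kappa>) (resolvent_b N \<alpha> \<kappa>) j l x y) * f l y =
      (if j = l then of_real (dirichlet_kernel \<kappa> x y) * f l y else 0) +
        e x / of_real (N * \<kappa> + \<alpha>) * (of_real (exp (- \<kappa> * y)) * f l y)" for l y
    proof -
      have "exp (- \<kappa> * (x + y)) = exp (- \<kappa> * x) * exp (- \<kappa> * y)"
        unfolding mult_exp_exp by (simp add: algebra_simps)
      then have b: "resolvent_b N \<alpha> \<kappa> (x + y) = exp (- \<kappa> * x) / (N * \<kappa> + \<alpha>) * exp (- \<kappa> * y)"
        by (simp add: resolvent_b_def)
      have a: "resolvent_a \<kappa> \<bar>x - y\<bar> - resolvent_a \<kappa> (x + y) = dirichlet_kernel \<kappa> x y"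
        by (auto simp: resolvent_a_def dirichlet_kernel_def diff_divide_distrib)
      show ?thesis unfolding star_kernel_def a b e_def
        by (cases "j = l") (simp_all add: algebra_simps add_divide_distrib)
    qed
    have "(LINT y|half_line. of_real (star_kernel (resolvent_a \<kappa>) (resolvent_b N \<alpha> \<kappa>) j l x y) * f l y) =
       (if j = l then D.op (f l) x else 0) + e x / of_real (N * \<kappa> + \<alpha>) * I l" for l
    proof (cases "j = l")
      case True
      then show ?thesis unfolding k I_def D.op_def
        using kernel_integrable[OF fj, of x l] exp_mult_integrable[OF fj, of l] by simp
    next
      case False
      then show ?thesis unfolding k I_def by simp
    qed
    then have "star_op (resolvent_a \<kappa>) (resolvent_b N \<alpha> \<kappa>) f j x =
      (\<Sum>l\<in>UNIV. (if j = l then D.op (f l) x else 0)) + (\<Sum>l\<in>UNIV. e x / of_real (N * \<kappa> + \<alpha>) * I l)"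
      by (simp add: star_op_def sum.distrib)
    also have "\<dots> = U j x"
      unfolding sum_distrib_left[symmetric] by (simp add: U_def B_def)
    finally show "star_op (resolvent_a \<kappa>) (resolvent_b N \<alpha> \<kappa>) f j x = U j x" .
  qed
  define g where "g = (\<lambda>j x. f j x - of_real (\<kappa>\<^sup>2) * U j x)"
  have UL: "U j \<in> L2_half_line" for j
    unfolding U_def[abs_def] by (intro add_L2_half_line scale_L2_half_line D.op_L2(1) fj eL)
  have U'L: "U' j \<in> L2_half_line" for j
    unfolding U'_def[abs_def] by (intro add_L2_half_line scale_L2_half_line D'.op_L2(1) fj eL)
  have gL: "g j \<in> L2_half_line" for j
    unfolding g_def by (intro diff_L2_half_line scale_L2_half_line fj UL)
  have ngL: "(\<lambda>x. - g j x) \<in> L2_half_line" for j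
    using scale_L2_half_line[OF gL, of "-1" j] by simp
  have d1: "weak_derivative (U j) (U' j)" for j
    unfolding U_def[abs_def] U'_def[abs_def]
    by (intro weak_derivative_add_scale weak_derivative_op ed D.op_L2(1) D'.op_L2(1) fj eL scale_L2_half_line)
  have d2: "weak_derivative (U' j) (\<lambda>x. - g j x)" for j
  proof -
    have "weak_derivative (\<lambda>x. D'.op (f j) x + B * (- of_real \<kappa> * e x))
       (\<lambda>x. (of_real (\<kappa>\<^sup>2) * D.op (f j) x - f j x) + B * (of_real (\<kappa>\<^sup>2) * e x))"
      by (intro weak_derivative_add_scale weak_derivative_op ed' D.op_L2(1) D'.op_L2(1) fj eL
          scale_L2_half_line diff_L2_half_line)
    moreover have "(\<lambda>x. (of_real (\<kappa>\<^sup>2) * D.op (f j) x - f j x) + B * (of_real (\<kappa>\<^sup>2) * e x)) = (\<lambda>x. - g j x)"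
      by (simp add: g_def U_def algebra_simps)
    ultimately show ?thesis by (simp add: U'_def[abs_def])
  qed
  have e0: "e 0 = 1" and eC: "isCont e x" for x
    unfolding e_def[abs_def] by (auto intro!: continuous_intros)
  have bv: "boundary_value (U j) B" "boundary_value (U' j) (I j - of_real \<kappa> * B)" for j
  proof -
    have "continuous_on {0..} (U j)" "continuous_on {0..} (U' j)"
      unfolding U_def[abs_def] U'_def[abs_def]
      by (intro continuous_at_imp_continuous_on ballI continuous_intros isCont_op fj eC)+
    moreover have "U j 0 = B" "U' j 0 = I j - of_real \<kappa> * B"
      by (simp_all add: U_def U'_def op_at_0 e0 I_def)
    ultimately show "boundary_value (U j) B" "boundary_value (U' j) (I j - of_real \<kappa> * B)"
      unfolding boundary_value_def by auto
  qed
  have sum: "(\<Sum>j\<in>UNIV. I j - of_real \<kappa> * B) = of_real \<alpha> * B"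
  proof -
    have "(\<Sum>j\<in>UNIV. I j) = of_real (N * \<kappa> + \<alpha>) * B"
      using pos unfolding B_def by (simp del: of_real_add of_real_mult)
    then show ?thesis by (simp add: sum_subtractf N_def algebra_simps)
  qed
  have "U j \<in> sobolev_H 2" for j
  proof -
    have "U' j \<in> sobolev_H (Suc 0)" using U'L[of j] ngL[of j] d2[of j] by auto
    then show ?thesis using UL[of j] d1[of j] unfolding numeral_2_eq_2 by auto
  qed
  moreover have "g \<in> L2" using gL by (simp add: L2_def)
  moreover have "\<exists>u' c d. (\<forall>j. weak_derivative (U j) (u' j) \<and> weak_derivative (u' j) (\<lambda>x. - g j x)) \<and>
      (\<forall>j. boundary_value (U j) c \<and> boundary_value (u' j) (d j)) \<and> (\<Sum>j\<in>UNIV. d j) = of_real \<alpha> * c"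
    by (rule exI[of _ U'], rule exI[of _ B], rule exI[of _ "\<lambda>j. I j - of_real \<kappa> * B"])
      (intro conjI allI d1 d2 bv sum)
  ultimately have "(U, g) \<in> star_hamiltonian \<alpha>"
    unfolding star_hamiltonian_def by (intro CollectI case_prodI conjI allI)
  then show ?thesis unfolding U g_def .
qed

section \<open>Comparing measures through their densities\<close>

text \<open>The relation M1 = M2 + w M3 on subsets of \<open>A\<close> is passed from sets to
  functions by monotone approximation. Written as a sum it involves positive measures only; in the
  application M1 and M2 are measures of v + u and v - u, whose difference is a polarized
  form.\<close>

lemma nn_integral_add_density:
  fixes M1 M2 M3 :: "real measure" and w :: "real \<Rightarrow> ennreal"
  assumes sets [measurable_cong]: "sets M1 = sets borel" "sets M2 = sets borel" "sets M3 = sets borel"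
    and [measurable]: "w \<in> borel_measurable borel" "A \<in> sets borel"
    and eq: "\<And>B. B \<in> sets borel \<Longrightarrow> B \<subseteq> A \<Longrightarrow>
      emeasure M1 B = emeasure M2 B + (\<integral>\<^sup>+s. w s * indicator B s \<partial>M3)"
    and h: "h \<in> borel_measurable borel"
  shows "(\<integral>\<^sup>+s. h s * indicator A s \<partial>M1) =
    (\<integral>\<^sup>+s. h s * indicator A s \<partial>M2) + (\<integral>\<^sup>+s. w s * h s * indicator A s \<partial>M3)"
  using h
proof (induction rule: borel_measurable_induct)
  case (cong f g)
  then have "f = g" by auto
  with cong show ?case by simp
next
  case (set B)
  have [measurable]: "B \<in> sets borel" by fact
  have "(\<integral>\<^sup>+s. indicator B s * indicator A s \<partial>M) = emeasure M (B \<inter> A)"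
    if [measurable_cong]: "sets M = sets borel" for M :: "real measure"
    by (simp add: nn_integral_indicator[symmetric] indicator_inter_arith sets del: nn_integral_indicator)
  moreover have "w s * indicator B s * indicator A s = w s * indicator (B \<inter> A) s" for s
    by (auto simp: indicator_def)
  ultimately show ?case
    using eq[of "B \<inter> A"] by (simp add: sets)
next
  case (mult u c)
  have [measurable]: "u \<in> borel_measurable borel" by fact
  have "(\<integral>\<^sup>+s. c * u s * indicator A s \<partial>M) = c * (\<integral>\<^sup>+s. u s * indicator A s \<partial>M)"
    if [measurable_cong]: "sets M = sets borel" for M :: "real measure"
    unfolding mult.assoc by (intro nn_integral_cmult) measurable
  moreover have "(\<integral>\<^sup>+s. w s * (c * u s) * indicator A s \<partial>M3)
      = c * (\<integral>\<^sup>+s. w s * u s * indicator A s \<partial>M3)"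
    by (subst nn_integral_cmult[symmetric]) (auto intro!: nn_integral_cong simp: ac_simps)
  ultimately show ?case
    using mult by (simp add: sets distrib_left)
next
  case (add u v)
  have [measurable]: "u \<in> borel_measurable borel" "v \<in> borel_measurable borel" by fact+
  have "(\<integral>\<^sup>+s. (v s + u s) * indicator A s \<partial>M)
      = (\<integral>\<^sup>+s. v s * indicator A s \<partial>M) + (\<integral>\<^sup>+s. u s * indicator A s \<partial>M)"
    if [measurable_cong]: "sets M = sets borel" for M :: "real measure"
    unfolding distrib_right by (intro nn_integral_add) measurable
  moreover have "(\<integral>\<^sup>+s. w s * (v s + u s) * indicator A s \<partial>M3)
      = (\<integral>\<^sup>+s. w s * v s * indicator A s \<partial>M3) + (\<integral>\<^sup>+s. w s * u s * indicator A s \<partial>M3)"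
    by (subst nn_integral_add[symmetric]) (auto intro!: nn_integral_cong simp: distrib_right distrib_left)
  ultimately show ?case
    using add by (simp add: sets ac_simps)
next
  case (seq U)
  have [measurable]: "\<And>i. U i \<in> borel_measurable borel" by fact
  have u: "Sup (range U) = (\<lambda>s. SUP i. U i s)" by (rule ext) (rule SUP_apply)
  have inc: "U i s \<le> U j s" if "i \<le> j" for i j s
    using \<open>incseq U\<close> that by (auto simp: incseq_def le_fun_def)
  have *: "(\<integral>\<^sup>+s. v s * (SUP i. U i s) * indicator A s \<partial>M)
      = (SUP i. \<integral>\<^sup>+s. v s * U i s * indicator A s \<partial>M)"
    if [measurable_cong]: "sets M = sets borel" and [measurable]: "v \<in> borel_measurable borel"
    for M :: "real measure" and v
  proof -
    have "(\<integral>\<^sup>+s. v s * (SUP i. U i s) * indicator A s \<partial>M)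
        = (\<integral>\<^sup>+s. (SUP i. v s * U i s * indicator A s) \<partial>M)"
      by (intro nn_integral_cong) (auto simp: SUP_mult_left_ennreal SUP_mult_right_ennreal)
    also have "\<dots> = (SUP i. \<integral>\<^sup>+s. v s * U i s * indicator A s \<partial>M)"
      by (intro nn_integral_monotone_convergence_SUP)
        (auto simp: incseq_def le_fun_def intro!: mult_mono inc)
    finally show ?thesis .
  qed
  have "(SUP i. \<integral>\<^sup>+s. U i s * indicator A s \<partial>M1) =
      (SUP i. (\<integral>\<^sup>+s. U i s * indicator A s \<partial>M2) + (\<integral>\<^sup>+s. w s * U i s * indicator A s \<partial>M3))"
    using seq by simp
  also have "\<dots> = (SUP i. \<integral>\<^sup>+s. U i s * indicator A s \<partial>M2) + (SUP i. \<integral>\<^sup>+s. w s * U i s * indicator A s \<partial>M3)"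
    by (intro ennreal_SUP_add)
      (auto simp: incseq_def intro!: nn_integral_mono mult_mono inc)
  finally show ?case
    unfolding u using *[of M1 "\<lambda>_. 1"] *[of M2 "\<lambda>_. 1"] *[of M3 w] by (simp add: sets)
qed

lemma set_integral_add_density:
  fixes M1 M2 M3 :: "real measure" and w h :: "real \<Rightarrow> real"
  assumes sets [measurable_cong]: "sets M1 = sets borel" "sets M2 = sets borel" "sets M3 = sets borel"
    and [measurable]: "w \<in> borel_measurable borel" "A \<in> sets borel" "h \<in> borel_measurable borel"
    and nonneg: "\<And>s. s \<in> A \<Longrightarrow> 0 \<le> h s" "\<And>s. s \<in> A \<Longrightarrow> 0 \<le> w s"
    and int: "set_integrable M1 A h" "set_integrable M2 A h" "set_integrable M3 A (\<lambda>s. w s * h s)"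
    and fin: "finite_measure M1" "finite_measure M2" "set_integrable M3 A w"
    and eq: "\<And>B. B \<in> sets borel \<Longrightarrow> B \<subseteq> A \<Longrightarrow> measure M1 B = measure M2 B + (LINT s:B|M3. w s)"
  shows "(LINT s:A|M1. h s) = (LINT s:A|M2. h s) + (LINT s:A|M3. w s * h s)"
proof -
  interpret M1: finite_measure M1 by fact
  interpret M2: finite_measure M2 by fact
  have conv: "(\<integral>\<^sup>+s. ennreal (f s) * indicator B s \<partial>M) = ennreal (LINT s:B|M. f s)"
    if "set_integrable M B f" "\<And>s. s \<in> B \<Longrightarrow> 0 \<le> f s" for M :: "real measure" and B and f :: "real \<Rightarrow> real"
  proof -
    have "(\<integral>\<^sup>+s. ennreal (f s) * indicator B s \<partial>M) = (\<integral>\<^sup>+s. ennreal (indicator B s *\<^sub>R f s) \<partial>M)"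
      by (intro nn_integral_cong) (simp add: indicator_def)
    then show ?thesis
      using that unfolding set_integrable_def set_lebesgue_integral_def
      by (simp add: nn_integral_eq_integral indicator_def del: real_scaleR_def)
  qed
  have nn: "0 \<le> (LINT s:B|M. f s)"
    if "\<And>s. s \<in> B \<Longrightarrow> 0 \<le> f s" for M :: "real measure" and B and f :: "real \<Rightarrow> real"
    unfolding set_lebesgue_integral_def using that
    by (intro integral_nonneg_AE) (auto simp: indicator_def)
  have "(\<integral>\<^sup>+s. ennreal (h s) * indicator A s \<partial>M1) =
    (\<integral>\<^sup>+s. ennreal (h s) * indicator A s \<partial>M2) +
    (\<integral>\<^sup>+s. ennreal (w s) * ennreal (h s) * indicator A s \<partial>M3)"
  proof (rule nn_integral_add_density[OF sets])
    fix B :: "real set" assume B: "B \<in> sets borel" "B \<subseteq> A"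
    have "set_integrable M3 B w"
      using B fin(3) by (intro set_integrable_subset[OF fin(3)]) (auto simp: sets)
    then show "emeasure M1 B = emeasure M2 B + (\<integral>\<^sup>+s. ennreal (w s) * indicator B s \<partial>M3)"
      using B nonneg eq[OF B]
      by (subst conv) (auto simp: M1.emeasure_eq_measure M2.emeasure_eq_measure
          intro!: ennreal_plus nn)
  qed auto
  also have "(\<integral>\<^sup>+s. ennreal (w s) * ennreal (h s) * indicator A s \<partial>M3) =
      (\<integral>\<^sup>+s. ennreal (w s * h s) * indicator A s \<partial>M3)"
    by (intro nn_integral_cong) (auto simp: indicator_def ennreal_mult nonneg)
  finally show ?thesis
    using int nonneg by (simp add: conv nn flip: ennreal_plus)
qed

lemma set_integral_cong_measure:
  fixes f :: "real \<Rightarrow> real" and M M' :: "real measure"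
  assumes "sets M = sets borel" "sets M' = sets borel" "A \<in> sets borel"
    and "\<And>B. B \<in> sets borel \<Longrightarrow> B \<subseteq> A \<Longrightarrow> emeasure M B = emeasure M' B"
  shows "set_integrable M A f \<longleftrightarrow> set_integrable M' A f"
    and "(LINT s:A|M. f s) = (LINT s:A|M'. f s)"
proof -
  have sp: "space M = UNIV" "space M' = UNIV"
    using assms sets_eq_imp_space_eq[of M borel] sets_eq_imp_space_eq[of M' borel] by auto
  have "restrict_space M A = restrict_space M' A"
  proof (rule measure_eqI)
    show "sets (restrict_space M A) = sets (restrict_space M' A)"
      using assms by (simp add: sets_restrict_space)
    fix B assume "B \<in> sets (restrict_space M A)"
    then have B: "B \<in> sets borel" "B \<subseteq> A"
      using assms by (auto simp: sets_restrict_space)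
    then show "emeasure (restrict_space M A) B = emeasure (restrict_space M' A) B"
      using assms sp by (simp add: emeasure_restrict_space)
  qed
  then show "set_integrable M A f \<longleftrightarrow> set_integrable M' A f"
    "(LINT s:A|M. f s) = (LINT s:A|M'. f s)"
    using assms sp
    by (simp_all add: set_integrable_eq set_lebesgue_integral_def integral_restrict_space[symmetric]
        del: real_scaleR_def)
qed

section \<open>Scalar spectral measures\<close>

locale pvm =
  fixes E :: "real set \<Rightarrow> 'n::finite wave \<Rightarrow> 'n wave"
  assumes pvm: "projection_valued_measure E"
begin

definition form :: "real set \<Rightarrow> 'n wave \<Rightarrow> 'n wave \<Rightarrow> complex" where
  "form A f g = l2_inner f (E A g)"

lemma E_projection: "\<forall>A\<in>sets borel. orthogonal_projection (E A)"
  and E_empty_UNIV: "\<forall>f\<in>L2. l2_eq (E {} f) (\<lambda>j x. 0) \<and> l2_eq (E UNIV f) f"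
  and E_Int: "\<forall>A\<in>sets borel. \<forall>B\<in>sets borel. \<forall>f\<in>L2. l2_eq (E (A \<inter> B) f) (E A (E B f))"
  and E_Union: "\<forall>A :: nat \<Rightarrow> real set. range A \<subseteq> sets borel \<longrightarrow> disjoint_family A \<longrightarrow>
        (\<forall>f\<in>L2. (\<lambda>n. l2_norm (\<lambda>j x. E (\<Union>i. A i) f j x - (\<Sum>i<n. E (A i) f j x)))
                   \<longlonglongrightarrow> 0)"
  by (rule conjE[OF pvm[unfolded projection_valued_measure_def]], elim conjE, assumption)+

lemma E_L2: "A \<in> sets borel \<Longrightarrow> f \<in> L2 \<Longrightarrow> E A f \<in> L2"
  using bspec[OF E_projection, of A] unfolding orthogonal_projection_def by blast

lemma E_symmetric: "A \<in> sets borel \<Longrightarrow> f \<in> L2 \<Longrightarrow> g \<in> L2 \<Longrightarrow> l2_inner f (E A g) = l2_inner (E A f) g"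
  using bspec[OF E_projection, of A] unfolding orthogonal_projection_def by blast

lemma form_E_right:
  assumes "A \<in> sets borel" "B \<in> sets borel" "f \<in> L2" "g \<in> L2"
  shows "form A f (E B g) = form (A \<inter> B) f g"
proof -
  have "l2_inner f (E (A \<inter> B) g) = l2_inner f (E A (E B g))"
    using assms by (intro l2_inner_eq_if_l2_eq E_Int[THEN bspec, THEN bspec, THEN bspec] E_L2 sets.Int)
  then show ?thesis by (simp add: form_def)
qed

lemma form_cnj: "A \<in> sets borel \<Longrightarrow> f \<in> L2 \<Longrightarrow> g \<in> L2 \<Longrightarrow> cnj (form A f g) = form A g f"
  by (simp add: form_def l2_inner_cnj E_symmetric)

lemma form_E_left:
  assumes "A \<in> sets borel" "B \<in> sets borel" "f \<in> L2" "g \<in> L2"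
  shows "form A (E B f) g = form (A \<inter> B) f g"
  using form_cnj[of A g "E B f"] form_cnj[of "A \<inter> B" g f] assms
  by (simp add: form_E_right E_L2)

lemma form_add_left:
  assumes "A \<in> sets borel" "f \<in> L2" "g \<in> L2" "h \<in> L2"
  shows "form A (\<lambda>j x. f j x + g j x) h = form A f h + form A g h"
  using assms by (simp add: form_def l2_inner_add_left E_L2)

lemma form_scale_left: "form A (\<lambda>j x. c * f j x) h = cnj c * form A f h"
  by (simp add: form_def l2_inner_scale_left)

lemma form_add_right:
  assumes "A \<in> sets borel" "f \<in> L2" "g \<in> L2" "h \<in> L2"
  shows "form A h (\<lambda>j x. f j x + g j x) = form A h f + form A h g"
  using assms by (simp add: form_def E_symmetric add_L2 l2_inner_add_right E_L2)

lemma form_scale_right: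
  assumes "A \<in> sets borel" "f \<in> L2" "h \<in> L2"
  shows "form A h (\<lambda>j x. c * f j x) = c * form A h f"
  using assms by (simp add: form_def E_symmetric scale_L2 l2_inner_scale_right)

lemma form_self:
  assumes "A \<in> sets borel" "f \<in> L2"
  shows "form A f f = of_real ((l2_norm (E A f))\<^sup>2)"
proof -
  have "form A f f = form A f (E A f)"
    using assms by (simp add: form_E_right)
  also have "\<dots> = l2_inner (E A f) (E A f)"
    using assms by (simp add: form_def E_symmetric E_L2)
  finally show ?thesis by (simp add: l2_inner_self)
qed

lemma form_UNIV: "f \<in> L2 \<Longrightarrow> g \<in> L2 \<Longrightarrow> form UNIV f g = l2_inner f g"
  unfolding form_def by (intro l2_inner_eq_if_l2_eq E_L2 E_empty_UNIV[THEN bspec, THEN conjunct2]) auto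

lemma form_empty:
  assumes "f \<in> L2" "g \<in> L2"
  shows "form {} f g = 0"
proof -
  have "form {} f g = l2_inner f (\<lambda>j x. 0)"
    unfolding form_def using assms by (intro l2_inner_eq_if_l2_eq E_L2 zero_L2 E_empty_UNIV[THEN bspec, THEN conjunct1]) auto
  then show ?thesis by (simp add: l2_inner_def)
qed

text \<open>Cauchy-Schwarz turns the norm convergence in the definition of a projection-valued
  measure into countable additivity of each complex set function.\<close>

lemma form_sums:
  fixes A :: "nat \<Rightarrow> real set"
  assumes A: "range A \<subseteq> sets borel" "disjoint_family A" and f: "f \<in> L2" and g: "g \<in> L2"
  shows "(\<lambda>i. form (A i) f g) sums form (\<Union>i. A i) f g"
proof -
  let ?d = "\<lambda>n j x. E (\<Union>i. A i) g j x - (\<Sum>i<n. E (A i) g j x)"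
  have U: "(\<Union>i. A i) \<in> sets borel" using A by auto
  have d: "?d n \<in> L2" for n
    using A g by (intro diff_L2 sum_L2 E_L2) auto
  have "(\<lambda>n. l2_norm f * l2_norm (?d n)) \<longlonglongrightarrow> l2_norm f * 0"
    using A g by (intro tendsto_mult tendsto_const E_Union[THEN spec, THEN mp, THEN mp, THEN bspec])
  then have "(\<lambda>n. l2_norm f * l2_norm (?d n)) \<longlonglongrightarrow> 0"
    by simp
  then have "(\<lambda>n. l2_inner f (?d n)) \<longlonglongrightarrow> 0"
    by (rule Lim_null_comparison[OF always_eventually, rotated]) (intro allI l2_Cauchy_Schwarz f d)
  moreover have "l2_inner f (?d n) = form (\<Union>i. A i) f g - (\<Sum>i<n. form (A i) f g)" for n
    using A f g U by (simp add: form_def l2_inner_diff_right l2_inner_sum_right sum_L2 E_L2 image_subset_iff)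
  ultimately have "(\<lambda>n. form (\<Union>i. A i) f g - (\<Sum>i<n. form (A i) f g)) \<longlonglongrightarrow> 0"
    by simp
  then have "(\<lambda>n. form (\<Union>i. A i) f g - (form (\<Union>i. A i) f g - (\<Sum>i<n. form (A i) f g)))
      \<longlonglongrightarrow> form (\<Union>i. A i) f g - 0"
    by (intro tendsto_diff tendsto_const)
  then show ?thesis by (simp add: sums_def)
qed

lemma form_Un:
  assumes "A \<in> sets borel" "B \<in> sets borel" "A \<inter> B = {}" "f \<in> L2" "g \<in> L2"
  shows "form (A \<union> B) f g = form A f g + form B f g"
proof -
  have "(\<lambda>i. form (binaryset A B i) f g) sums form (\<Union>i. binaryset A B i) f g"
    using assms by (intro form_sums) (auto simp: range_binaryset_eq disjoint_family_on_def binaryset_def)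
  moreover have "(\<lambda>i. form (binaryset A B i) f g) sums (form A f g + form B f g)"
    unfolding sums_def using assms by (intro LIMSEQ_binaryset form_empty)
  ultimately show ?thesis using sums_unique2 by (metis UN_binaryset_eq)
qed

abbreviation \<mu> :: "'n wave \<Rightarrow> real measure" where "\<mu> \<equiv> scalar_measure E"

lemma sets_scalar_measure [simp, measurable_cong]: "sets (\<mu> f) = sets borel"
  by (simp add: scalar_measure_def sets.sigma_sets_eq[of borel, simplified])

lemma space_scalar_measure [simp]: "space (\<mu> f) = UNIV"
  by (simp add: scalar_measure_def)

lemma emeasure_scalar_measure:
  assumes "f \<in> L2" "A \<in> sets borel"
  shows "emeasure (\<mu> f) A = ennreal (Re (form A f f))"
  unfolding scalar_measure_def form_def[symmetric]
proof (rule emeasure_measure_of_sigma)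
  show "sigma_algebra UNIV (sets borel)"
    using sets.sigma_algebra_axioms[of borel] by simp
  show "positive (sets borel) (\<lambda>A. ennreal (Re (form A f f)))"
    using assms by (simp add: positive_def form_empty)
  show "countably_additive (sets borel) (\<lambda>A. ennreal (Re (form A f f)))"
    unfolding countably_additive_def
  proof (intro allI impI)
    fix A :: "nat \<Rightarrow> real set" assume A: "range A \<subseteq> sets borel" "disjoint_family A"
    show "(\<Sum>i. ennreal (Re (form (A i) f f))) = ennreal (Re (form (\<Union> (range A)) f f))"
      using sums_Re[OF form_sums[OF A assms(1) assms(1)]] A assms(1)
      by (intro suminf_ennreal_eq) (auto simp: form_self image_subset_iff)
  qed
qed fact

lemma Re_form_self_nonneg: "f \<in> L2 \<Longrightarrow> A \<in> sets borel \<Longrightarrow> 0 \<le> Re (form A f f)"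
  by (simp add: form_self)

lemma measure_scalar_measure:
  "f \<in> L2 \<Longrightarrow> A \<in> sets borel \<Longrightarrow> measure (\<mu> f) A = Re (form A f f)"
  by (simp add: measure_def emeasure_scalar_measure Re_form_self_nonneg)

lemma finite_scalar_measure: "f \<in> L2 \<Longrightarrow> finite_measure (\<mu> f)"
  by (intro finite_measureI) (simp add: emeasure_scalar_measure)

lemma measure_scalar_measure_le:
  assumes "f \<in> L2" "A \<in> sets borel"
  shows "measure (\<mu> f) A \<le> (l2_norm f)\<^sup>2"
proof -
  have "measure (\<mu> f) A \<le> measure (\<mu> f) UNIV"
    using finite_measure.finite_measure_mono[OF finite_scalar_measure[OF assms(1)], of A UNIV] by simp
  also have "\<dots> = (l2_norm f)\<^sup>2"
    using assms by (simp add: measure_scalar_measure form_UNIV l2_inner_self)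
  finally show ?thesis .
qed

lemma scalar_integrable_bounded:
  fixes h :: "real \<Rightarrow> real"
  assumes "f \<in> L2" "A \<in> sets borel" "h \<in> borel_measurable borel" "\<And>s. s \<in> A \<Longrightarrow> \<bar>h s\<bar> \<le> B"
  shows "set_integrable (\<mu> f) A h"
proof -
  interpret finite_measure "\<mu> f" using assms finite_scalar_measure by blast
  have "(\<lambda>s. indicator A s *\<^sub>R h s) \<in> borel_measurable (\<mu> f)"
    using assms(2,3) by measurable
  moreover have "norm (indicator A s *\<^sub>R h s) \<le> \<bar>B\<bar>" for s
    using assms(4)[of s] by (auto simp: indicator_def)
  ultimately show ?thesis
    unfolding set_integrable_def by (intro integrable_const_bound[where B="\<bar>B\<bar>"]) auto
qed

subsection \<open>Localizing a self-adjoint operator\<close>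

text \<open>
  A vector \<open>E A v + c u\<close> splits orthogonally into its parts in the ranges of \<open>E A\<close> and \<open>E (- A)\<close>.
\<close>

lemma measure_split:
  assumes "A \<in> sets borel" "B \<in> sets borel" "v \<in> L2" "u \<in> L2" "cmod c = 1"
  shows "emeasure (\<mu> (\<lambda>j x. E A v j x + c * u j x)) B =
    emeasure (\<mu> (\<lambda>j x. v j x + c * u j x)) (B \<inter> A) + emeasure (\<mu> u) (B - A)"
proof -
  have EL: "E A v \<in> L2" "(\<lambda>j x. E A v j x + c * u j x) \<in> L2" "(\<lambda>j x. v j x + c * u j x) \<in> L2"
    using assms by (auto intro!: add_L2 scale_L2 E_L2)
  have "form B u u = form (B \<inter> A \<union> (B - A)) u u" by (simp add: Int_Diff_Un)
  also have "\<dots> = form (B \<inter> A) u u + form (B - A) u u"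
    using assms by (intro form_Un) auto
  finally have B: "form B u u = form (B \<inter> A) u u + form (B - A) u u" .
  have c: "c * (cnj c * z) = z" for z
    using assms(5) by (metis complex_norm_square mult.assoc mult_1 of_real_1 one_power2)
  have "form B (\<lambda>j x. E A v j x + c * u j x) (\<lambda>j x. E A v j x + c * u j x) =
     form (B \<inter> A) (\<lambda>j x. v j x + c * u j x) (\<lambda>j x. v j x + c * u j x) + form (B - A) u u"
    using assms EL
    by (simp add: form_add_left form_add_right form_scale_left form_scale_right form_E_left form_E_right
        scale_L2 c B algebra_simps)
  then show ?thesis
    using assms EL by (simp add: emeasure_scalar_measure Re_form_self_nonneg)
qed

lemma scalar_measure_scale:
  assumes "u \<in> L2" "A \<in> sets borel"
  shows "measure (\<mu> (\<lambda>j x. c * u j x)) A = (cmod c)\<^sup>2 * measure (\<mu> u) A"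
proof -
  have "form A (\<lambda>j x. c * u j x) (\<lambda>j x. c * u j x) = of_real ((cmod c)\<^sup>2) * form A u u"
    using assms unfolding complex_norm_square
    by (simp add: form_scale_left form_scale_right)
  then show ?thesis using assms by (simp add: measure_scalar_measure scale_L2)
qed

text \<open>On \<open>A\<close> the measure of \<open>E A v\<close> + c u is that of v + c u. Off
  \<open>A\<close> it is that of u alone, because |c| = 1. This second part does not depend on c and
  cancels in differences.\<close>

lemma integral_split:
  assumes A: "A \<in> sets borel" "A \<subseteq> {-b..b}" and v: "v \<in> L2" and c: "cmod c = 1"
    and u: "u \<in> spectral_domain E (\<lambda>s. s)"
  shows "integral\<^sup>L (\<mu> (\<lambda>j x. E A v j x + c * u j x)) (\<lambda>s. s) =
    (LINT s:A|\<mu> (\<lambda>j x. v j x + c * u j x). s) + (LINT s:-A|\<mu> u. s)"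
proof -
  have uL: "u \<in> L2" and u2: "integrable (\<mu> u) (\<lambda>s. s\<^sup>2)"
    using u by (auto simp: spectral_domain_def)
  let ?w = "\<lambda>j x. E A v j x + c * u j x" and ?v = "\<lambda>j x. v j x + c * u j x"
  have L: "?w \<in> L2" "?v \<in> L2" "E A v \<in> L2"
    using assms uL by (auto intro!: add_L2 scale_L2 E_L2)
  interpret finite_measure "\<mu> u" using uL finite_scalar_measure by blast
  \<comment> \<open>The domain provides integrability of s^2; on a finite measure |s| \<le> 1 + s^2
    then gives that of s.\<close>
  have "integrable (\<mu> u) (\<lambda>s. s)"
  proof (rule Bochner_Integration.integrable_bound)
    show "integrable (\<mu> u) (\<lambda>s. 1 + s\<^sup>2)" using u2 by auto
    show "AE s in \<mu> u. norm s \<le> norm (1 + s\<^sup>2)"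
    proof (rule AE_I2)
      fix s :: real
      have "0 \<le> (\<bar>s\<bar> - 1)\<^sup>2" by simp
      then show "norm s \<le> norm (1 + s\<^sup>2)"
        unfolding power2_diff by (simp add: abs_if split: if_splits)
    qed
  qed auto
  then have u1: "set_integrable (\<mu> u) (-A) (\<lambda>s. s)"
    unfolding set_integrable_def using A
    by (intro integrable_mult_indicator) auto
  have eqA: "emeasure (\<mu> ?w) B = emeasure (\<mu> ?v) B" if "B \<in> sets borel" "B \<subseteq> A" for B
  proof -
    have "B \<inter> A = B" "B - A = {}" using that by auto
    then show ?thesis using measure_split[OF A(1) that(1) v uL c] by (simp only:) simp
  qed
  have eqC: "emeasure (\<mu> ?w) B = emeasure (\<mu> u) B" if "B \<in> sets borel" "B \<subseteq> -A" for B
  proof -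
    have "B \<inter> A = {}" "B - A = B" using that by auto
    then show ?thesis using measure_split[OF A(1) that(1) v uL c] by simp
  qed
  have A': "-A \<in> sets borel" using A by auto
  have "\<bar>s\<bar> \<le> b" if "s \<in> A" for s
    using that A(2) by (auto simp: abs_le_iff subset_iff)
  then have v1: "set_integrable (\<mu> ?v) A (\<lambda>s. s)"
    using A L by (intro scalar_integrable_bounded[where B=b]) auto
  have i1: "set_integrable (\<mu> ?w) A (\<lambda>s. s)"
    using v1 set_integral_cong_measure(1)[OF _ _ A(1) eqA] by simp
  have i2: "set_integrable (\<mu> ?w) (-A) (\<lambda>s. s)"
    using u1 set_integral_cong_measure(1)[OF _ _ A' eqC] by simp
  have "integral\<^sup>L (\<mu> ?w) (\<lambda>s. s) = (LINT s:A \<union> -A|\<mu> ?w. s)"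
    by (simp add: set_lebesgue_integral_def)
  also have "\<dots> = (LINT s:A|\<mu> ?w. s) + (LINT s:-A|\<mu> ?w. s)"
    using i1 i2 by (intro set_integral_Un) auto
  also have "(LINT s:A|\<mu> ?w. s) = (LINT s:A|\<mu> ?v. s)"
    using set_integral_cong_measure(2)[OF _ _ A(1) eqA] by simp
  also have "(LINT s:-A|\<mu> ?w. s) = (LINT s:-A|\<mu> u. s)"
    using set_integral_cong_measure(2)[OF _ _ A' eqC] by simp
  finally show ?thesis .
qed

text \<open>The scalar measure of \<open>E A v\<close> is concentrated on the bounded set
  \<open>A\<close>. Hence every \<open>E A v\<close> is an admissible test vector for H.\<close>

lemma E_in_spectral_domain:
  assumes A: "A \<in> sets borel" "A \<subseteq> {-b..b}" and v: "v \<in> L2"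
  shows "E A v \<in> spectral_domain E (\<lambda>s. s)"
proof -
  have EL: "E A v \<in> L2" using assms E_L2 by auto
  have eq: "emeasure (\<mu> (E A v)) B = emeasure (\<mu> v) (B \<inter> A)" if "B \<in> sets borel" for B
    using that assms EL
    by (simp add: emeasure_scalar_measure form_E_left form_E_right)
  have "\<bar>s\<^sup>2\<bar> \<le> b\<^sup>2" if "s \<in> A" for s
  proof -
    have "\<bar>s\<bar> \<le> \<bar>b\<bar>" using that A(2) by (auto simp: abs_le_iff abs_if subset_iff)
    then show ?thesis by (simp add: abs_le_square_iff)
  qed
  then have "set_integrable (\<mu> (E A v)) A (\<lambda>s. s\<^sup>2)"
    using A EL by (intro scalar_integrable_bounded[where B="b\<^sup>2"]) auto
  moreover have "AE s in \<mu> (E A v). s \<in> A"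
    using A EL eq[of "-A"] by (intro AE_I[where N="-A"]) auto
  then have "AE s in \<mu> (E A v). indicator A s *\<^sub>R s\<^sup>2 = s\<^sup>2" by auto
  ultimately have "integrable (\<mu> (E A v)) (\<lambda>s. s\<^sup>2)"
    unfolding set_integrable_def using A
    by (subst (asm) integrable_cong_AE[where g="\<lambda>s. s\<^sup>2"]) auto
  then show ?thesis using EL by (simp add: spectral_domain_def)
qed

text \<open>In the polarization sum the real part keeps k = 0 and k = 2 only, since the other two
  terms are imaginary. With the test vector \<open>E A v\<close> the contributions off
  \<open>A\<close> are the same in both and cancel.\<close>

lemma four_Re_form_operator:
  assumes A: "A \<in> sets borel" "A \<subseteq> {-b..b}" and v: "v \<in> L2"
    and ug: "(u, g) \<in> spectral_integral E (\<lambda>s. s)"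
  shows "4 * Re (form A v g) =
    (LINT s:A|\<mu> (\<lambda>j x. v j x + 1 * u j x). s) - (LINT s:A|\<mu> (\<lambda>j x. v j x + (-1) * u j x). s)"
proof -
  have u: "u \<in> spectral_domain E (\<lambda>s. s)" and gL: "g \<in> L2"
    and *: "l2_inner (E A v) g = spectral_form E (\<lambda>s. s) (E A v) u"
    using ug E_in_spectral_domain[OF A v] by (auto simp: spectral_integral_def)
  have "form A v g = spectral_form E (\<lambda>s. s) (E A v) u"
    using A v gL * by (simp add: form_def E_symmetric)
  from arg_cong[OF this, of "\<lambda>z. 4 * Re z"]
  have "4 * Re (form A v g) = integral\<^sup>L (\<mu> (\<lambda>j x. E A v j x + 1 * u j x)) (\<lambda>s. s)
      - integral\<^sup>L (\<mu> (\<lambda>j x. E A v j x + (-1) * u j x)) (\<lambda>s. s)"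
    by (simp add: spectral_form_def lessThan_nat_numeral eval_nat_numeral)
  then show ?thesis
    using integral_split[OF A v _ u, of 1] integral_split[OF A v _ u, of "-1"] by simp
qed

end

section \<open>Resolvents and scalar spectral measures\<close>

context pvm begin

lemma Re_form_commute:
  "A \<in> sets borel \<Longrightarrow> f \<in> L2 \<Longrightarrow> g \<in> L2 \<Longrightarrow> Re (form A f g) = Re (form A g f)"
  using arg_cong[OF form_cnj[of A f g], of Re] by simp

lemma measure_parallelogram:
  assumes "A \<in> sets borel" "v \<in> L2" "u \<in> L2"
  shows "measure (\<mu> (\<lambda>j x. v j x + 1 * u j x)) A + measure (\<mu> (\<lambda>j x. v j x + (-1) * u j x)) A =
      2 * measure (\<mu> v) A + 2 * measure (\<mu> u) A"
    and measure_polarization: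
      "measure (\<mu> (\<lambda>j x. v j x + 1 * u j x)) A - measure (\<mu> (\<lambda>j x. v j x + (-1) * u j x)) A =
      4 * Re (form A v u)"
proof -
  have vL: "(\<lambda>j x. v j x + c * u j x) \<in> L2" for c
    using assms by (auto intro!: add_L2 scale_L2)
  have uv: "Re (form A u v) = Re (form A v u)"
    by (rule Re_form_commute) (fact assms)+
  have *: "measure (\<mu> (\<lambda>j x. v j x + of_real r * u j x)) A =
      Re (form A v v) + 2 * r * Re (form A v u) + r\<^sup>2 * Re (form A u u)" for r :: real
    using assms vL uv
    by (simp add: measure_scalar_measure form_add_left form_add_right form_scale_left
        form_scale_right scale_L2 algebra_simps power2_eq_square)
  show "measure (\<mu> (\<lambda>j x. v j x + 1 * u j x)) A + measure (\<mu> (\<lambda>j x. v j x + (-1) * u j x)) A =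
      2 * measure (\<mu> v) A + 2 * measure (\<mu> u) A"
    using *[of 1] *[of "-1"] assms by (simp add: measure_scalar_measure)
  show "measure (\<mu> (\<lambda>j x. v j x + 1 * u j x)) A - measure (\<mu> (\<lambda>j x. v j x + (-1) * u j x)) A =
      4 * Re (form A v u)"
    using *[of 1] *[of "-1"] by simp
qed

lemma set_integral_shift:
  assumes "A \<in> sets borel" "A \<subseteq> {-b..b}" "f \<in> L2"
  shows "(LINT s:A|\<mu> f. s + c) = (LINT s:A|\<mu> f. s) + c * measure (\<mu> f) A"
proof -
  interpret finite_measure "\<mu> f" using assms finite_scalar_measure by blast
  have "\<bar>s\<bar> \<le> b" if "s \<in> A" for s
    using that assms(2) by (auto simp: abs_le_iff subset_iff)
  then have "set_integrable (\<mu> f) A (\<lambda>s. s)"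
    using assms by (intro scalar_integrable_bounded[where B=b]) auto
  moreover have "set_integrable (\<mu> f) A (\<lambda>s. c)"
    using assms by (intro scalar_integrable_bounded[where B="\<bar>c\<bar>"]) auto
  ultimately have "(LINT s:A|\<mu> f. s + c) = (LINT s:A|\<mu> f. s) + (LINT s:A|\<mu> f. c)"
    by (rule set_integral_add)
  also have "(LINT s:A|\<mu> f. c) = c * measure (\<mu> f) A"
    using assms by (simp add: set_lebesgue_integral_def)
  finally show ?thesis .
qed

text \<open>If (H + c) u = f, then f = g + c u with g = H u; the polarized measure of
  \<open>A\<close> absorbs the summand c u, which turns the integrand s into s + c.\<close>

lemma four_Re_form_shift:
  assumes A: "A \<in> sets borel" "A \<subseteq> {-b..b}" and v: "v \<in> L2" and f: "f \<in> L2" and u: "u \<in> L2"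
    and ug: "(u, \<lambda>j x. f j x - of_real c * u j x) \<in> spectral_integral E (\<lambda>s. s)"
  shows "4 * Re (form A v f) =
    (LINT s:A|\<mu> (\<lambda>j x. v j x + 1 * u j x). s + c) - (LINT s:A|\<mu> (\<lambda>j x. v j x + (-1) * u j x). s + c)"
proof -
  let ?g = "\<lambda>j x. f j x - of_real c * u j x"
  have g: "?g \<in> L2" using f u by (intro diff_L2 scale_L2)
  have vL: "(\<lambda>j x. v j x + c * u j x) \<in> L2" for c
    using v u by (auto intro!: add_L2 scale_L2)
  have "form A v (\<lambda>j x. ?g j x + of_real c * u j x) = form A v ?g + of_real c * form A v u"
    using A v g u by (subst form_add_right) (auto simp: scale_L2 form_scale_right)
  then have "form A v f = form A v ?g + of_real c * form A v u" by simp
  then have "4 * Re (form A v f) = 4 * Re (form A v ?g) + c * (4 * Re (form A v u))" by simp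
  also have "\<dots> = (LINT s:A|\<mu> (\<lambda>j x. v j x + 1 * u j x). s + c)
      - (LINT s:A|\<mu> (\<lambda>j x. v j x + (-1) * u j x). s + c)"
    unfolding four_Re_form_operator[OF A v ug] measure_polarization[OF A(1) v u, symmetric]
      set_integral_shift[OF A vL] by (simp add: right_diff_distrib)
  finally show ?thesis .
qed

text \<open>
  A bounded right inverse of \<open>H + c\<close> keeps the spectrum away from \<open>- c\<close>: on a spectral
  subspace for a short interval around \<open>- c\<close> the operator \<open>H + c\<close> is too small to be inverted.
\<close>

lemma null_near_resolvent_point:
  assumes R: "\<And>f. f \<in> L2 \<Longrightarrow> R f \<in> L2"
    "\<And>f. f \<in> L2 \<Longrightarrow> (R f, \<lambda>j x. f j x - of_real c * R f j x) \<in> spectral_integral E (\<lambda>s. s)"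
    "\<And>f. f \<in> L2 \<Longrightarrow> (l2_norm (R f))\<^sup>2 \<le> C * (l2_norm f)\<^sup>2"
  obtains \<epsilon> where "\<epsilon> > 0"
    "\<And>A f. f \<in> L2 \<Longrightarrow> A \<in> sets borel \<Longrightarrow> A \<subseteq> {- c - \<epsilon>..- c + \<epsilon>} \<Longrightarrow> measure (\<mu> f) A = 0"
proof
  \<comment> \<open>The estimate below ends in 4 m \<le> 2 \<epsilon> (1 + |C|) m for m =
    \<open>measure (\<mu> f) A\<close>; this \<epsilon> makes the right side 2 m, whence m =
    0.\<close>
  define \<epsilon> where "\<epsilon> = 1 / (1 + \<bar>C\<bar>)"
  show "\<epsilon> > 0" by (simp add: \<epsilon>_def add_pos_nonneg)
  fix A and f :: "'n wave"
  assume f: "f \<in> L2" and A: "A \<in> sets borel" "A \<subseteq> {- c - \<epsilon>..- c + \<epsilon>}"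
  \<comment> \<open>After projecting, the whole norm of \<open>F\<close> sits on \<open>A\<close>,
    so the bound on \<open>R\<close> can be compared with \<open>measure (\<mu> f) A\<close>
    itself.\<close>
  define F where "F = E A f"
  define u where "u = R F"
  have F: "F \<in> L2" using A f by (simp add: F_def E_L2)
  have u: "u \<in> L2" "(u, \<lambda>j x. F j x - of_real c * u j x) \<in> spectral_integral E (\<lambda>s. s)"
    "(l2_norm u)\<^sup>2 \<le> C * (l2_norm F)\<^sup>2"
    using R F by (auto simp: u_def)
  have near: "- c - \<epsilon> \<le> s" "s \<le> - c + \<epsilon>" if "s \<in> A" for s
    using A(2) that by auto
  have bd: "A \<subseteq> {- (\<bar>c\<bar> + \<epsilon>)..\<bar>c\<bar> + \<epsilon>}"
  proof
    show "s \<in> {- (\<bar>c\<bar> + \<epsilon>)..\<bar>c\<bar> + \<epsilon>}" if "s \<in> A" for s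
      using near[OF that] abs_ge_self[of c] abs_ge_minus_self[of c] by simp
  qed
  have FA: "measure (\<mu> F) A = measure (\<mu> f) A"
    using A f by (simp add: measure_scalar_measure F F_def form_E_left form_E_right E_L2)
  have nF: "(l2_norm F)\<^sup>2 = measure (\<mu> f) A"
    using A f by (simp add: measure_scalar_measure F_def form_self)
  have int: "set_integrable (\<mu> w) A (\<lambda>s. s + c)" "set_integrable (\<mu> w) A (\<lambda>s. \<epsilon>)"
    "set_integrable (\<mu> w) A (\<lambda>s. - \<epsilon>)" if "w \<in> L2" for w
  proof -
    have "\<bar>s + c\<bar> \<le> \<epsilon>" if "s \<in> A" for s
      using near[OF that] by (simp add: abs_le_iff)
    then show "set_integrable (\<mu> w) A (\<lambda>s. s + c)" "set_integrable (\<mu> w) A (\<lambda>s. \<epsilon>)"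
      "set_integrable (\<mu> w) A (\<lambda>s. - \<epsilon>)"
      using that A(1) \<open>\<epsilon> > 0\<close> by (auto intro!: scalar_integrable_bounded[where B=\<epsilon>])
  qed
  have bound: "\<bar>LINT s:A|\<mu> w. s + c\<bar> \<le> \<epsilon> * measure (\<mu> w) A" if w: "w \<in> L2" for w
  proof -
    interpret finite_measure "\<mu> w" using w finite_scalar_measure by blast
    have "(LINT s:A|\<mu> w. s + c) \<le> (LINT s:A|\<mu> w. \<epsilon>)"
      "(LINT s:A|\<mu> w. - \<epsilon>) \<le> (LINT s:A|\<mu> w. s + c)"
      by (intro set_integral_mono int w; use near in fastforce)+
    then show ?thesis using A by (simp add: set_lebesgue_integral_def abs_le_iff) (simp add: mult.commute)
  qed
  have wL: "(\<lambda>j x. F j x + c * u j x) \<in> L2" for c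
    using F u by (auto intro!: add_L2 scale_L2)
  have "4 * measure (\<mu> f) A = 4 * Re (form A F F)"
    using A F FA by (simp add: measure_scalar_measure)
  also have "\<dots> \<le> \<epsilon> * measure (\<mu> (\<lambda>j x. F j x + 1 * u j x)) A
      + \<epsilon> * measure (\<mu> (\<lambda>j x. F j x + (-1) * u j x)) A"
    unfolding four_Re_form_shift[OF A(1) bd F F u(1,2)]
    using bound[OF wL, of 1] bound[OF wL, of "-1"] by (simp add: abs_le_iff)
  also have "\<dots> = 2 * \<epsilon> * (measure (\<mu> F) A + measure (\<mu> u) A)"
    unfolding distrib_left[symmetric] measure_parallelogram[OF A(1) F u(1)] by simp
  also have "\<dots> \<le> 2 * \<epsilon> * (measure (\<mu> f) A + \<bar>C\<bar> * measure (\<mu> f) A)"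
  proof (intro mult_left_mono add_mono)
    have "measure (\<mu> u) A \<le> C * (l2_norm F)\<^sup>2"
      using measure_scalar_measure_le[OF u(1) A(1)] u(3) by linarith
    also have "\<dots> \<le> \<bar>C\<bar> * measure (\<mu> f) A"
      unfolding nF by (intro mult_right_mono) auto
    finally show "measure (\<mu> u) A \<le> \<bar>C\<bar> * measure (\<mu> f) A" .
  qed (use FA \<open>\<epsilon> > 0\<close> in auto)
  also have "\<dots> = 2 * measure (\<mu> f) A"
    by (simp add: \<epsilon>_def field_simps add_pos_nonneg)
  finally show "measure (\<mu> f) A = 0"
    using measure_nonneg[of "\<mu> f" A] by linarith
qed

text \<open>Every s < 0 has a null neighbourhood, taken at the resolvent point c = - s. The radii
  are not controlled as s varies, so a countable subcover is extracted by Lindelof.\<close>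

lemma AE_nonneg:
  assumes R: "\<And>c f. c > 0 \<Longrightarrow> f \<in> L2 \<Longrightarrow> R c f \<in> L2"
    "\<And>c f. c > 0 \<Longrightarrow> f \<in> L2 \<Longrightarrow>
      (R c f, \<lambda>j x. f j x - of_real c * R c f j x) \<in> spectral_integral E (\<lambda>s. s)"
    "\<And>c f. c > 0 \<Longrightarrow> f \<in> L2 \<Longrightarrow> (l2_norm (R c f))\<^sup>2 \<le> C c * (l2_norm f)\<^sup>2"
    and f: "f \<in> L2"
  shows "AE s in \<mu> f. 0 \<le> s"
proof -
  define \<F> where "\<F> = {U. open U \<and> emeasure (\<mu> f) U = 0}"
  obtain \<F>' where \<F>': "\<F>' \<subseteq> \<F>" "countable \<F>'" "\<Union>\<F>' = \<Union>\<F>"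
    using Lindelof[of \<F>] by (auto simp: \<F>_def)
  have "(\<Union>U\<in>\<F>'. U) \<in> null_sets (\<mu> f)"
    using \<F>'(1,2) by (intro null_sets_UN') (auto simp: \<F>_def null_sets_def)
  then have null: "\<Union>\<F>' \<in> null_sets (\<mu> f)" by simp
  have "s \<in> \<Union>\<F>'" if s: "s < 0" for s
  proof -
    have "-s > 0" using s by simp
    from null_near_resolvent_point[of "R (-s)" "-s" "C (-s)"] R[OF this]
    obtain \<epsilon> where \<epsilon>: "\<epsilon> > 0"
      "\<And>A f. f \<in> L2 \<Longrightarrow> A \<in> sets borel \<Longrightarrow> A \<subseteq> {s - \<epsilon>..s + \<epsilon>} \<Longrightarrow> measure (\<mu> f) A = 0"
      by auto
    interpret finite_measure "\<mu> f" using f finite_scalar_measure by blast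
    have "measure (\<mu> f) {s - \<epsilon><..<s + \<epsilon>} = 0"
      by (intro \<epsilon> f) auto
    then have "{s - \<epsilon><..<s + \<epsilon>} \<in> \<F>" by (simp add: \<F>_def emeasure_eq_measure)
    then show ?thesis unfolding \<F>'(3) using \<epsilon>(1) by (intro UnionI[where X="{s - \<epsilon><..<s + \<epsilon>}"]) auto
  qed
  then show ?thesis
    using null by (intro AE_I'[OF null]) (auto simp: not_le)
qed

text \<open>From (H + c) u = f follow, on subsets of \<open>A\<close>, first d Re <u, E f> = (s + c)
  d \<mu> u and then d \<mu> f = (s + c)^2 d \<mu> u. Dividing by s + c turns the integral of 1 / (s
  + c) against \<mu> f back into the first form.\<close>

lemma resolvent_integral_bounded:
  assumes A: "A \<in> sets borel" "A \<subseteq> {0..b}" and f: "f \<in> L2" and u: "u \<in> L2" and c: "c > 0"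
    and ug: "(u, \<lambda>j x. f j x - of_real c * u j x) \<in> spectral_integral E (\<lambda>s. s)"
  shows "(LINT s:A|\<mu> f. 1 / (s + c)) = Re (form A f u)"
proof -
  have int: "set_integrable (\<mu> w) B h"
    if "w \<in> L2" "B \<in> sets borel" "h \<in> borel_measurable borel" "B \<subseteq> A"
      "\<And>s. 0 \<le> s \<Longrightarrow> s \<le> b \<Longrightarrow> \<bar>h s\<bar> \<le> D" for w B D and h :: "real \<Rightarrow> real"
    using that A by (intro scalar_integrable_bounded[where B=D]) auto
  have bd: "B \<subseteq> {-b..b}" if "B \<subseteq> A" for B
    using that A(2) by force
  let ?p = "\<lambda>j x. f j x + 1 * u j x" and ?m = "\<lambda>j x. f j x + (-1) * u j x"
  have L: "?p \<in> L2" "?m \<in> L2" by (rule add_L2[OF f scale_L2[OF u]])+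
  have form_u: "Re (form B u f) = (LINT s:B|\<mu> u. s + c)" if B: "B \<in> sets borel" "B \<subseteq> A" for B
  proof -
    have L2: "(\<lambda>j x. u j x + r * u j x) \<in> L2" for r using u by (auto intro!: add_L2 scale_L2)
    \<comment> \<open>The case v = u of polarization: the two vectors are 2 u and 0, with measures 4
      \<mu> u and 0.\<close>
    have m: "measure (\<mu> (\<lambda>j x. u j x + 1 * u j x)) D = 4 * measure (\<mu> u) D"
      "measure (\<mu> (\<lambda>j x. u j x + (-1) * u j x)) D = 0" if "D \<in> sets borel" for D
      using scalar_measure_scale[OF u that, of 2] scalar_measure_scale[OF u that, of 0] by simp_all
    have i: "set_integrable (\<mu> w) B (\<lambda>s. s + c)" "set_integrable (\<mu> w) B (\<lambda>s. 4 * (s + c))"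
      "set_integrable (\<mu> w) B (\<lambda>s. 4 :: real)" if "w \<in> L2" for w
    proof -
      show "set_integrable (\<mu> w) B (\<lambda>s. s + c)" using that B c by (intro int[where D="b + c"]) auto
      show "set_integrable (\<mu> w) B (\<lambda>s. 4 * (s + c))" using that B c by (intro int[where D="4 * (b + c)"]) auto
      show "set_integrable (\<mu> w) B (\<lambda>s. 4 :: real)" using that B c by (intro int[where D=4]) auto
    qed
    have s: "0 \<le> s" if "s \<in> B" for s using that B A by auto
    have "(LINT s:B|\<mu> (\<lambda>j x. u j x + 1 * u j x). s + c) =
        (LINT s:B|\<mu> (\<lambda>j x. u j x + (-1) * u j x). s + c) + (LINT s:B|\<mu> u. 4 * (s + c))"
    proof (rule set_integral_add_density)
      interpret finite_measure "\<mu> u" using u finite_scalar_measure by blast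
      show "measure (\<mu> (\<lambda>j x. u j x + 1 * u j x)) D =
          measure (\<mu> (\<lambda>j x. u j x + - 1 * u j x)) D + (LINT s:D|\<mu> u. 4)"
        if "D \<in> sets borel" "D \<subseteq> B" for D
        using m[OF that(1)] that by (simp add: set_lebesgue_integral_def)
    qed (use B u c s i[OF L2[of 1]] i[OF L2[of "-1"]] i[OF u] finite_scalar_measure[OF L2[of 1]]
      finite_scalar_measure[OF L2[of "-1"]] in auto)
    moreover have "4 * Re (form B u f) = (LINT s:B|\<mu> (\<lambda>j x. u j x + 1 * u j x). s + c)
        - (LINT s:B|\<mu> (\<lambda>j x. u j x + (-1) * u j x). s + c)"
      by (rule four_Re_form_shift[OF B(1) bd[OF B(2)] u f u ug])
    moreover have "(LINT s:B|\<mu> u. 4 * (s + c)) = 4 * (LINT s:B|\<mu> u. s + c)"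
      by (rule set_integral_mult_right)
    ultimately show ?thesis by simp
  qed
  have form_f: "measure (\<mu> f) B = (LINT s:B|\<mu> u. (s + c) * (s + c))"
    if B: "B \<in> sets borel" "B \<subseteq> A" for B
  proof -
    have s: "0 \<le> s" if "s \<in> B" for s using that B A by auto
    have "0 \<le> s \<Longrightarrow> s \<le> b \<Longrightarrow> (s + c) * (s + c) \<le> (b + c) * (b + c)" for s
      using c by (intro mult_mono) auto
    then have i: "set_integrable (\<mu> w) B (\<lambda>s. s + c)" "set_integrable (\<mu> w) B (\<lambda>s. 4 * (s + c))"
      "set_integrable (\<mu> w) B (\<lambda>s. 4 * (s + c) * (s + c))" if "w \<in> L2" for w
    proof -
      show "set_integrable (\<mu> w) B (\<lambda>s. s + c)" using that B c by (intro int[where D="b + c"]) auto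
      show "set_integrable (\<mu> w) B (\<lambda>s. 4 * (s + c))" using that B c by (intro int[where D="4 * (b + c)"]) auto
      show "set_integrable (\<mu> w) B (\<lambda>s. 4 * (s + c) * (s + c))"
        using that B c \<open>\<And>s. 0 \<le> s \<Longrightarrow> s \<le> b \<Longrightarrow> (s + c) * (s + c) \<le> (b + c) * (b + c)\<close>
        by (intro int[where D="4 * ((b + c) * (b + c))"]) (auto simp: mult.assoc simp del: distrib_left_numeral)
    qed
    \<comment> \<open>The measures of f + u and f - u differ by 4 Re <f, E u>, which by
      \<open>form_u\<close> has density 4 (s + c) against \<mu> u; the integrand contributes the
      second factor s + c.\<close>
    have "(LINT s:B|\<mu> ?p. s + c) = (LINT s:B|\<mu> ?m. s + c) + (LINT s:B|\<mu> u. 4 * (s + c) * (s + c))"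
    proof (rule set_integral_add_density)
      show "measure (\<mu> ?p) D = measure (\<mu> ?m) D + (LINT s:D|\<mu> u. 4 * (s + c))"
        if D: "D \<in> sets borel" "D \<subseteq> B" for D
      proof -
        have "(LINT s:D|\<mu> u. 4 * (s + c)) = 4 * (LINT s:D|\<mu> u. s + c)"
          by (rule set_integral_mult_right)
        also have "\<dots> = 4 * Re (form D f u)"
          using form_u[OF D(1) order.trans[OF D(2) B(2)]] Re_form_commute[OF D(1) f u] by simp
        finally show ?thesis
          using measure_polarization[OF D(1) f u] by simp
      qed
    qed (use B u c s L i finite_scalar_measure in auto)
    moreover have "4 * Re (form B f f) = (LINT s:B|\<mu> ?p. s + c) - (LINT s:B|\<mu> ?m. s + c)"
      by (rule four_Re_form_shift[OF B(1) bd[OF B(2)] f f u ug])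
    moreover have "(LINT s:B|\<mu> u. 4 * (s + c) * (s + c)) = 4 * (LINT s:B|\<mu> u. (s + c) * (s + c))"
      unfolding mult.assoc by (rule set_integral_mult_right)
    ultimately show ?thesis using B f by (simp add: measure_scalar_measure)
  qed
  have s: "0 \<le> s" if "s \<in> A" for s using that A by auto
  \<comment> \<open>The zero vector, with vanishing measure, serves as the middle term M2 of
    \<open>set_integral_add_density\<close>.\<close>
  have zL: "(\<lambda>j x. 0 * u j x) \<in> L2" by (intro scale_L2 u)
  have bnd: "0 \<le> s \<Longrightarrow> s \<le> b \<Longrightarrow> (s + c) * (s + c) \<le> (b + c) * (b + c)"
    "0 \<le> s \<Longrightarrow> 1 / (s + c) \<le> 1 / c" for s
    using c by (auto intro!: mult_mono frac_le)
  have "(LINT s:A|\<mu> f. 1 / (s + c)) =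
      (LINT s:A|\<mu> (\<lambda>j x. 0 * u j x). 1 / (s + c)) + (LINT s:A|\<mu> u. (s + c) * (s + c) * (1 / (s + c)))"
  proof (rule set_integral_add_density)
    show "measure (\<mu> f) D = measure (\<mu> (\<lambda>j x. 0 * u j x)) D + (LINT s:D|\<mu> u. (s + c) * (s + c))"
      if "D \<in> sets borel" "D \<subseteq> A" for D
      using form_f[OF that] scalar_measure_scale[OF u that(1), of 0] by simp
    show "set_integrable (\<mu> f) A (\<lambda>s. 1 / (s + c))" "set_integrable (\<mu> (\<lambda>j x. 0 * u j x)) A (\<lambda>s. 1 / (s + c))"
      using A c f zL bnd by (auto intro!: int[where D="1 / c"])
    show "set_integrable (\<mu> u) A (\<lambda>s. (s + c) * (s + c) * (1 / (s + c)))"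
      using A c u by (auto intro!: int[where D="b + c"])
    show "set_integrable (\<mu> u) A (\<lambda>s. (s + c) * (s + c))"
      using A c u bnd by (auto intro!: int[where D="(b + c) * (b + c)"])
  qed (use A f u c s zL finite_scalar_measure in auto)
  also have "(LINT s:A|\<mu> (\<lambda>j x. 0 * u j x). 1 / (s + c)) = 0"
  proof -
    have "emeasure (\<mu> (\<lambda>j x. 0 * u j x)) UNIV = 0"
      using zL by (simp add: emeasure_scalar_measure form_scale_left[of UNIV 0 u, simplified])
    then have "AE s in \<mu> (\<lambda>j x. 0 * u j x). indicator A s *\<^sub>R (1 / (s + c)) = 0"
      by (intro AE_I[where N=UNIV]) auto
    then show ?thesis unfolding set_lebesgue_integral_def by (rule integral_eq_zero_AE)
  qed
  also have "(LINT s:A|\<mu> u. (s + c) * (s + c) * (1 / (s + c))) = (LINT s:A|\<mu> u. s + c)"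
    unfolding set_lebesgue_integral_def using s c
    by (intro Bochner_Integration.integral_cong) (auto simp: indicator_def)
  also have "\<dots> = Re (form A f u)"
    using form_u[OF A(1) order_refl] Re_form_commute[OF A(1) f u] by simp
  finally show ?thesis by simp
qed

text \<open>The half-axis is cut into the bounded pieces [i, i + 1) and both sides are countably
  additive. The modulus keeps the integrand bounded by 1 / c on the whole line.\<close>

lemma resolvent_integral:
  assumes f: "f \<in> L2" and u: "u \<in> L2" and c: "c > 0" and nonneg: "AE s in \<mu> f. 0 \<le> s"
    and ug: "(u, \<lambda>j x. f j x - of_real c * u j x) \<in> spectral_integral E (\<lambda>s. s)"
  shows "integral\<^sup>L (\<mu> f) (\<lambda>s. 1 / (\<bar>s\<bar> + c)) = Re (l2_inner f u)"
proof -
  define A where "A i = {real i..<real i + 1}" for i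
  have UA: "(\<Union>i. A i) = {0..}"
  proof
    show "{0..} \<subseteq> (\<Union>i. A i)"
    proof
      fix s :: real assume "s \<in> {0..}"
      then have "s \<in> A (nat \<lfloor>s\<rfloor>)" by (auto simp: A_def)
      then show "s \<in> (\<Union>i. A i)" by blast
    qed
  qed (auto simp: A_def)
  have disj: "A i \<inter> A j = {}" if "i \<noteq> j" for i j
    using that by (auto simp: A_def dest: linorder_neqE_nat)
  have meas: "A i \<in> sets borel" for i by (simp add: A_def)
  have s1: "(\<lambda>i. Re (form (A i) f u)) sums Re (form {0..} f u)"
    using form_sums[of A f u] disj meas f u UA
    by (intro sums_Re) (auto simp: disjoint_family_on_def)
  have int: "set_integrable (\<mu> f) (\<Union>i. A i) (\<lambda>s. 1 / (\<bar>s\<bar> + c))"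
    unfolding UA using f c by (intro scalar_integrable_bounded[where B="1/c"]) (auto intro!: frac_le)
  have "integral\<^sup>L (\<mu> f) (\<lambda>s. 1 / (\<bar>s\<bar> + c)) = (LINT s:(\<Union>i. A i)|\<mu> f. 1 / (\<bar>s\<bar> + c))"
    unfolding set_lebesgue_integral_def UA using nonneg
    by (intro integral_cong_AE) (auto simp: indicator_def)
  also have "\<dots> = (\<Sum>i. LINT s:A i|\<mu> f. 1 / (\<bar>s\<bar> + c))"
    using meas by (intro lebesgue_integral_countable_add disj int) auto
  also have "(\<lambda>i. LINT s:A i|\<mu> f. 1 / (\<bar>s\<bar> + c)) = (\<lambda>i. Re (form (A i) f u))"
  proof
    fix i
    have "(LINT s:A i|\<mu> f. 1 / (\<bar>s\<bar> + c)) = (LINT s:A i|\<mu> f. 1 / (s + c))"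
      by (intro set_lebesgue_integral_cong) (auto simp: A_def)
    also have "\<dots> = Re (form (A i) f u)"
      using c f u ug by (intro resolvent_integral_bounded[where b="real i + 1"]) (auto simp: A_def)
    finally show "(LINT s:A i|\<mu> f. 1 / (\<bar>s\<bar> + c)) = Re (form (A i) f u)" .
  qed
  also have "(\<Sum>i. Re (form (A i) f u)) = Re (form {0..} f u)"
    using s1 by (rule sums_unique[symmetric])
  \<comment> \<open>The negative axis is null for \<mu> f, so \<open>E {..<0} f\<close> has norm
    zero and by Cauchy-Schwarz the form with u vanishes there.\<close>
  also have "\<dots> = Re (form UNIV f u)"
  proof -
    have "emeasure (\<mu> f) {..<0} = 0"
      using nonneg AE_iff_measurable[of "{..<0}" "\<mu> f" "\<lambda>s. 0 \<le> s"] by (auto simp: not_le)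
    then have "Re (form {..<0} f f) \<le> 0" using f by (simp add: emeasure_scalar_measure ennreal_eq_0_iff)
    then have "l2_norm (E {..<0} f) = 0" using f by (simp add: form_self)
    then have "l2_inner u (E {..<0} f) = 0"
      using l2_Cauchy_Schwarz[OF u E_L2[of "{..<0}" f]] f by simp
    then have "form {..<0} f u = 0"
      using form_cnj[of "{..<0}" u f] f u by (simp add: form_def)
    moreover have "form ({..<0} \<union> {0..}) f u = form {..<0} f u + form {0..} f u"
      using f u by (intro form_Un) auto
    moreover have "{..<0} \<union> {0..} = (UNIV :: real set)" by auto
    ultimately show ?thesis by simp
  qed
  also have "\<dots> = Re (l2_inner f u)" using f u by (simp add: form_UNIV)
  finally show ?thesis .
qed

end

section \<open>The cylinder operator\<close>

locale star_spectral = pvm E for E :: "real set \<Rightarrow> 'n::finite wave \<Rightarrow> 'n wave" +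
  fixes \<alpha> N :: real
  assumes N: "N = real CARD('n)" and \<alpha>: "\<alpha> > 0" and H: "star_hamiltonian \<alpha> = spectral_integral E (\<lambda>s. s)"
begin

abbreviation R :: "real \<Rightarrow> 'n wave \<Rightarrow> 'n wave" where
  "R \<kappa> \<equiv> star_op (resolvent_a \<kappa>) (resolvent_b N \<alpha> \<kappa>)"

abbreviation T :: "real \<Rightarrow> 'n wave \<Rightarrow> 'n wave" where
  "T t \<equiv> star_op (cylinder_a t) (cylinder_b N \<alpha> t)"

lemma N_ge_1: "N \<ge> 1"
  by (simp add: N Suc_leI)

lemma R_bound: "\<kappa> > 0 \<Longrightarrow> star_kernel_bound (resolvent_a \<kappa>) (resolvent_b N \<alpha> \<kappa>) (\<lambda>r. 2 / \<kappa> * exp (- \<kappa> * r))"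
  by (intro resolvent_bound \<alpha> N_ge_1)

lemma T_bound: "t > 0 \<Longrightarrow> star_kernel_bound (cylinder_a t) (cylinder_b N \<alpha> t) (\<lambda>r. 5 / pi * poisson t r)"
  using cylinder_bound[of t \<alpha> N 0] \<alpha> N_ge_1 by simp

lemma R_graph:
  "\<kappa> > 0 \<Longrightarrow> f \<in> L2 \<Longrightarrow> (R \<kappa> f, \<lambda>j x. f j x - of_real (\<kappa>\<^sup>2) * R \<kappa> f j x) \<in> spectral_integral E (\<lambda>s. s)"
  unfolding H[symmetric] N by (intro resolvent_in_hamiltonian \<alpha>)

lemma AE_scalar_nonneg:
  assumes f: "f \<in> L2"
  shows "AE s in \<mu> f. 0 \<le> s"
proof (rule AE_nonneg[where R="\<lambda>c. R (sqrt c)"])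
  fix c :: real and f :: "'n wave" assume c: "c > 0" and f: "f \<in> L2"
  then have k: "sqrt c > 0" by simp
  show "R (sqrt c) f \<in> L2" by (rule star_kernel_bound.star_op_L2[OF R_bound[OF k] f])
  show "(l2_norm (R (sqrt c) f))\<^sup>2 \<le> (real CARD('n))\<^sup>2 * (4 * (LINT r|half_line. 2 / sqrt c * exp (- sqrt c * r))\<^sup>2) * (l2_norm f)\<^sup>2"
    by (rule star_kernel_bound.star_op_norm[OF R_bound[OF k] f])
  show "(R (sqrt c) f, \<lambda>j x. f j x - of_real c * R (sqrt c) f j x) \<in> spectral_integral E (\<lambda>s. s)"
    using R_graph[OF k f] c by simp
qed (fact f)

lemma resolvent_form:
  assumes "\<kappa> > 0" "f \<in> L2"
  shows "integral\<^sup>L (\<mu> f) (\<lambda>s. 1 / (\<bar>s\<bar> + \<kappa>\<^sup>2)) = Re (star_form (resolvent_a \<kappa>) (resolvent_b N \<alpha> \<kappa>) f f)"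
proof -
  have "integral\<^sup>L (\<mu> f) (\<lambda>s. 1 / (\<bar>s\<bar> + \<kappa>\<^sup>2)) = Re (l2_inner f (R \<kappa> f))"
    by (intro resolvent_integral R_graph AE_scalar_nonneg star_kernel_bound.star_op_L2[OF R_bound] assms)
      (use assms in simp)
  then show ?thesis by (simp add: star_kernel_bound.l2_inner_star_op[OF R_bound] assms)
qed

text \<open>The \<kappa>^2 in the bound for the weight cancels against |s| + \<kappa>^2 \<ge>
  \<kappa>^2, uniformly in s, so finiteness of \<mu> f is enough for Fubini.\<close>

lemma weight_fubini:
  assumes t: "t > 0" and \<epsilon>: "\<epsilon> > 0" and f: "f \<in> L2"
  shows "(LINT \<kappa>|half_line. weight t \<epsilon> \<kappa> * integral\<^sup>L (\<mu> f) (\<lambda>s. 1 / (\<bar>s\<bar> + \<kappa>\<^sup>2))) =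
      integral\<^sup>L (\<mu> f) (\<lambda>s. regularized_exp t \<epsilon> \<bar>s\<bar>)"
    and "(\<lambda>s. regularized_exp t \<epsilon> \<bar>s\<bar>) \<in> borel_measurable (\<mu> f)"
proof -
  interpret mu: finite_measure "\<mu> f" using f by (rule finite_scalar_measure)
  interpret P: pair_sigma_finite half_line "\<mu> f" ..
  define F where "F = (\<lambda>q. weight t \<epsilon> (fst q) / (\<bar>snd q\<bar> + (fst q)\<^sup>2))"
  have mF: "F \<in> borel_measurable (half_line \<Otimes>\<^sub>M \<mu> f)"
  proof -
    have "(\<lambda>q. (fst q, snd q)) \<in> measurable (half_line \<Otimes>\<^sub>M \<mu> f) (borel \<Otimes>\<^sub>M borel)"
      by (intro measurable_Pair measurable_compose[OF measurable_fst measurable_ident_half_line]) measurable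
    moreover have "F \<in> borel_measurable (borel \<Otimes>\<^sub>M borel)" unfolding F_def by measurable
    ultimately show ?thesis using measurable_compose[of "\<lambda>q. (fst q, snd q)" _ _ F] by simp
  qed
  have le: "\<bar>F (\<kappa>, s)\<bar> \<le> 2 / pi * t * exp (- \<epsilon> * \<kappa>)" if \<kappa>: "\<kappa> > 0" for \<kappa> s
  proof -
    have "\<bar>F (\<kappa>, s)\<bar> = \<bar>weight t \<epsilon> \<kappa>\<bar> / (\<bar>s\<bar> + \<kappa>\<^sup>2)" by (simp add: F_def abs_divide)
    also have "\<dots> \<le> (2 / pi * t * (\<kappa>\<^sup>2 * exp (- \<epsilon> * \<kappa>))) / \<kappa>\<^sup>2"
      using \<kappa> t by (intro frac_le abs_weight_le) auto
    finally show ?thesis using \<kappa> by simp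
  qed
  have iF: "integrable (half_line \<Otimes>\<^sub>M \<mu> f) F"
  proof (rule P.Fubini_integrable[OF mF])
    have mk: "(\<lambda>s. F (\<kappa>, s)) \<in> borel_measurable (\<mu> f)" for \<kappa> unfolding F_def by simp
    have i: "integrable (\<mu> f) (\<lambda>s. F (\<kappa>, s))" if "\<kappa> > 0" for \<kappa>
      by (rule mu.integrable_const_bound[OF _ mk]) (use le[OF that] in auto)
    then show "AE \<kappa> in half_line. integrable (\<mu> f) (\<lambda>s. F (\<kappa>, s))" by (rule AE_half_line_if_positive)
    show "integrable half_line (\<lambda>\<kappa>. LINT s|\<mu> f. norm (F (\<kappa>, s)))"
    proof (rule half_line_integrable_bound[OF integrable_mult_left[OF integrable_mult_right[OF half_line_exp(1)[OF \<epsilon>], of "2 / pi * t"], of "measure (\<mu> f) UNIV"]])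
      have "(\<lambda>q. norm (F q)) \<in> borel_measurable (half_line \<Otimes>\<^sub>M \<mu> f)" using mF by measurable
      then have "case_prod (\<lambda>\<kappa> s. norm (F (\<kappa>, s))) \<in> borel_measurable (half_line \<Otimes>\<^sub>M \<mu> f)"
        by (simp add: case_prod_beta')
      then show "(\<lambda>\<kappa>. LINT s|\<mu> f. norm (F (\<kappa>, s))) \<in> borel_measurable half_line"
        by (rule mu.borel_measurable_lebesgue_integral)
      fix \<kappa> :: real assume \<kappa>: "\<kappa> > 0"
      have "(LINT s|\<mu> f. norm (F (\<kappa>, s))) \<le> (LINT s|\<mu> f. 2 / pi * t * exp (- \<epsilon> * \<kappa>))"
        using i[OF \<kappa>] le[OF \<kappa>] by (intro integral_mono) auto
      also have "\<dots> = 2 / pi * t * exp (- \<epsilon> * \<kappa>) * measure (\<mu> f) UNIV"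
        by (simp only: lebesgue_integral_const space_scalar_measure real_scaleR_def mult.commute)
      finally show "norm (LINT s|\<mu> f. norm (F (\<kappa>, s))) \<le> 2 / pi * t * exp (- \<epsilon> * \<kappa>) * measure (\<mu> f) UNIV"
        by simp
    qed
  qed
  have "(LINT \<kappa>|half_line. weight t \<epsilon> \<kappa> * integral\<^sup>L (\<mu> f) (\<lambda>s. 1 / (\<bar>s\<bar> + \<kappa>\<^sup>2))) =
      (LINT \<kappa>|half_line. LINT s|\<mu> f. F (\<kappa>, s))"
    by (simp add: F_def integral_mult_right_zero[symmetric] del: integral_mult_right_zero)
  also have "\<dots> = (LINT s|\<mu> f. LINT \<kappa>|half_line. F (\<kappa>, s))"
    using P.Fubini_integral[of "\<lambda>\<kappa> s. F (\<kappa>, s)"] iF by (simp add: case_prod_beta')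
  finally show "(LINT \<kappa>|half_line. weight t \<epsilon> \<kappa> * integral\<^sup>L (\<mu> f) (\<lambda>s. 1 / (\<bar>s\<bar> + \<kappa>\<^sup>2))) =
      integral\<^sup>L (\<mu> f) (\<lambda>s. regularized_exp t \<epsilon> \<bar>s\<bar>)"
    by (simp add: F_def regularized_exp_def)
  have "(\<lambda>s. LINT \<kappa>|half_line. F (\<kappa>, s)) \<in> borel_measurable (\<mu> f)"
    using P.integrable_snd[of "\<lambda>\<kappa> s. F (\<kappa>, s)"] iF by (auto simp: case_prod_beta')
  then show "(\<lambda>s. regularized_exp t \<epsilon> \<bar>s\<bar>) \<in> borel_measurable (\<mu> f)"
    by (simp add: F_def regularized_exp_def)
qed

text \<open>The identity \<open>resolvent_form\<close> is integrated against the weight. As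
  \<epsilon> = 1 / (n + 1) tends to 0, the spectral side is dominated by 1, while the kernel side
  converges by \<open>star_form_tendsto\<close>.\<close>

lemma exp_sqrt_form:
  assumes t: "t > 0" and f: "f \<in> L2"
  shows "integral\<^sup>L (\<mu> f) (\<lambda>s. exp (- t * sqrt s)) = Re (star_form (cylinder_a t) (cylinder_b N \<alpha> t) f f)"
proof -
  interpret mu: finite_measure "\<mu> f" using f by (rule finite_scalar_measure)
  have reg: "integral\<^sup>L (\<mu> f) (\<lambda>s. regularized_exp t \<epsilon> \<bar>s\<bar>) =
      Re (star_form (\<lambda>r. cylinder_a t (r + \<epsilon>)) (\<lambda>r. cylinder_b N \<alpha> t (r + \<epsilon>)) f f)" if \<epsilon>: "\<epsilon> > 0" for \<epsilon>
  proof -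
    note W = weight_star_form[OF t \<epsilon> \<alpha> N_ge_1 f]
    have "integral\<^sup>L (\<mu> f) (\<lambda>s. regularized_exp t \<epsilon> \<bar>s\<bar>) =
        (LINT \<kappa>|half_line. Re (of_real (weight t \<epsilon> \<kappa>) * star_form (resolvent_a \<kappa>) (resolvent_b N \<alpha> \<kappa>) f f))"
      unfolding weight_fubini(1)[OF t \<epsilon> f, symmetric]
      by (intro Bochner_Integration.integral_cong refl) (simp add: resolvent_form f)
    also have "\<dots> = Re (LINT \<kappa>|half_line. of_real (weight t \<epsilon> \<kappa>) * star_form (resolvent_a \<kappa>) (resolvent_b N \<alpha> \<kappa>) f f)"
      by (rule integral_Re[OF W(2)])
    finally show ?thesis unfolding W(1) .
  qed
  have "(\<lambda>n. integral\<^sup>L (\<mu> f) (\<lambda>s. regularized_exp t (1 / Suc n) \<bar>s\<bar>)) \<longlonglongrightarrow> integral\<^sup>L (\<mu> f) (\<lambda>s. exp (- t * sqrt \<bar>s\<bar>))"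
  proof (rule integral_dominated_convergence[where w="\<lambda>_. 1"])
    show "AE s in \<mu> f. (\<lambda>n. regularized_exp t (1 / Suc n) \<bar>s\<bar>) \<longlonglongrightarrow> exp (- t * sqrt \<bar>s\<bar>)"
    proof (rule AE_I2)
      show "(\<lambda>n. regularized_exp t (1 / Suc n) \<bar>s\<bar>) \<longlonglongrightarrow> exp (- t * sqrt \<bar>s\<bar>)" for s
        using regularized_exp_tendsto[OF t, of "sqrt \<bar>s\<bar>"] by (simp del: of_nat_Suc)
    qed
    show "AE s in \<mu> f. norm (regularized_exp t (1 / Suc n) \<bar>s\<bar>) \<le> 1" for n
    proof (rule AE_I2)
      show "norm (regularized_exp t (1 / Suc n) \<bar>s\<bar>) \<le> 1" for s
        using abs_regularized_exp_le[OF t, of "1 / Suc n" "sqrt \<bar>s\<bar>"] by (simp del: of_nat_Suc)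
    qed
    show "(\<lambda>s. regularized_exp t (1 / Suc n) \<bar>s\<bar>) \<in> borel_measurable (\<mu> f)" for n
      by (intro weight_fubini(2) t f) simp
  qed auto
  moreover have "(\<lambda>n. integral\<^sup>L (\<mu> f) (\<lambda>s. regularized_exp t (1 / Suc n) \<bar>s\<bar>)) \<longlonglongrightarrow>
      Re (star_form (cylinder_a t) (cylinder_b N \<alpha> t) f f)"
    using tendsto_Re[OF star_form_tendsto[OF t \<alpha> N_ge_1 f]] by (simp add: reg del: of_nat_Suc)
  ultimately have "integral\<^sup>L (\<mu> f) (\<lambda>s. exp (- t * sqrt \<bar>s\<bar>)) = Re (star_form (cylinder_a t) (cylinder_b N \<alpha> t) f f)"
    by (rule LIMSEQ_unique)
  \<comment> \<open>\<open>sqrt\<close> is odd, so both integrands differ on the negative axis,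
    which is \<mu> f-null.\<close>
  moreover have "integral\<^sup>L (\<mu> f) (\<lambda>s. exp (- t * sqrt s)) = integral\<^sup>L (\<mu> f) (\<lambda>s. exp (- t * sqrt \<bar>s\<bar>))"
  proof (rule integral_cong_AE)
    show "AE s in \<mu> f. exp (- t * sqrt s) = exp (- t * sqrt \<bar>s\<bar>)"
      using AE_scalar_nonneg[OF f] by eventually_elim simp
  qed auto
  ultimately show ?thesis by simp
qed

text \<open>For s \<ge> 0 the function is at most 1. For s < 0 it would grow, since
  \<open>sqrt\<close> is odd, and this is where the absence of negative spectrum enters.\<close>

lemma spectral_domain_exp_sqrt:
  assumes t: "t > 0"
  shows "spectral_domain E (\<lambda>s. exp (- t * sqrt s)) = L2"
proof -
  have "integrable (\<mu> f) (\<lambda>s. (exp (- t * sqrt s))\<^sup>2)" if f: "f \<in> L2" for f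
  proof -
    interpret mu: finite_measure "\<mu> f" using f by (rule finite_scalar_measure)
    show ?thesis
    proof (rule mu.integrable_const_bound[where B=1])
      show "AE s in \<mu> f. norm ((exp (- t * sqrt s))\<^sup>2) \<le> 1"
        using AE_scalar_nonneg[OF f] by eventually_elim (use t in \<open>auto intro!: power_le_one\<close>)
    qed simp
  qed
  then show ?thesis by (auto simp: spectral_domain_def)
qed

text \<open>The quadratic forms agree by \<open>exp_sqrt_form\<close>, the kernel one being real by
  symmetry. Polarization, which defines \<open>spectral_form\<close>, then recovers the sesquilinear
  form.\<close>

lemma spectral_form_exp_sqrt:
  assumes t: "t > 0" and h: "h \<in> L2" and f: "f \<in> L2"
  shows "spectral_form E (\<lambda>s. exp (- t * sqrt s)) h f = l2_inner h (T t f)"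
proof -
  interpret star_kernel_bound "cylinder_a t" "cylinder_b N \<alpha> t" "\<lambda>r. 5 / pi * poisson t r"
    by (rule T_bound[OF t])
  let ?S = "star_form (cylinder_a t) (cylinder_b N \<alpha> t) :: 'n wave \<Rightarrow> _"
  have q: "of_real (integral\<^sup>L (\<mu> (\<lambda>j x. h j x + c * f j x)) (\<lambda>s. exp (- t * sqrt s))) =
      ?S h h + cnj c * ?S f h + c * ?S h f + c * cnj c * ?S f f" for c
  proof -
    let ?w = "\<lambda>j x. h j x + c * f j x"
    have w: "?w \<in> L2" by (intro add_L2 scale_L2 h f)
    have "?S ?w ?w \<in> \<real>" using star_form_cnj[OF w w] by (simp add: Reals_cnj_iff)
    then have "of_real (integral\<^sup>L (\<mu> ?w) (\<lambda>s. exp (- t * sqrt s))) = ?S ?w ?w"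
      unfolding exp_sqrt_form[OF t w] by (rule of_real_Re)
    also have "\<dots> = ?S ?w h + c * ?S ?w f" by (rule star_form_add_right[OF w h f])
    also have "?S ?w h = cnj (?S h h + c * ?S h f)"
      unfolding star_form_add_right[OF h h f, symmetric] by (rule star_form_cnj[OF h w, symmetric])
    also have "?S ?w f = cnj (?S f h + c * ?S f f)"
      unfolding star_form_add_right[OF f h f, symmetric] by (rule star_form_cnj[OF f w, symmetric])
    finally show ?thesis
      by (simp add: star_form_cnj h f algebra_simps)
  qed
  have "spectral_form E (\<lambda>s. exp (- t * sqrt s)) h f = ?S h f"
    unfolding spectral_form_def q by (simp add: lessThan_nat_numeral eval_nat_numeral algebra_simps)
  then show ?thesis by (simp add: l2_inner_star_op h f)
qed

lemma cylinder_operator_iff: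
  assumes t: "t > 0"
  shows "(f, g) \<in> cylinder_operator E t \<longleftrightarrow> f \<in> L2 \<and> g \<in> L2 \<and> l2_eq g (T t f)"
proof -
  note TL = star_kernel_bound.star_op_L2[OF T_bound[OF t]]
  have "(\<forall>h\<in>L2. l2_inner h g = l2_inner h (T t f)) \<longleftrightarrow> l2_eq g (T t f)" if "f \<in> L2" "g \<in> L2"
    using that TL l2_eqI[of g "T t f"] l2_inner_eq_if_l2_eq[of g "T t f"] by blast
  then show ?thesis
    unfolding cylinder_operator_def spectral_integral_def spectral_domain_exp_sqrt[OF t]
    using spectral_form_exp_sqrt[OF t] by auto
qed

section \<open>The cylinder kernel\<close>

definition G\<^sub>0 :: "real \<Rightarrow> 'n \<Rightarrow> 'n \<Rightarrow> real \<Rightarrow> real \<Rightarrow> complex" where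
  "G\<^sub>0 t j l x y = of_real (star_kernel (cylinder_a t) (cylinder_b N \<alpha> t) j l x y)"

lemma continuous_G\<^sub>0: "t > 0 \<Longrightarrow> continuous_on UNIV (\<lambda>(x, y). G\<^sub>0 t j l x y)"
proof -
  assume t: "t > 0"
  have a: "continuous_on UNIV (cylinder_a t)" and b: "continuous_on UNIV (cylinder_b N \<alpha> t)"
    using isCont_cylinder_a[OF t] isCont_cylinder_b[OF t \<alpha>] by (auto intro!: continuous_at_imp_continuous_on)
  show ?thesis
    unfolding G\<^sub>0_def star_kernel_def case_prod_beta'
    by (cases "j = l")
      (auto intro!: continuous_intros continuous_on_compose2[OF a] continuous_on_compose2[OF b])
qed

lemma AE_G\<^sub>0_integrable:
  assumes t: "t > 0" and f: "f \<in> L2"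
  shows "AE x in half_line. \<forall>l. integrable half_line (\<lambda>y. G\<^sub>0 t j l x y * f l y)"
proof -
  have "AE x in half_line. \<forall>l\<in>UNIV. integrable half_line (\<lambda>y. G\<^sub>0 t j l x y * f l y)"
    unfolding G\<^sub>0_def
    by (intro AE_finite_allI finite_class.finite_UNIV
        kernel_bound.AE_kernel_integrable[OF star_kernel_bound.kernel_bound[OF T_bound[OF t]] L2_D[OF f]])
  then show ?thesis by simp
qed

lemma G\<^sub>0_is_cylinder_kernel: "is_cylinder_kernel E G\<^sub>0"
  unfolding is_cylinder_kernel_def
proof (intro allI impI conjI ballI)
  fix t :: real and j l :: 'n assume t: "t > 0"
  show "continuous_on ({0<..} \<times> {0<..}) (\<lambda>(x, y). G\<^sub>0 t j l x y)"
    using continuous_G\<^sub>0[OF t] by (rule continuous_on_subset) simp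
next
  fix t :: real and fg :: "'n wave \<times> 'n wave" assume t: "t > 0" and fg: "fg \<in> cylinder_operator E t"
  obtain f g where [simp]: "fg = (f, g)" by (cases fg)
  have f: "f \<in> L2" and eq: "l2_eq g (T t f)" using fg cylinder_operator_iff[OF t] by auto
  have "AE x in half_line. (\<forall>l. integrable half_line (\<lambda>y. G\<^sub>0 t j l x y * f l y)) \<and>
      g j x = (\<Sum>l\<in>UNIV. LINT y|half_line. G\<^sub>0 t j l x y * f l y)" for j
  proof -
    have "AE x in half_line. g j x = T t f j x" using eq by (simp add: l2_eq_def)
    then show ?thesis using AE_G\<^sub>0_integrable[OF t f, of j]
      by eventually_elim (simp add: star_op_def G\<^sub>0_def)
  qed
  then show "case fg of (f, g) \<Rightarrow> \<forall>j. AE x in half_line. (\<forall>l. integrable half_line (\<lambda>y. G\<^sub>0 t j l x y * f l y)) \<and>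
      g j x = (\<Sum>l\<in>UNIV. LINT y|half_line. G\<^sub>0 t j l x y * f l y)" by simp
qed

text \<open>Two kernels of one operator integrate equally against each test vector for almost every
  x. If their difference D had a value c \<noteq> 0 at a point, continuity would keep D within |c| /
  2 of c on a rectangle; testing with the indicator of its y-side then forces the open x-side to be
  a null set.\<close>

lemma cylinder_kernel_unique:
  assumes G: "is_cylinder_kernel E G" and t: "t > 0" and xy: "x\<^sub>0 > 0" "y\<^sub>0 > 0"
  shows "G t j l x\<^sub>0 y\<^sub>0 = G\<^sub>0 t j l x\<^sub>0 y\<^sub>0"
proof (rule ccontr)
  define D where "D = (\<lambda>(x, y). G t j l x y - G\<^sub>0 t j l x y)"
  define c where "c = D (x\<^sub>0, y\<^sub>0)"
  assume "G t j l x\<^sub>0 y\<^sub>0 \<noteq> G\<^sub>0 t j l x\<^sub>0 y\<^sub>0"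
  then have c: "cmod c > 0" by (simp add: c_def D_def)
  have "continuous_on ({0<..} \<times> {0<..}) (\<lambda>p. (case p of (x, y) \<Rightarrow> G t j l x y) - (case p of (x, y) \<Rightarrow> G\<^sub>0 t j l x y))"
    using G t continuous_on_subset[OF continuous_G\<^sub>0[OF t]]
    by (intro continuous_on_diff) (auto simp: is_cylinder_kernel_def)
  then have "continuous_on ({0<..} \<times> {0<..}) D"
    by (simp add: D_def case_prod_beta')
  moreover have "(x\<^sub>0, y\<^sub>0) \<in> {0<..} \<times> {0<..}" using xy by simp
  ultimately obtain \<delta> where \<delta>: "\<delta> > 0"
    "\<And>p. p \<in> {0<..} \<times> {0<..} \<Longrightarrow> dist p (x\<^sub>0, y\<^sub>0) < \<delta> \<Longrightarrow> dist (D p) c < cmod c / 2"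
    unfolding continuous_on_iff c_def using c by (metis c_def half_gt_zero)
  \<comment> \<open>d \<le> \<delta> / 3 keeps the sum of both coordinate distances below \<delta>;
    the halves of the coordinates keep the rectangle inside the open quadrant.\<close>
  define d where "d = min (\<delta> / 3) (min (x\<^sub>0 / 2) (y\<^sub>0 / 2))"
  have d: "d > 0" "d \<le> \<delta> / 3" "d < x\<^sub>0" "d < y\<^sub>0" using \<delta> xy by (auto simp: d_def)
  have near: "cmod (D (x, y) - c) \<le> cmod c / 2" if "x \<in> {x\<^sub>0 - d<..<x\<^sub>0 + d}" "y \<in> {y\<^sub>0 - d..y\<^sub>0 + d}" for x y
  proof -
    have "dist (x, y) (x\<^sub>0, y\<^sub>0) \<le> \<bar>x - x\<^sub>0\<bar> + \<bar>y - y\<^sub>0\<bar>"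
      using sqrt_sum_squares_le_sum_abs[of "x - x\<^sub>0" "y - y\<^sub>0"] by (simp add: dist_Pair_Pair dist_real_def)
    also have "\<dots> < \<delta>" using that d by (auto simp: abs_if)
    finally show ?thesis using \<delta>(2)[of "(x, y)"] that d by (simp add: dist_norm)
  qed
  let ?I = "\<lambda>y. complex_of_real (indicator {y\<^sub>0 - d..y\<^sub>0 + d} y)"
  define f where "f = (\<lambda>l' y. if l' = l then ?I y else 0)"
  have ind: "integrable half_line (indicator {y\<^sub>0 - d..y\<^sub>0 + d} :: real \<Rightarrow> real)"
    "(LINT y|half_line. indicator {y\<^sub>0 - d..y\<^sub>0 + d} y :: real) = 2 * d"
  proof -
    have eq: "(\<lambda>y. indicator {0<..} y *\<^sub>R indicator {y\<^sub>0 - d..y\<^sub>0 + d} y) = (indicator {y\<^sub>0 - d..y\<^sub>0 + d} :: real \<Rightarrow> real)"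
      using d by (auto simp: indicator_def fun_eq_iff)
    have i: "integrable lborel (indicator {y\<^sub>0 - d..y\<^sub>0 + d} :: real \<Rightarrow> real)"
      by (intro integrable_real_indicator) (auto simp: emeasure_lborel_Icc_eq)
    show "integrable half_line (indicator {y\<^sub>0 - d..y\<^sub>0 + d} :: real \<Rightarrow> real)"
      using i by (subst integrable_restrict_space) (auto simp: eq simp del: real_scaleR_def)
    show "(LINT y|half_line. indicator {y\<^sub>0 - d..y\<^sub>0 + d} y :: real) = 2 * d"
      using d by (subst integral_restrict_space) (auto simp: eq simp del: real_scaleR_def)
  qed
  have IL: "?I \<in> L2_half_line"
  proof (rule L2_half_lineI)
    have "(\<lambda>y. (cmod (?I y))\<^sup>2) = indicator {y\<^sub>0 - d..y\<^sub>0 + d}" by (auto simp: indicator_def)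
    then show "integrable half_line (\<lambda>y. (cmod (?I y))\<^sup>2)" using ind(1) by simp
  qed (rule half_line_measurable, measurable)
  have "f l' \<in> L2_half_line" for l'
    using IL zero_L2[THEN L2_D] by (cases "l' = l") (simp_all add: f_def)
  then have f: "f \<in> L2" by (simp add: L2_def)
  have "(f, T t f) \<in> cylinder_operator E t"
    using f star_kernel_bound.star_op_L2[OF T_bound[OF t] f] by (simp add: cylinder_operator_iff[OF t] l2_eq_def)
  then have K: "AE x in half_line. (\<forall>l'. integrable half_line (\<lambda>y. K t j l' x y * f l' y)) \<and>
      T t f j x = (\<Sum>l'\<in>UNIV. LINT y|half_line. K t j l' x y * f l' y)" if "is_cylinder_kernel E K" for K
    using that t unfolding is_cylinder_kernel_def by blast
  have s: "(\<Sum>l'\<in>UNIV. LINT y|half_line. K l' y * f l' y) = (LINT y|half_line. K l y * ?I y)" for K :: "'n \<Rightarrow> real \<Rightarrow> complex"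
  proof -
    have "(\<Sum>l'\<in>UNIV. LINT y|half_line. K l' y * f l' y) = (\<Sum>l'\<in>UNIV. if l' = l then LINT y|half_line. K l y * ?I y else 0)"
      by (intro sum.cong refl) (auto simp: f_def)
    then show ?thesis by simp
  qed
  \<comment> \<open>For such an x the integral of D over the y-side is 0, yet it differs from 2 d c
    by at most d |c|: a contradiction.\<close>
  have "AE x in half_line. x \<notin> {x\<^sub>0 - d<..<x\<^sub>0 + d}"
    using K[OF G] K[OF G\<^sub>0_is_cylinder_kernel]
  proof eventually_elim
    case (elim x)
    show ?case
    proof
      assume x: "x \<in> {x\<^sub>0 - d<..<x\<^sub>0 + d}"
      have i: "integrable half_line (\<lambda>y. G t j l x y * ?I y)" "integrable half_line (\<lambda>y. G\<^sub>0 t j l x y * ?I y)"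
        using elim by (auto simp: f_def dest!: spec[of _ l])
      have eq: "(LINT y|half_line. G t j l x y * ?I y) = (LINT y|half_line. G\<^sub>0 t j l x y * ?I y)"
        using elim unfolding s by simp
      have iD: "integrable half_line (\<lambda>y. D (x, y) * ?I y)" and D0: "(LINT y|half_line. D (x, y) * ?I y) = 0"
        using i eq by (simp_all add: D_def left_diff_distrib)
      have ic: "integrable half_line (\<lambda>y. c * ?I y)" "(LINT y|half_line. c * ?I y) = c * of_real (2 * d)"
        using ind by (simp_all only: integral_mult_right_zero integral_complex_of_real integrable_mult_right integrable_of_real)
      have "cmod (c * of_real (2 * d)) = cmod ((LINT y|half_line. D (x, y) * ?I y) - (LINT y|half_line. c * ?I y))"
        unfolding D0 ic(2) by (simp add: norm_minus_cancel)
      also have "\<dots> = cmod (LINT y|half_line. D (x, y) * ?I y - c * ?I y)"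
        using iD ic(1) by simp
      also have "\<dots> \<le> (LINT y|half_line. cmod c / 2 * indicator {y\<^sub>0 - d..y\<^sub>0 + d} y)"
      proof (intro order.trans[OF integral_norm_bound] integral_mono)
        show "integrable half_line (\<lambda>y. norm (D (x, y) * ?I y - c * ?I y))"
          using iD ic(1) by auto
        show "integrable half_line (\<lambda>y. cmod c / 2 * indicator {y\<^sub>0 - d..y\<^sub>0 + d} y)"
          using ind(1) by simp
        show "norm (D (x, y) * ?I y - c * ?I y) \<le> cmod c / 2 * indicator {y\<^sub>0 - d..y\<^sub>0 + d} y" for y
          using near[OF x, of y] by (auto simp: indicator_def)
      qed
      also have "\<dots> = cmod c / 2 * (2 * d)"
        unfolding integral_mult_right_zero ind(2) ..
      finally have "cmod c * (2 * d) \<le> cmod c / 2 * (2 * d)"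
        unfolding norm_mult[of c] norm_of_real using d by simp
      moreover have "0 < cmod c * d" by (rule mult_pos_pos[OF c d(1)])
      ultimately show False by linarith
    qed
  qed
  then have "AE x in lborel. x \<notin> {x\<^sub>0 - d<..<x\<^sub>0 + d}"
    using d by (subst (asm) AE_restrict_space_iff) (auto elim!: AE_mp)
  then have "emeasure lborel {x\<^sub>0 - d<..<x\<^sub>0 + d} = 0"
  proof (rule iffD1[OF AE_iff_measurable, rotated 2])
    show "{x \<in> space lborel. \<not> x \<notin> {x\<^sub>0 - d<..<x\<^sub>0 + d}} = {x\<^sub>0 - d<..<x\<^sub>0 + d}" by auto
  qed simp
  then show False using d by simp
qed

text \<open>\<open>SOME\<close> may return any continuous kernel; one exists, and all of them agree
  at positive arguments.\<close>

lemma cylinder_kernel_eq: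
  assumes "t > 0" "x > 0" "y > 0"
  shows "cylinder_kernel E t j l x y = G\<^sub>0 t j l x y"
  unfolding cylinder_kernel_def
  by (rule cylinder_kernel_unique[OF someI[of "is_cylinder_kernel E", OF G\<^sub>0_is_cylinder_kernel] assms])

end

section \<open>Asymptotic expansions\<close>

lemma powi_smallo:
  assumes "k > (M::int)"
  shows "(\<lambda>t. complex_of_real (t powi k)) \<in> o[at_right 0](\<lambda>t. of_real (t powi M))"
proof (rule landau_o.smallI)
  fix c :: real assume c: "c > 0"
  have "\<forall>\<^sub>F t in at_right (0::real). t \<in> {0<..<min 1 c}"
    using c by (intro eventually_at_right_real) auto
  then show "\<forall>\<^sub>F t in at_right 0. norm (complex_of_real (t powi k)) \<le> c * norm (complex_of_real (t powi M))"
  proof eventually_elim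
    case (elim t)
    then have t: "0 < t" "t < 1" "t < c" by auto
    have "k = M + int (nat (k - M))" using assms by simp
    then have "t powi k = t powi M * t ^ nat (k - M)"
      using t by (metis less_irrefl power_int_add power_int_of_nat)
    also have "\<dots> \<le> t powi M * t"
    proof (rule mult_left_mono)
      show "t ^ nat (k - M) \<le> t"
        using t assms power_decreasing[of 1 "nat (k - M)" t] by simp
    qed (use t in \<open>simp add: less_imp_le\<close>)
    also have "\<dots> \<le> t powi M * c"
      using t by (intro mult_left_mono) (simp_all add: less_imp_le)
    finally show ?case using t by (simp add: norm_power_int mult.commute)
  qed
qed

text \<open>At the smallest exponent where the coefficients differ, subtracting the expansions would
  make a nonzero multiple of a power of t little-o of that same power. Starting at the smaller of
  the two initial exponents makes the induction well-founded.\<close>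

lemma asymptotic_expansion_unique:
  assumes "has_asymptotic_expansion F a" "has_asymptotic_expansion F b"
  shows "a = b"
proof
  obtain ma where ma: "\<And>k. k < ma \<Longrightarrow> a k = 0"
    "\<And>M. (\<lambda>t. F t - (\<Sum>k=ma..M. a k * of_real (t powi k))) \<in> o[at_right 0](\<lambda>t. of_real (t powi M))"
    using assms(1) by (auto simp: has_asymptotic_expansion_def)
  obtain mb where mb: "\<And>k. k < mb \<Longrightarrow> b k = 0"
    "\<And>M. (\<lambda>t. F t - (\<Sum>k=mb..M. b k * of_real (t powi k))) \<in> o[at_right 0](\<lambda>t. of_real (t powi M))"
    using assms(2) by (auto simp: has_asymptotic_expansion_def)
  define m where "m = min ma mb"
  have "(\<lambda>t. (\<Sum>k=m..M. (a k - b k) * of_real (t powi k))) \<in> o[at_right 0](\<lambda>t. of_real (t powi M))" for M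
  proof -
    have "(\<Sum>k=ma..M. a k * of_real (t powi k)) = (\<Sum>k=m..M. a k * of_real (t powi k))" for t :: real
      using ma(1) by (intro sum.mono_neutral_left) (auto simp: m_def)
    moreover have "(\<Sum>k=mb..M. b k * of_real (t powi k)) = (\<Sum>k=m..M. b k * of_real (t powi k))" for t :: real
      using mb(1) by (intro sum.mono_neutral_left) (auto simp: m_def)
    ultimately show ?thesis
      using sum_in_smallo(2)[OF mb(2)[of M] ma(2)[of M]] by (simp add: left_diff_distrib sum_subtractf)
  qed
  note diff = this
  have eq: "a (m + int n) = b (m + int n)" for n
  proof (induction n rule: less_induct)
    case (less n)
    let ?M = "m + int n"
    have "a k = b k" if "m \<le> k" "k < ?M" for k
      using less.IH[of "nat (k - m)"] that by auto
    then have "(\<Sum>k=m..?M. (a k - b k) * of_real (t powi k)) = (a ?M - b ?M) * of_real (t powi ?M)" for t :: real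
      by (subst sum.mono_neutral_right[where S="{?M}"]) auto
    then have small: "(\<lambda>t. (a ?M - b ?M) * of_real (t powi ?M)) \<in> o[at_right 0](\<lambda>t. complex_of_real (t powi ?M))"
      using diff[of ?M] by simp
    show ?case
    proof (rule ccontr)
      assume ne: "a ?M \<noteq> b ?M"
      have "\<forall>\<^sub>F t in at_right 0. norm ((a ?M - b ?M) * of_real (t powi ?M)) \<le>
          cmod (a ?M - b ?M) / 2 * norm (complex_of_real (t powi ?M))"
        using ne by (intro landau_o.smallD[OF small]) simp
      moreover have "\<forall>\<^sub>F t in at_right (0::real). t \<in> {0<..<1}"
        by (intro eventually_at_right_real) auto
      ultimately have "\<forall>\<^sub>F t in at_right (0::real). False"
      proof eventually_elim
        case (elim t)
        have "0 < norm (complex_of_real (t powi ?M))" using elim(2) by simp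
        then show ?case using elim(1) ne by (simp add: norm_mult)
      qed
      then show False by (simp add: trivial_limit_at_right_real)
    qed
  qed
  fix k show "a k = b k"
  proof (cases "k < m")
    case True
    then show ?thesis using ma(1) mb(1) by (simp add: m_def)
  next
    case False
    then show ?thesis using eq[of "nat (k - m)"] by simp
  qed
qed

lemma asymptotic_coeff_eq:
  assumes "has_asymptotic_expansion F a"
  shows "asymptotic_coeff F k = a k"
  unfolding asymptotic_coeff_def
  by (rule the_equality) (use assms asymptotic_expansion_unique in blast)+

text \<open>Coefficients of c0 / t + (sum over m of c m t^(2 m + 1)): for odd k \<ge> 0,
  \<open>nat k div 2\<close> is the m with k = 2 m + 1.\<close>

definition odd_coeff :: "complex \<Rightarrow> (nat \<Rightarrow> real) \<Rightarrow> int \<Rightarrow> complex" where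
  "odd_coeff c0 c k = (if k = -1 then c0 else if k \<ge> 0 \<and> odd k then of_real (c (nat k div 2)) else 0)"

lemma powi_odd: "(t::'a::division_ring) powi (2 * int n + 1) = t ^ (2 * n + 1)"
proof -
  have "2 * int n + 1 = int (2 * n + 1)" by simp
  then show ?thesis by (simp only: power_int_of_nat)
qed

text \<open>Remainder bounds at odd orders suffice: one truncates beyond M and discards the finitely
  many surplus terms, each of which is o(t^M).\<close>

lemma odd_expansion:
  assumes "\<And>n. \<exists>C. \<forall>t>0. cmod (F t - (c0 / of_real t + (\<Sum>m<n. of_real (c m * t ^ (2 * m + 1))))) \<le> C * t ^ (2 * n + 1)"
  shows "has_asymptotic_expansion F (odd_coeff c0 c)"
  unfolding has_asymptotic_expansion_def
proof (intro exI[of _ "-1"] conjI allI impI)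
  show "odd_coeff c0 c k = 0" if "k < -1" for k
    using that by (simp add: odd_coeff_def)
  fix M :: int
  \<comment> \<open>This n gives M \<le> 2 n - 1 and M < 2 n + 1 for every integer M; for M \<le> -2
    it is 0 and only the term c0 / t is kept.\<close>
  define n where "n = nat (M + 2)"
  define L where "L = 2 * int n - 1"
  have L: "M \<le> L" "M < 2 * int n + 1" "-1 \<le> L" by (auto simp: L_def n_def)
  have full: "(\<Sum>k=-1..2 * int n - 1. odd_coeff c0 c k * of_real (t powi k)) =
      c0 / of_real t + (\<Sum>m<n. of_real (c m * t ^ (2 * m + 1)))" if "t > 0" for n t
  proof (induction n)
    case 0
    have "{-1..2 * int 0 - 1} = {-1}" by auto
    then show ?case by (simp add: odd_coeff_def power_int_minus divide_inverse)
  next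
    case (Suc n)
    have set: "{-1..2 * int (Suc n) - 1} = insert (2 * int n + 1) (insert (2 * int n) {-1..2 * int n - 1})"
      by auto
    have "odd_coeff c0 c (2 * int n + 1) = of_real (c n)"
      by (simp add: odd_coeff_def nat_add_distrib nat_mult_distrib)
    moreover have "odd_coeff c0 c (2 * int n) = 0" by (simp add: odd_coeff_def)
    ultimately show ?case using Suc unfolding set by (simp add: powi_odd)
  qed
  obtain C where C: "\<And>t. t > 0 \<Longrightarrow>
      cmod (F t - (c0 / of_real t + (\<Sum>m<n. of_real (c m * t ^ (2 * m + 1))))) \<le> C * t ^ (2 * n + 1)"
    using assms by blast
  have pos: "\<forall>\<^sub>F t in at_right (0::real). t > 0" by (simp add: eventually_at_filter)
  have "(\<lambda>t. F t - (\<Sum>k=-1..L. odd_coeff c0 c k * of_real (t powi k))) \<in> O[at_right 0](\<lambda>t. of_real (t powi (2 * int n + 1)))"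
  proof (rule bigoI)
    show "\<forall>\<^sub>F t in at_right 0. norm (F t - (\<Sum>k=-1..L. odd_coeff c0 c k * of_real (t powi k))) \<le>
        C * norm (complex_of_real (t powi (2 * int n + 1)))"
      using pos
    proof eventually_elim
      case (elim t)
      show ?case using C[OF elim] elim unfolding L_def full[OF elim] powi_odd
        by (simp add: norm_mult norm_power)
    qed
  qed
  also have "(\<lambda>t. complex_of_real (t powi (2 * int n + 1))) \<in> o[at_right 0](\<lambda>t. of_real (t powi M))"
    by (rule powi_smallo[OF L(2)])
  finally have 1: "(\<lambda>t. F t - (\<Sum>k=-1..L. odd_coeff c0 c k * of_real (t powi k))) \<in> o[at_right 0](\<lambda>t. of_real (t powi M))" .
  have "(\<lambda>t. \<Sum>k\<in>{-1..L} - {-1..M}. odd_coeff c0 c k * of_real (t powi k)) \<in> o[at_right 0](\<lambda>t. complex_of_real (t powi M))"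
  proof (rule big_sum_in_smallo)
    fix k assume "k \<in> {-1..L} - {-1..M}"
    then have "k > M" by auto
    from powi_smallo[OF this]
    show "(\<lambda>t. odd_coeff c0 c k * of_real (t powi k)) \<in> o[at_right 0](\<lambda>t. complex_of_real (t powi M))"
      by (cases "odd_coeff c0 c k = 0") simp_all
  qed
  from sum_in_smallo(1)[OF 1 this]
  have "(\<lambda>t. F t - (\<Sum>k=-1..L. odd_coeff c0 c k * of_real (t powi k))
      + (\<Sum>k\<in>{-1..L} - {-1..M}. odd_coeff c0 c k * of_real (t powi k))) \<in> o[at_right 0](\<lambda>t. complex_of_real (t powi M))" .
  moreover have "(\<Sum>k=-1..L. odd_coeff c0 c k * of_real (t powi k)) =
      (\<Sum>k\<in>{-1..L} - {-1..M}. odd_coeff c0 c k * of_real (t powi k)) + (\<Sum>k=-1..M. odd_coeff c0 c k * of_real (t powi k))" for t :: real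
    using L(1) by (intro sum.subset_diff) auto
  ultimately show "(\<lambda>t. F t - (\<Sum>k=-1..M. odd_coeff c0 c k * of_real (t powi k))) \<in> o[at_right 0](\<lambda>t. complex_of_real (t powi M))"
    by (simp add: algebra_simps)
qed

section \<open>Expansion of the Poisson kernels and of the diagonal\<close>

text \<open>A geometric series in - (t / r)^2 with its exact remainder. Keeping 1 / (t^2 + r^2) in
  the remainder makes the estimate valid for every t > 0, not only for t < r.\<close>

lemma poisson_expansion:
  assumes "t > 0" "r > 0"
  shows "poisson t r - (\<Sum>m<n. (-1) ^ m * t ^ (2 * m + 1) / r ^ (2 * m + 2)) =
    (-1) ^ n * t ^ (2 * n + 1) / (r ^ (2 * n) * (t\<^sup>2 + r\<^sup>2))"
proof (induction n)
  case 0
  then show ?case by (simp add: poisson_def)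
next
  case (Suc n)
  have p: "t\<^sup>2 + r\<^sup>2 \<noteq> 0" "r ^ (2 * n) \<noteq> 0" "r \<noteq> 0" using poisson_denom_pos[OF assms(1), of r] assms by auto
  have "(-1) ^ n * t ^ (2 * n + 1) / (r ^ (2 * n) * (t\<^sup>2 + r\<^sup>2)) - (-1) ^ n * t ^ (2 * n + 1) / r ^ (2 * n + 2) =
    (-1) ^ Suc n * t ^ (2 * Suc n + 1) / (r ^ (2 * Suc n) * (t\<^sup>2 + r\<^sup>2))"
    using p by (simp add: divide_simps) (simp add: algebra_simps power2_eq_square)
  then show ?case using Suc by simp
qed

lemma poisson_expansion_bound:
  assumes "t > 0" "r > 0"
  shows "\<bar>poisson t r - (\<Sum>m<n. (-1) ^ m * t ^ (2 * m + 1) / r ^ (2 * m + 2))\<bar> \<le> t ^ (2 * n + 1) / r ^ (2 * n + 2)"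
proof -
  have "r ^ (2 * n + 2) = r ^ (2 * n) * r\<^sup>2" by (rule power_add)
  also have "\<dots> \<le> r ^ (2 * n) * (t\<^sup>2 + r\<^sup>2)" using assms by (intro mult_left_mono) auto
  finally have "t ^ (2 * n + 1) / (r ^ (2 * n) * (t\<^sup>2 + r\<^sup>2)) \<le> t ^ (2 * n + 1) / r ^ (2 * n + 2)"
    using assms by (intro divide_left_mono) (auto intro!: mult_pos_pos poisson_denom_pos)
  then show ?thesis
    unfolding poisson_expansion[OF assms] using assms poisson_denom_pos[OF assms(1), of r]
    by (simp add: abs_mult power_abs)
qed

definition tail_coeff :: "real \<Rightarrow> real \<Rightarrow> real \<Rightarrow> nat \<Rightarrow> real" where
  "tail_coeff N \<alpha> r k = (LINT q|half_line. exp (- \<alpha> * q) / (r + N * q) ^ k)"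

lemma tail_coeff_integrable:
  assumes "\<alpha> > 0" "N > 0" "r > 0"
  shows "integrable half_line (\<lambda>q. exp (- \<alpha> * q) / (r + N * q) ^ k)"
proof (rule half_line_integrable_bound[OF integrable_mult_left[OF half_line_exp(1)[OF assms(1)], of "1 / r ^ k"]])
  fix q :: real assume q: "q > 0"
  have "r ^ k \<le> (r + N * q) ^ k" using assms q by (intro power_mono) auto
  then have "exp (- \<alpha> * q) / (r + N * q) ^ k \<le> exp (- \<alpha> * q) / r ^ k"
    using assms q by (intro divide_left_mono) (auto intro!: mult_pos_pos zero_less_power add_pos_pos)
  moreover have "0 < r + N * q" using assms q by (simp add: add_pos_pos)
  ultimately show "norm (exp (- \<alpha> * q) / (r + N * q) ^ k) \<le> exp (- \<alpha> * q) * (1 / r ^ k)"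
    by simp
qed (auto intro!: half_line_measurable)

text \<open>The pointwise remainder at r + N q is bounded by the one at r, uniformly in q, and exp
  (- \<alpha> q) has integral 1 / \<alpha>. So the expansion may be integrated term by term.\<close>

lemma poisson_tail_expansion_bound:
  assumes "t > 0" "r > 0" "\<alpha> > 0" "N > 0"
  shows "\<bar>poisson_tail N \<alpha> t r - (\<Sum>m<n. (-1) ^ m * t ^ (2 * m + 1) * tail_coeff N \<alpha> r (2 * m + 2))\<bar>
    \<le> t ^ (2 * n + 1) / r ^ (2 * n + 2) / \<alpha>"
proof -
  let ?s = "\<lambda>m q. (-1) ^ m * t ^ (2 * m + 1) * (exp (- \<alpha> * q) / (r + N * q) ^ (2 * m + 2))"
  have i: "integrable half_line (?s m)" for m
    by (intro integrable_mult_right tail_coeff_integrable assms)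
  have iT: "integrable half_line (\<lambda>q. exp (- \<alpha> * q) * poisson t (r + N * q))"
    by (intro poisson_tail_integrable assms)
  have iS: "integrable half_line (\<lambda>q. \<Sum>m<n. ?s m q)" by (intro Bochner_Integration.integrable_sum i)
  have "(\<Sum>m<n. (-1) ^ m * t ^ (2 * m + 1) * tail_coeff N \<alpha> r (2 * m + 2)) = (LINT q|half_line. (\<Sum>m<n. ?s m q))"
    unfolding tail_coeff_def integral_mult_right_zero[symmetric]
    by (intro Bochner_Integration.integral_sum[symmetric] i)
  then have eq: "poisson_tail N \<alpha> t r - (\<Sum>m<n. (-1) ^ m * t ^ (2 * m + 1) * tail_coeff N \<alpha> r (2 * m + 2)) =
      (LINT q|half_line. exp (- \<alpha> * q) * poisson t (r + N * q) - (\<Sum>m<n. ?s m q))"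
    unfolding poisson_tail_def using iT iS by simp
  have "\<bar>LINT q|half_line. exp (- \<alpha> * q) * poisson t (r + N * q) - (\<Sum>m<n. ?s m q)\<bar> \<le>
      (LINT q|half_line. exp (- \<alpha> * q) * (t ^ (2 * n + 1) / r ^ (2 * n + 2)))"
  proof (intro order.trans[OF integral_abs_bound] integral_mono_AE AE_half_line_if_positive)
    show "integrable half_line (\<lambda>q. \<bar>exp (- \<alpha> * q) * poisson t (r + N * q) - (\<Sum>m<n. ?s m q)\<bar>)"
      using iT iS by (intro integrable_abs Bochner_Integration.integrable_diff)
    show "integrable half_line (\<lambda>q. exp (- \<alpha> * q) * (t ^ (2 * n + 1) / r ^ (2 * n + 2)))"
      by (intro integrable_mult_left half_line_exp(1) assms)
    fix q :: real assume q: "q > 0"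
    have r: "r \<le> r + N * q" "0 < r + N * q" using assms q by (auto intro: add_pos_pos)
    have eq': "exp (- \<alpha> * q) * poisson t (r + N * q) - (\<Sum>m<n. ?s m q) =
        exp (- \<alpha> * q) * (poisson t (r + N * q) - (\<Sum>m<n. (-1) ^ m * t ^ (2 * m + 1) / (r + N * q) ^ (2 * m + 2)))"
      unfolding right_diff_distrib sum_distrib_left
      by (intro arg_cong2[where f=minus] sum.cong refl) (simp only: times_divide_eq_right ac_simps)
    have "\<bar>exp (- \<alpha> * q) * poisson t (r + N * q) - (\<Sum>m<n. ?s m q)\<bar> = exp (- \<alpha> * q) * \<bar>poisson t (r + N * q) - (\<Sum>m<n. (-1) ^ m * t ^ (2 * m + 1) / (r + N * q) ^ (2 * m + 2))\<bar>"
      unfolding eq' by (simp only: abs_mult abs_exp_cancel)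
    also have "\<dots> \<le> exp (- \<alpha> * q) * (t ^ (2 * n + 1) / (r + N * q) ^ (2 * n + 2))"
      by (intro mult_left_mono poisson_expansion_bound assms r) simp
    also have "\<dots> \<le> exp (- \<alpha> * q) * (t ^ (2 * n + 1) / r ^ (2 * n + 2))"
      using assms r by (intro mult_left_mono divide_left_mono power_mono mult_pos_pos zero_less_power) auto
    finally show "\<bar>exp (- \<alpha> * q) * poisson t (r + N * q) - (\<Sum>m<n. ?s m q)\<bar> \<le> exp (- \<alpha> * q) * (t ^ (2 * n + 1) / r ^ (2 * n + 2))" .
  qed
  also have "\<dots> = 1 / \<alpha> * (t ^ (2 * n + 1) / r ^ (2 * n + 2))"
    unfolding integral_mult_left_zero half_line_exp(2)[OF assms(3)] ..
  also have "\<dots> = t ^ (2 * n + 1) / r ^ (2 * n + 2) / \<alpha>" by (simp add: mult.commute)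
  finally show ?thesis unfolding eq .
qed

text \<open>On the diagonal the direct path has length 0 and gives exactly 1 / (pi t), the universal
  divergence. The image term and the vertex term depend on r = 2 x > 0 and have odd
  expansions.\<close>

lemma diagonal_expansion:
  assumes "x > 0" "\<alpha> > 0" "N > 0"
  defines "c \<equiv> \<lambda>m. (-1) ^ m * (- 1 / (pi * (2 * x) ^ (2 * m + 2)) +
    2 / (N * pi) * (1 / (2 * x) ^ (2 * m + 2) - \<alpha> * tail_coeff N \<alpha> (2 * x) (2 * m + 2)))"
  shows "\<exists>C. \<forall>t>0. \<bar>cylinder_a t 0 - cylinder_a t (2 * x) + cylinder_b N \<alpha> t (2 * x) -
    (1 / pi / t + (\<Sum>m<n. c m * t ^ (2 * m + 1)))\<bar> \<le> C * t ^ (2 * n + 1)"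
proof (intro exI allI impI)
  fix t :: real assume t: "t > 0"
  let ?r = "2 * x"
  let ?P = "\<Sum>m<n. (-1) ^ m * t ^ (2 * m + 1) / ?r ^ (2 * m + 2)"
  let ?T = "\<Sum>m<n. (-1) ^ m * t ^ (2 * m + 1) * tail_coeff N \<alpha> ?r (2 * m + 2)"
  let ?u = "t ^ (2 * n + 1) / ?r ^ (2 * n + 2)"
  have r: "?r > 0" using assms by simp
  have sum: "(\<Sum>m<n. c m * t ^ (2 * m + 1)) = - 1 / pi * ?P + 2 / (N * pi) * (?P - \<alpha> * ?T)"
    unfolding c_def sum_distrib_left sum.distrib[symmetric] sum_subtractf[symmetric] right_diff_distrib
    by (intro sum.cong refl) (simp add: algebra_simps)
  have a0: "cylinder_a t 0 = 1 / pi / t"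
    using t by (simp add: cylinder_a_def poisson_def power2_eq_square)
  have eq: "cylinder_a t 0 - cylinder_a t ?r + cylinder_b N \<alpha> t ?r - (1 / pi / t + (\<Sum>m<n. c m * t ^ (2 * m + 1))) =
     - 1 / pi * (poisson t ?r - ?P) + 2 / (N * pi) * ((poisson t ?r - ?P) - \<alpha> * (poisson_tail N \<alpha> t ?r - ?T))"
    unfolding sum a0 unfolding cylinder_a_def cylinder_b_def by (simp add: algebra_simps diff_divide_distrib)
  have 1: "\<bar>poisson t ?r - ?P\<bar> \<le> ?u" by (rule poisson_expansion_bound[OF t r])
  have "\<bar>\<alpha> * (poisson_tail N \<alpha> t ?r - ?T)\<bar> = \<alpha> * \<bar>poisson_tail N \<alpha> t ?r - ?T\<bar>"
    using assms by (simp add: abs_mult)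
  also have "\<dots> \<le> \<alpha> * (?u / \<alpha>)"
    using assms by (intro mult_left_mono poisson_tail_expansion_bound t r) auto
  finally have 2: "\<bar>\<alpha> * (poisson_tail N \<alpha> t ?r - ?T)\<bar> \<le> ?u" using assms by simp
  have 3: "\<bar>(poisson t ?r - ?P) - \<alpha> * (poisson_tail N \<alpha> t ?r - ?T)\<bar> \<le> 2 * ?u"
    using 1 2 by linarith
  have "\<bar>- 1 / pi * (poisson t ?r - ?P)\<bar> \<le> 1 / pi * ?u"
    using mult_left_mono[OF 1, of "1 / pi"] by (simp add: abs_mult)
  moreover have "\<bar>2 / (N * pi) * ((poisson t ?r - ?P) - \<alpha> * (poisson_tail N \<alpha> t ?r - ?T))\<bar> \<le> 2 / (N * pi) * (2 * ?u)"
    unfolding abs_mult[of "2 / (N * pi)"] using assms by (intro mult_mono 3) auto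
  ultimately have "\<bar>cylinder_a t 0 - cylinder_a t ?r + cylinder_b N \<alpha> t ?r - (1 / pi / t + (\<Sum>m<n. c m * t ^ (2 * m + 1)))\<bar>
      \<le> 1 / pi * ?u + 2 / (N * pi) * (2 * ?u)"
    unfolding eq by linarith
  also have "\<dots> = (1 / pi + 4 / (N * pi)) / ?r ^ (2 * n + 2) * t ^ (2 * n + 1)"
    by (simp add: distrib_right add_divide_distrib)
  finally show "\<bar>cylinder_a t 0 - cylinder_a t ?r + cylinder_b N \<alpha> t ?r - (1 / pi / t + (\<Sum>m<n. c m * t ^ (2 * m + 1)))\<bar>
      \<le> (1 / pi + 4 / (N * pi)) / ?r ^ (2 * n + 2) * t ^ (2 * n + 1)" .
qed

section \<open>The exponential integral and the coefficient of t\<close>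

text \<open>Substituting w = z + \<alpha> q with z = \<alpha> r / N turns w into (\<alpha> / N) (r +
  N q) and splits off the factor exp (- z).\<close>

lemma tail_coeff_1:
  assumes "\<alpha> > 0" "N > 0" "r > 0"
  shows "tail_coeff N \<alpha> r 1 = - exp (\<alpha> * r / N) / N * Ei (- (\<alpha> * r / N))"
proof -
  define z where "z = \<alpha> * r / N"
  have z: "z > 0" using assms by (simp add: z_def)
  have "- Ei (- z) = (LINT w|lborel. indicator {z..} w *\<^sub>R (exp (- w) / w))"
    by (simp add: Ei_def set_lebesgue_integral_def)
  also have "\<dots> = \<bar>\<alpha>\<bar> *\<^sub>R (LINT q|lborel. indicator {z..} (z + \<alpha> * q) *\<^sub>R (exp (- (z + \<alpha> * q)) / (z + \<alpha> * q)))"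
    using assms by (intro lborel_integral_real_affine) simp
  also have "(LINT q|lborel. indicator {z..} (z + \<alpha> * q) *\<^sub>R (exp (- (z + \<alpha> * q)) / (z + \<alpha> * q))) =
      (LINT q|lborel. indicator {0<..} q *\<^sub>R (exp (- z) * N / \<alpha> * (exp (- \<alpha> * q) / (r + N * q) ^ 1)))"
  proof (rule integral_cong_AE)
    show "AE q in lborel. indicator {z..} (z + \<alpha> * q) *\<^sub>R (exp (- (z + \<alpha> * q)) / (z + \<alpha> * q)) =
        indicator {0<..} q *\<^sub>R (exp (- z) * N / \<alpha> * (exp (- \<alpha> * q) / (r + N * q) ^ 1))"
      using AE_lborel_singleton[of 0]
    proof eventually_elim
      case (elim q)
      have i: "z + \<alpha> * q \<in> {z..} \<longleftrightarrow> q \<in> {0<..}"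
        using assms elim by (auto simp: zero_le_mult_iff)
      have "z + \<alpha> * q = \<alpha> / N * (r + N * q)" using assms by (simp add: z_def field_simps)
      moreover have "exp (- (z + \<alpha> * q)) = exp (- z) * exp (- \<alpha> * q)"
        unfolding mult_exp_exp by (simp add: algebra_simps)
      ultimately have "exp (- (z + \<alpha> * q)) / (z + \<alpha> * q) = exp (- z) * N / \<alpha> * (exp (- \<alpha> * q) / (r + N * q) ^ 1)"
        by simp
      then show ?case using i by (simp add: indicator_def)
    qed
  qed measurable
  also have "\<dots> = (LINT q|half_line. exp (- z) * N / \<alpha> * (exp (- \<alpha> * q) / (r + N * q) ^ 1))"
    by (subst integral_restrict_space) auto
  also have "\<dots> = exp (- z) * N / \<alpha> * tail_coeff N \<alpha> r 1"
    unfolding tail_coeff_def integral_mult_right_zero ..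
  finally have "- Ei (- z) = exp (- z) * N * tail_coeff N \<alpha> r 1" using assms by simp
  then have "tail_coeff N \<alpha> r 1 = - exp z / N * Ei (- z)"
    using assms by (simp add: exp_minus field_simps)
  then show ?thesis by (simp add: z_def)
qed

text \<open>Integrating the derivative of - exp (- \<alpha> q) / (N (r + N q)) trades the square in
  the denominator for a first power; the boundary value at q = 0 is the term 1 / (N r).\<close>

lemma tail_coeff_2:
  assumes "\<alpha> > 0" "N > 0" "r > 0"
  shows "tail_coeff N \<alpha> r 2 = 1 / (N * r) - \<alpha> / N * tail_coeff N \<alpha> r 1"
proof -
  let ?F = "\<lambda>q. - (exp (- \<alpha> * q) / (N * (r + N * q)))"
  let ?f = "\<lambda>q. exp (- \<alpha> * q) / (r + N * q) ^ 2 + \<alpha> / N * (exp (- \<alpha> * q) / (r + N * q) ^ 1)"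
  note i = tail_coeff_integrable[OF assms]
  have int: "integrable half_line ?f"
    by (intro Bochner_Integration.integrable_add integrable_mult_right i)
  have p: "0 < r + N * q" if "q > 0" for q using assms that by (simp add: add_pos_pos)
  have "(LINT q|half_line. ?f q) = 0 - (- (1 / (N * r)))"
  proof (rule half_line_FTC[OF _ _ int])
    show "(?F has_real_derivative ?f q) (at q)" if "q > 0" for q
      using p[OF that] assms
      by (auto intro!: derivative_eq_intros simp: divide_simps; simp add: algebra_simps power2_eq_square)
    show "isCont ?f q" if "q > 0" for q
      using p[OF that] by (intro continuous_intros) auto
    have "isCont ?F 0" using assms by (intro continuous_intros) auto
    then show "(?F \<longlongrightarrow> - (1 / (N * r))) (at_right 0)"
      by (auto simp: isCont_def intro: tendsto_within_subset)
    show "(?F \<longlongrightarrow> 0) at_top" using assms by real_asymp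
  qed
  moreover have "(LINT q|half_line. ?f q) = (LINT q|half_line. exp (- \<alpha> * q) / (r + N * q) ^ 2) +
      (LINT q|half_line. \<alpha> / N * (exp (- \<alpha> * q) / (r + N * q) ^ 1))"
    by (intro Bochner_Integration.integral_add integrable_mult_right i)
  ultimately show ?thesis
    unfolding tail_coeff_def integral_mult_right_zero by linarith
qed

theorem mainTheorem8:
  fixes \<alpha> x :: real and j :: "'n::finite"
    and E :: "real set \<Rightarrow> 'n wave \<Rightarrow> 'n wave"
  assumes "\<alpha> > 0"
    and "is_spectral_measure_of E (star_hamiltonian \<alpha>)"
    and "x > 0"
  defines "N \<equiv> real CARD('n)"
  shows "vacuum_energy_density E j x = of_real (
           (1 - 2 / N) * (1 / (8 * pi * x\<^sup>2)) + \<alpha> / (2 * pi * N\<^sup>2 * x)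
           + \<alpha>\<^sup>2 / (pi * N ^ 3) * exp (2 * \<alpha> * x / N) * Ei (- (2 * \<alpha> * x / N)))"
proof -
  interpret star_spectral E \<alpha> N
    using assms(1,2) by unfold_locales (auto simp: is_spectral_measure_of_def N_def)
  have N0: "N > 0" using N_ge_1 by simp
  define c where "c m = (-1) ^ m * (- 1 / (pi * (2 * x) ^ (2 * m + 2)) +
    2 / (N * pi) * (1 / (2 * x) ^ (2 * m + 2) - \<alpha> * tail_coeff N \<alpha> (2 * x) (2 * m + 2)))" for m
  let ?F = "\<lambda>t. cylinder_kernel E t j j x x"
  have F: "?F t = of_real (cylinder_a t 0 - cylinder_a t (2 * x) + cylinder_b N \<alpha> t (2 * x))" if "t > 0" for t
    using cylinder_kernel_eq[OF that assms(3,3), of j j] by (simp add: G\<^sub>0_def star_kernel_def)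
  have "has_asymptotic_expansion ?F (odd_coeff (of_real (1 / pi)) c)"
  proof (rule odd_expansion)
    fix n
    from diagonal_expansion[OF assms(3,1) N0, of n]
    obtain C where C: "\<And>t. t > 0 \<Longrightarrow> \<bar>cylinder_a t 0 - cylinder_a t (2 * x) + cylinder_b N \<alpha> t (2 * x) -
      (1 / pi / t + (\<Sum>m<n. c m * t ^ (2 * m + 1)))\<bar> \<le> C * t ^ (2 * n + 1)"
      unfolding c_def by blast
    show "\<exists>C. \<forall>t>0. cmod (?F t - (of_real (1 / pi) / of_real t + (\<Sum>m<n. of_real (c m * t ^ (2 * m + 1)))))
        \<le> C * t ^ (2 * n + 1)"
    proof (intro exI allI impI)
      fix t :: real assume t: "t > 0"
      have "?F t - (of_real (1 / pi) / of_real t + (\<Sum>m<n. of_real (c m * t ^ (2 * m + 1)))) =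
         of_real (cylinder_a t 0 - cylinder_a t (2 * x) + cylinder_b N \<alpha> t (2 * x) -
           (1 / pi / t + (\<Sum>m<n. c m * t ^ (2 * m + 1))))"
        unfolding F[OF t] by simp
      then show "cmod (?F t - (of_real (1 / pi) / of_real t + (\<Sum>m<n. of_real (c m * t ^ (2 * m + 1)))))
        \<le> C * t ^ (2 * n + 1)"
        using C[OF t] by (simp only: norm_of_real)
    qed
  qed
  then have "asymptotic_coeff ?F 1 = odd_coeff (of_real (1 / pi)) c 1"
    by (rule asymptotic_coeff_eq)
  \<comment> \<open>Exponent 1 is 2 m + 1 with m = 0; the divergence 1 / (pi t) sits at exponent -1
    and does not contribute.\<close>
  also have "\<dots> = of_real (c 0)" by (simp add: odd_coeff_def)
  finally have V: "vacuum_energy_density E j x = of_real (- (1 / 2) * c 0)"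
    by (simp add: vacuum_energy_density_def)
  \<comment> \<open>The point and its mirror image are 2 x apart, so r = 2 x. The boundary value
    becomes the 1 / x term of the density and the remaining integral its Ei term; the image and
    Kirchhoff parts make up (1 - 2 / N) / (8 pi x^2).\<close>
  have "tail_coeff N \<alpha> (2 * x) 2 = 1 / (N * (2 * x)) + \<alpha> / N\<^sup>2 * (exp (2 * \<alpha> * x / N) * Ei (- (2 * \<alpha> * x / N)))"
    using tail_coeff_2[OF assms(1) N0, of "2 * x"] tail_coeff_1[OF assms(1) N0, of "2 * x"] assms(3)
    by (simp add: power2_eq_square mult.left_commute mult.assoc)
  then have "- (1 / 2) * c 0 = (1 - 2 / N) * (1 / (8 * pi * x\<^sup>2)) + \<alpha> / (2 * pi * N\<^sup>2 * x)
           + \<alpha>\<^sup>2 / (pi * N ^ 3) * (exp (2 * \<alpha> * x / N) * Ei (- (2 * \<alpha> * x / N)))"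
    using assms(3) N0 unfolding c_def
    by (simp add: numeral_2_eq_2[symmetric]) (simp add: field_simps power2_eq_square power3_eq_cube)
  then show ?thesis unfolding V by (simp only: mult.assoc)
qed

end
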